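(* Let $l\ge 3$ be odd and $d=2l-1$ (so $d\equiv 1\pmod 4$). On the hypercubic lattice $\mathbb{Z}^d$ place two qubits, of types $A$ and $B$, on every $l$-cell. For $\alpha\in\{A,B\}$ and each $(l-1)$-cell $r$ set $G^\alpha_r=X^\alpha_{\delta \boldsymbol r}\prod_{s'}(Z^\alpha_{s'})^{\int \delta\boldsymbol r\cup_1\boldsymbol s'}$, and for each $l$-cell $s$ set $$\overline Z^A_s=Z^A_s\prod_{r}(G^B_r)^{\int \boldsymbol s\cup\boldsymbol r},\qquad \overline Z^B_s=Z^B_s\prod_{r}(G^A_r)^{\int \boldsymbol r\cup\boldsymbol s},$$ $$U^\alpha_s=X^\alpha_s\prod_{s'}(Z^\alpha_{s'})^{\int\boldsymbol s'\cup_1\boldsymbol s},\qquad \overline X^\alpha_s=U^\alpha_s\prod_{s'}(\overline Z^\alpha_{s'})^{\int\boldsymbol s'\cup_1\boldsymbol s}.$$ Then the Clifford QCA given by $X^\alpha_s\mapsto\overline X^\alpha_s$, $Z^\alpha_s\mapsto\overline Z^\alpha_s$ is trivial up to a (not necessarily Clifford) finite-depth quantum circuit: possibly after adding ancilla qubits on which it acts as the identity, it is a composition of finite-depth quantum circuits (with arbitrary, in particular non-Clifford, local gates) and lattice shifts.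
   Context: An $n$-cell of $\mathbb{Z}^d$ is a pair $(v,I)$, $v\in\mathbb{Z}^d$, $I\subset[d]=\{1,\dots,d\}$, $|I|=n$, representing the cube $v+\{\sum_{i\in I}t_ie_i: t_i\in[0,1]\}$. Bold $\boldsymbol{s}$ is the indicator cochain of the cell $s$. The mod-2 boundary is $\partial(v,I)=\sum_{i\in I}\big[(v,I\setminus\{i\})+(v+e_i,I\setminus\{i\})\big]$, and $\delta a(c)=a(\partial c)$ for $\mathbb{Z}_2$-valued cochains. For $e_I:=\sum_{i\in I}e_i$ and cochains $a,b$ of degrees $p,q$: if $p+q=d$, $(a\cup b)(v,[d])=\sum_{I\sqcup J=[d],|I|=p}a(v,I)\,b(v+e_I,J)$; if $p+q=d+1$, $(a\cup_1b)(v,[d])=\sum_{c\in[d]}\sum_{I'\sqcup J'=[d]\setminus\{c\},\,|I'|=p-1}a\big(v+\sum_{j\in J',j>c}e_j,\ I'\cup\{c\}\big)\,b\big(v+\sum_{i\in I',i<c}e_i,\ J'\cup\{c\}\big)$. $\int$ is the sum of values over all $d$-cells, mod 2; $X_{\delta\boldsymbol r}=\prod_sX_s^{(\delta\boldsymbol r)(s)}$. The products run over $(l-1)$-cells $r$ and $l$-cells $s'$. A QCA is a locality-preserving automorphism of the algebra of local operators: every operator is mapped to one supported within a fixed finite distance of its support. The images $\overline X,\overline Z$ are multiplied by phases making them Hermitian involutions, so that the assignment defines such an automorphism; the choice of the remaining signs is immaterial, since different choices differ by conjugation by a product of single-qubit Pauli operators. A finite-depth quantum circuit is a composition of finitely many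 layers, each layer being conjugation by a product of unitaries with disjoint supports of uniformly bounded diameter. A shift is a locality-preserving permutation of qubits. The QCA above is the one associated with the topological action $\frac12\int A_l\cup A_l+A_l\cup B_l+B_l\cup B_l$. *)

theory Defs
  imports Complex_Main "HOL-Library.Z2" "HOL-Combinatorics.Permutations"
begin

text \<open>
  An operator is given by its matrix entries between configurations of all qubits (the entry
  \<open>k \<sigma> \<tau>\<close> is the coefficient of the basis state \<open>\<sigma>\<close> in the image of \<open>\<tau>\<close>). The predicate
  \<open>acts_on F k\<close> says that \<open>k\<close> is a matrix on the qubits in \<open>F\<close> tensored with the identity on all
  other qubits. The type of local operators is the union over finite \<open>F\<close>, i.e. the
  algebraic infinite tensor product of copies of the algebra of 2 by 2 matrices.
\<close>

definition acts_on :: "'q set \<Rightarrow> (('q \<Rightarrow> bool) \<Rightarrow> ('q \<Rightarrow> bool) \<Rightarrow> complex) \<Rightarrow> bool" where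
  "acts_on F k \<longleftrightarrow>
     (\<forall>\<sigma> \<tau>. k \<sigma> \<tau> \<noteq> 0 \<longrightarrow> (\<forall>q. q \<notin> F \<longrightarrow> \<sigma> q = \<tau> q)) \<and>
     (\<forall>\<sigma> \<tau> \<rho>. (\<forall>q. q \<notin> F \<longrightarrow> \<sigma> q = \<tau> q) \<longrightarrow>
        k (override_on \<rho> \<sigma> F) (override_on \<rho> \<tau> F) = k \<sigma> \<tau>)"

definition agree_off :: "'q set \<Rightarrow> ('q \<Rightarrow> bool) \<Rightarrow> ('q \<Rightarrow> bool) set" where
  "agree_off F \<sigma> = {\<rho>. \<forall>q. q \<notin> F \<longrightarrow> \<rho> q = \<sigma> q}"

lemma finite_agree_off: "finite F \<Longrightarrow> finite (agree_off F \<sigma>)"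
proof -
  assume F: "finite F"
  have "agree_off F \<sigma> \<subseteq> (\<lambda>S q. if q \<in> F then q \<in> S else \<sigma> q) ` Pow F"
  proof
    fix \<rho> assume "\<rho> \<in> agree_off F \<sigma>"
    then have "\<rho> = (\<lambda>q. if q \<in> F then q \<in> {p \<in> F. \<rho> p} else \<sigma> q)"
      by (auto simp: agree_off_def fun_eq_iff)
    then show "\<rho> \<in> (\<lambda>S q. if q \<in> F then q \<in> S else \<sigma> q) ` Pow F" by blast
  qed
  then show ?thesis using F finite_subset by blast
qed

lemma acts_on_supp: "acts_on F k \<Longrightarrow> k \<sigma> \<tau> \<noteq> 0 \<Longrightarrow> q \<notin> F \<Longrightarrow> \<sigma> q = \<tau> q"
  unfolding acts_on_def by blast

lemma acts_on_inv:
  "acts_on F k \<Longrightarrow> (\<And>q. q \<notin> F \<Longrightarrow> \<sigma> q = \<tau> q) \<Longrightarrow>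
     k (override_on \<rho> \<sigma> F) (override_on \<rho> \<tau> F) = k \<sigma> \<tau>"
  unfolding acts_on_def by blast

lemma acts_on_mono:
  assumes k: "acts_on F k" and FG: "F \<subseteq> G"
  shows "acts_on G k"
  unfolding acts_on_def
proof (intro conjI allI impI)
  fix \<sigma> \<tau> q assume "k \<sigma> \<tau> \<noteq> 0" "q \<notin> G"
  then show "\<sigma> q = \<tau> q" using acts_on_supp[OF k] FG by blast
next
  fix \<sigma> \<tau> \<rho> :: "'a \<Rightarrow> bool"
  assume eq: "\<forall>q. q \<notin> G \<longrightarrow> \<sigma> q = \<tau> q"
  show "k (override_on \<rho> \<sigma> G) (override_on \<rho> \<tau> G) = k \<sigma> \<tau>"
  proof (cases "\<forall>q. q \<notin> F \<longrightarrow> \<sigma> q = \<tau> q")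
    case True
    have *: "override_on \<rho> \<sigma> G = override_on (override_on \<rho> \<sigma> G) \<sigma> F"
      "override_on \<rho> \<tau> G = override_on (override_on \<rho> \<sigma> G) \<tau> F"
      using FG True by (auto simp: override_on_def fun_eq_iff)
    show ?thesis using acts_on_inv[OF k, of \<sigma> \<tau> "override_on \<rho> \<sigma> G"] True * by metis
  next
    case False
    then obtain q where q: "q \<notin> F" "\<sigma> q \<noteq> \<tau> q" by blast
    then have "q \<in> G" using eq by blast
    then have "override_on \<rho> \<sigma> G q \<noteq> override_on \<rho> \<tau> G q" using q by simp
    then show ?thesis using acts_on_supp[OF k] q by metis
  qed
qed

definition kmult :: "(('q \<Rightarrow> bool) \<Rightarrow> ('q \<Rightarrow> bool) \<Rightarrow> complex) \<Rightarrow>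
    (('q \<Rightarrow> bool) \<Rightarrow> ('q \<Rightarrow> bool) \<Rightarrow> complex) \<Rightarrow> ('q \<Rightarrow> bool) \<Rightarrow> ('q \<Rightarrow> bool) \<Rightarrow> complex" where
  "kmult k k' \<sigma> \<tau> = (\<Sum>\<rho> | k \<sigma> \<rho> \<noteq> 0. k \<sigma> \<rho> * k' \<rho> \<tau>)"

lemma kmult_eq:
  assumes "finite F" "acts_on F k"
  shows "kmult k k' \<sigma> \<tau> = (\<Sum>\<rho>\<in>agree_off F \<sigma>. k \<sigma> \<rho> * k' \<rho> \<tau>)"
  unfolding kmult_def
proof (rule sum.mono_neutral_left)
  show "finite (agree_off F \<sigma>)" using assms finite_agree_off by blast
  show "{\<rho>. k \<sigma> \<rho> \<noteq> 0} \<subseteq> agree_off F \<sigma>"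
  proof
    fix \<rho> assume "\<rho> \<in> {\<rho>. k \<sigma> \<rho> \<noteq> 0}"
    then have "k \<sigma> \<rho> \<noteq> 0" by simp
    then show "\<rho> \<in> agree_off F \<sigma>"
      using acts_on_supp[OF assms(2)] unfolding agree_off_def by blast
  qed
qed auto

lemma agree_off_cong: "\<rho> \<in> agree_off F \<sigma> \<Longrightarrow> agree_off F \<rho> = agree_off F \<sigma>"
  by (auto simp: agree_off_def)

lemma acts_on_kmult:
  assumes F: "finite F" and k: "acts_on F k" and k': "acts_on F k'"
  shows "acts_on F (kmult k k')"
  unfolding acts_on_def
proof (intro conjI allI impI)
  fix \<sigma> \<tau> q assume nz: "kmult k k' \<sigma> \<tau> \<noteq> 0" and q: "q \<notin> F"
  obtain \<rho> where "k \<sigma> \<rho> * k' \<rho> \<tau> \<noteq> 0"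
    using nz unfolding kmult_def by (meson sum.neutral)
  then have "k \<sigma> \<rho> \<noteq> 0" "k' \<rho> \<tau> \<noteq> 0" by auto
  then have "\<sigma> q = \<rho> q" "\<rho> q = \<tau> q"
    using acts_on_supp[OF k _ q] acts_on_supp[OF k' _ q] by blast+
  then show "\<sigma> q = \<tau> q" by simp
next
  fix \<sigma> \<tau> \<rho> :: "'a \<Rightarrow> bool"
  assume eq: "\<forall>q. q \<notin> F \<longrightarrow> \<sigma> q = \<tau> q"
  have bij: "bij_betw (\<lambda>\<kappa>. override_on \<rho> \<kappa> F) (agree_off F \<sigma>) (agree_off F (override_on \<rho> \<sigma> F))"
    by (rule bij_betw_byWitness[where f' = "\<lambda>\<kappa>. override_on \<sigma> \<kappa> F"])
      (auto simp: agree_off_def override_on_def fun_eq_iff)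
  have "kmult k k' (override_on \<rho> \<sigma> F) (override_on \<rho> \<tau> F) =
      (\<Sum>\<kappa>\<in>agree_off F (override_on \<rho> \<sigma> F).
         k (override_on \<rho> \<sigma> F) \<kappa> * k' \<kappa> (override_on \<rho> \<tau> F))"
    by (rule kmult_eq[OF F k])
  also have "\<dots> = (\<Sum>\<kappa>\<in>agree_off F \<sigma>. k (override_on \<rho> \<sigma> F) (override_on \<rho> \<kappa> F) *
         k' (override_on \<rho> \<kappa> F) (override_on \<rho> \<tau> F))"
    by (rule sum.reindex_bij_betw[OF bij, symmetric])
  also have "\<dots> = (\<Sum>\<kappa>\<in>agree_off F \<sigma>. k \<sigma> \<kappa> * k' \<kappa> \<tau>)"
    by (rule sum.cong[OF refl], subst acts_on_inv[OF k], simp add: agree_off_def,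
        subst acts_on_inv[OF k'], use eq in \<open>simp add: agree_off_def\<close>, simp)
  also have "\<dots> = kmult k k' \<sigma> \<tau>" by (rule kmult_eq[OF F k, symmetric])
  finally show "kmult k k' (override_on \<rho> \<sigma> F) (override_on \<rho> \<tau> F) = kmult k k' \<sigma> \<tau>" .
qed

lemma acts_on_zero: "acts_on F (\<lambda>\<sigma> \<tau>. 0)"
  by (simp add: acts_on_def)

lemma acts_on_one: "acts_on F (\<lambda>\<sigma> \<tau>. if \<sigma> = \<tau> then 1 else 0)"
proof -
  have "override_on \<rho> \<sigma> F = override_on \<rho> \<tau> F \<longleftrightarrow> \<sigma> = \<tau>"
    if "\<forall>q. q \<notin> F \<longrightarrow> \<sigma> q = \<tau> q" for \<sigma> \<tau> \<rho> :: "'a \<Rightarrow> bool"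
  proof
    assume eq: "override_on \<rho> \<sigma> F = override_on \<rho> \<tau> F"
    show "\<sigma> = \<tau>"
    proof
      fix q show "\<sigma> q = \<tau> q"
        using that fun_cong[OF eq, of q] by (cases "q \<in> F") simp_all
    qed
  qed simp
  then show ?thesis by (simp add: acts_on_def)
qed

lemma override_on_singleton: "override_on f g {q} = f(q := g q)"
  by (rule ext) (simp add: override_on_def)

lemma acts_on_add:
  assumes "acts_on F k" "acts_on F k'"
  shows "acts_on F (\<lambda>\<sigma> \<tau>. k \<sigma> \<tau> + k' \<sigma> \<tau>)"
  unfolding acts_on_def
proof (intro conjI allI impI)
  fix \<sigma> \<tau> q assume "k \<sigma> \<tau> + k' \<sigma> \<tau> \<noteq> 0" and q: "q \<notin> F"
  then have "k \<sigma> \<tau> \<noteq> 0 \<or> k' \<sigma> \<tau> \<noteq> 0" by auto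
  then show "\<sigma> q = \<tau> q" using assms q acts_on_supp by metis
next
  fix \<sigma> \<tau> \<rho> :: "'a \<Rightarrow> bool"
  assume "\<forall>q. q \<notin> F \<longrightarrow> \<sigma> q = \<tau> q"
  then show "k (override_on \<rho> \<sigma> F) (override_on \<rho> \<tau> F) +
      k' (override_on \<rho> \<sigma> F) (override_on \<rho> \<tau> F) = k \<sigma> \<tau> + k' \<sigma> \<tau>"
    using assms by (simp add: acts_on_inv)
qed

lemma acts_on_scale: "acts_on F k \<Longrightarrow> acts_on F (\<lambda>\<sigma> \<tau>. c * k \<sigma> \<tau>)"
  unfolding acts_on_def by auto

lemma acts_on_adjoint: "acts_on F k \<Longrightarrow> acts_on F (\<lambda>\<sigma> \<tau>. cnj (k \<tau> \<sigma>))"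
  unfolding acts_on_def by (intro conjI allI impI; simp; metis)

typedef 'q local_op =
  "{k :: ('q \<Rightarrow> bool) \<Rightarrow> ('q \<Rightarrow> bool) \<Rightarrow> complex. \<exists>F. finite F \<and> acts_on F k}"
  morphisms entry Local_Op
  using acts_on_zero by blast

setup_lifting type_definition_local_op

lemma two_supports:
  assumes "\<exists>F. finite F \<and> acts_on F k" "\<exists>F. finite F \<and> acts_on F k'"
  obtains F where "finite F" "acts_on F k" "acts_on F k'"
proof -
  obtain F G where "finite F" "acts_on F k" "finite G" "acts_on G k'" using assms by blast
  then show ?thesis
    using that[of "F \<union> G"] acts_on_mono[of F k "F \<union> G"] acts_on_mono[of G k' "F \<union> G"] by simp
qed

lemma kmult_assoc:
  assumes F: "finite F" and k: "acts_on F k" and k': "acts_on F k'"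
  shows "kmult (kmult k k') k'' = kmult k (kmult k' k'')"
proof (intro ext)
  fix \<sigma> \<tau>
  have "kmult (kmult k k') k'' \<sigma> \<tau> =
      (\<Sum>\<rho>\<in>agree_off F \<sigma>. \<Sum>\<kappa>\<in>agree_off F \<sigma>. k \<sigma> \<kappa> * k' \<kappa> \<rho> * k'' \<rho> \<tau>)"
    by (simp add: kmult_eq[OF F acts_on_kmult[OF F k k']] kmult_eq[OF F k] sum_distrib_right)
  also have "\<dots> = (\<Sum>\<kappa>\<in>agree_off F \<sigma>. \<Sum>\<rho>\<in>agree_off F \<sigma>. k \<sigma> \<kappa> * k' \<kappa> \<rho> * k'' \<rho> \<tau>)"
    by (rule sum.swap)
  also have "\<dots> = (\<Sum>\<kappa>\<in>agree_off F \<sigma>. k \<sigma> \<kappa> * kmult k' k'' \<kappa> \<tau>)"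
    by (rule sum.cong[OF refl])
      (simp add: kmult_eq[OF F k'] agree_off_cong sum_distrib_left mult.assoc)
  also have "\<dots> = kmult k (kmult k' k'') \<sigma> \<tau>"
    by (rule kmult_eq[OF F k, symmetric])
  finally show "kmult (kmult k k') k'' \<sigma> \<tau> = kmult k (kmult k' k'') \<sigma> \<tau>" .
qed

instantiation local_op :: (type) ring_1
begin

lift_definition zero_local_op :: "'a local_op" is "\<lambda>\<sigma> \<tau>. 0"
  using acts_on_zero by blast

lift_definition one_local_op :: "'a local_op" is "\<lambda>\<sigma> \<tau>. if \<sigma> = \<tau> then 1 else 0"
  using acts_on_one by blast

lift_definition plus_local_op :: "'a local_op \<Rightarrow> 'a local_op \<Rightarrow> 'a local_op"
  is "\<lambda>k k' \<sigma> \<tau>. k \<sigma> \<tau> + k' \<sigma> \<tau>"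
  by (erule (1) two_supports) (blast intro: acts_on_add)

lift_definition uminus_local_op :: "'a local_op \<Rightarrow> 'a local_op" is "\<lambda>k \<sigma> \<tau>. - k \<sigma> \<tau>"
  using acts_on_scale[where c = "-1"] by fastforce

lift_definition minus_local_op :: "'a local_op \<Rightarrow> 'a local_op \<Rightarrow> 'a local_op"
  is "\<lambda>k k' \<sigma> \<tau>. k \<sigma> \<tau> - k' \<sigma> \<tau>"
proof -
  fix k k' :: "('a \<Rightarrow> bool) \<Rightarrow> ('a \<Rightarrow> bool) \<Rightarrow> complex"
  assume "\<exists>F. finite F \<and> acts_on F k" "\<exists>F. finite F \<and> acts_on F k'"
  then obtain F where "finite F" "acts_on F k" "acts_on F k'" by (rule two_supports)
  then show "\<exists>F. finite F \<and> acts_on F (\<lambda>\<sigma> \<tau>. k \<sigma> \<tau> - k' \<sigma> \<tau>)"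
    using acts_on_add[of F k "\<lambda>\<sigma> \<tau>. -1 * k' \<sigma> \<tau>"] acts_on_scale[of F k' "-1"] by auto
qed

lift_definition times_local_op :: "'a local_op \<Rightarrow> 'a local_op \<Rightarrow> 'a local_op" is kmult
  by (erule (1) two_supports) (blast intro: acts_on_kmult)

instance
proof
  fix a b c :: "'a local_op"
  show "a * b * c = a * (b * c)"
    by transfer (erule (1) two_supports, rule kmult_assoc)
  show "1 * a = a"
  proof transfer
    fix k :: "('a \<Rightarrow> bool) \<Rightarrow> ('a \<Rightarrow> bool) \<Rightarrow> complex"
    show "kmult (\<lambda>\<sigma> \<tau>. if \<sigma> = \<tau> then 1 else 0) k = k"
    proof (intro ext)
      fix \<sigma> \<tau> :: "'a \<Rightarrow> bool"
      have "agree_off {} \<sigma> = {\<sigma>}" by (auto simp: agree_off_def)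
      then show "kmult (\<lambda>\<sigma> \<tau>. if \<sigma> = \<tau> then 1 else 0) k \<sigma> \<tau> = k \<sigma> \<tau>"
        by (simp add: kmult_eq[OF finite.emptyI acts_on_one])
    qed
  qed
  show "a * 1 = a"
  proof transfer
    fix k :: "('a \<Rightarrow> bool) \<Rightarrow> ('a \<Rightarrow> bool) \<Rightarrow> complex"
    assume "\<exists>F. finite F \<and> acts_on F k"
    then obtain F where F: "finite F" "acts_on F k" by blast
    show "kmult k (\<lambda>\<sigma> \<tau>. if \<sigma> = \<tau> then 1 else 0) = k"
    proof (intro ext)
      fix \<sigma> \<tau> :: "'a \<Rightarrow> bool"
      have "kmult k (\<lambda>\<sigma> \<tau>. if \<sigma> = \<tau> then 1 else 0) \<sigma> \<tau> =
          (\<Sum>\<rho>\<in>agree_off F \<sigma>. if \<rho> = \<tau> then k \<sigma> \<rho> else 0)"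
        unfolding kmult_eq[OF F] by (rule sum.cong) auto
      also have "\<dots> = (if \<tau> \<in> agree_off F \<sigma> then k \<sigma> \<tau> else 0)"
        by (simp add: finite_agree_off F sum.delta)
      also have "\<dots> = k \<sigma> \<tau>"
        using acts_on_supp[OF F(2), of \<sigma> \<tau>] by (auto simp: agree_off_def)
      finally show "kmult k (\<lambda>\<sigma> \<tau>. if \<sigma> = \<tau> then 1 else 0) \<sigma> \<tau> = k \<sigma> \<tau>" .
    qed
  qed
  show "(a + b) * c = a * c + b * c"
  proof transfer
    fix k k' k'' :: "('a \<Rightarrow> bool) \<Rightarrow> ('a \<Rightarrow> bool) \<Rightarrow> complex"
    assume "\<exists>F. finite F \<and> acts_on F k" "\<exists>F. finite F \<and> acts_on F k'"
    then obtain F where F: "finite F" "acts_on F k" "acts_on F k'" by (rule two_supports)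
    show "kmult (\<lambda>\<sigma> \<tau>. k \<sigma> \<tau> + k' \<sigma> \<tau>) k'' = (\<lambda>\<sigma> \<tau>. kmult k k'' \<sigma> \<tau> + kmult k' k'' \<sigma> \<tau>)"
      using F by (intro ext) (simp add: kmult_eq[OF F(1)] acts_on_add distrib_right sum.distrib)
  qed
  show "a * (b + c) = a * b + a * c"
    by transfer (simp add: kmult_def[abs_def] distrib_left sum.distrib)
  show "(0 :: 'a local_op) \<noteq> 1"
    by transfer (metis zero_neq_one)
  show "a + b + c = a + (b + c)" by transfer (simp add: add.assoc)
  show "a + b = b + a" by transfer (simp add: add.commute)
  show "0 + a = a" by transfer simp
  show "- a + a = 0" by transfer simp
  show "a - b = a + - b" by transfer simp
qed

end

lift_definition scale :: "complex \<Rightarrow> 'q local_op \<Rightarrow> 'q local_op" is "\<lambda>c k \<sigma> \<tau>. c * k \<sigma> \<tau>"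
  using acts_on_scale by blast

lift_definition adjoint_op :: "'q local_op \<Rightarrow> 'q local_op" is "\<lambda>k \<sigma> \<tau>. cnj (k \<tau> \<sigma>)"
  using acts_on_adjoint by blast

lift_definition pauli_X :: "'q \<Rightarrow> 'q local_op" is
  "\<lambda>q \<sigma> \<tau>. if \<sigma> = \<tau>(q := \<not> \<tau> q) then 1 else 0"
proof -
  fix q :: 'q
  have "\<rho>(q := \<sigma> q) = \<rho>(q := \<not> \<tau> q) \<longleftrightarrow> \<sigma> = \<tau>(q := \<not> \<tau> q)"
    if "\<forall>p. p \<noteq> q \<longrightarrow> \<sigma> p = \<tau> p" for \<sigma> \<tau> \<rho> :: "'q \<Rightarrow> bool"
  proof
    assume "\<rho>(q := \<sigma> q) = \<rho>(q := \<not> \<tau> q)"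
    then have "\<sigma> q = (\<not> \<tau> q)" by (rule fun_upd_eqD)
    with that show "\<sigma> = \<tau>(q := \<not> \<tau> q)" by (intro ext) simp
  next
    assume "\<sigma> = \<tau>(q := \<not> \<tau> q)"
    then have "\<sigma> q = (\<not> \<tau> q)" by (metis fun_upd_same)
    then show "\<rho>(q := \<sigma> q) = \<rho>(q := \<not> \<tau> q)" by simp
  qed
  then have "acts_on {q} (\<lambda>\<sigma> \<tau>. if \<sigma> = \<tau>(q := \<not> \<tau> q) then 1 else 0)"
    unfolding acts_on_def override_on_singleton by simp
  then show "\<exists>F. finite F \<and> acts_on F (\<lambda>\<sigma> \<tau>. if \<sigma> = \<tau>(q := \<not> \<tau> q) then 1 else (0::complex))"
    by (intro exI[of _ "{q}"]) simp
qed

lift_definition pauli_Z :: "'q \<Rightarrow> 'q local_op" is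
  "\<lambda>q \<sigma> \<tau>. if \<sigma> = \<tau> then (if \<sigma> q then -1 else 1) else 0"
proof -
  fix q :: 'q
  have "\<rho>(q := \<sigma> q) = \<rho>(q := \<tau> q) \<longleftrightarrow> \<sigma> = \<tau>"
    if "\<forall>p. p \<noteq> q \<longrightarrow> \<sigma> p = \<tau> p" for \<sigma> \<tau> \<rho> :: "'q \<Rightarrow> bool"
  proof
    assume "\<rho>(q := \<sigma> q) = \<rho>(q := \<tau> q)"
    then have "\<sigma> q = \<tau> q" by (rule fun_upd_eqD)
    with that show "\<sigma> = \<tau>" by (intro ext) metis
  qed simp
  then have "acts_on {q} (\<lambda>\<sigma> \<tau>. if \<sigma> = \<tau> then (if \<sigma> q then -1 else 1) else 0)"
    unfolding acts_on_def override_on_singleton by simp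
  then show "\<exists>F. finite F \<and>
      acts_on F (\<lambda>\<sigma> \<tau>. if \<sigma> = \<tau> then (if \<sigma> q then -1 else 1) else (0::complex))"
    by (intro exI[of _ "{q}"]) simp
qed

definition local_ops :: "'q set \<Rightarrow> 'q local_op set" where
  "local_ops S = {a. \<exists>F. finite F \<and> F \<subseteq> S \<and> acts_on F (entry a)}"

definition unitary_op :: "'q local_op \<Rightarrow> bool" where
  "unitary_op u \<longleftrightarrow> u * adjoint_op u = 1 \<and> adjoint_op u * u = 1"

definition hermitian_involution :: "'q local_op \<Rightarrow> bool" where
  "hermitian_involution a \<longleftrightarrow> adjoint_op a = a \<and> a * a = 1"

text \<open>
  Product of a finite family of operators, along an arbitrary enumeration of the index set.
  It is applied only to families of operators that commute, at least up to a sign; where signs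
  could matter (in the images of the Pauli operators) the result is used only up to a phase.
\<close>

definition op_prod :: "('i \<Rightarrow> 'q local_op) \<Rightarrow> 'i set \<Rightarrow> 'q local_op" where
  "op_prod f S = prod_list (map f (SOME xs. distinct xs \<and> set xs = S))"

text \<open>
  Points of the \<open>d\<close>-dimensional lattice are integer functions vanishing outside \<open>{1..d}\<close>.
\<close>

type_synonym point = "nat \<Rightarrow> int"
type_synonym cell = "point \<times> nat set"
type_synonym cochain = "cell \<Rightarrow> bit"

definition points :: "nat \<Rightarrow> point set" where
  "points d = {v. \<forall>i. i \<notin> {1..d} \<longrightarrow> v i = 0}"

definition cells :: "nat \<Rightarrow> nat \<Rightarrow> cell set" where
  "cells d n = {(v, I). v \<in> points d \<and> I \<subseteq> {1..d} \<and> card I = n}"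

definition translate :: "point \<Rightarrow> nat set \<Rightarrow> point" where
  "translate v S = (\<lambda>i. v i + (if i \<in> S then 1 else 0))"

definition ind :: "cell \<Rightarrow> cochain" where
  "ind s = (\<lambda>c. if c = s then 1 else 0)"

definition cobd :: "cochain \<Rightarrow> cochain" where
  "cobd a = (\<lambda>(v, I). \<Sum>i\<in>I. a (v, I - {i}) + a (translate v {i}, I - {i}))"

text \<open>
  The first argument \<open>p\<close> of the two products is the degree of the left factor. They are
  evaluated on \<open>d\<close>-cells \<open>(v, K)\<close>, for which \<open>K = {1..d}\<close>.
\<close>

definition cup :: "nat \<Rightarrow> cochain \<Rightarrow> cochain \<Rightarrow> cochain" where
  "cup p a b = (\<lambda>(v, K). \<Sum>I | I \<subseteq> K \<and> card I = p. a (v, I) * b (translate v I, K - I))"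

definition cup1 :: "nat \<Rightarrow> cochain \<Rightarrow> cochain \<Rightarrow> cochain" where
  "cup1 p a b = (\<lambda>(v, K). \<Sum>c\<in>K. \<Sum>I | I \<subseteq> K - {c} \<and> card I = p - 1.
     (let J = K - {c} - I in
        a (translate v {j \<in> J. c < j}, insert c I) *
        b (translate v {i \<in> I. i < c}, insert c J)))"

text \<open>Only integrals of cochains with finite support occur.\<close>

definition integral_cells :: "nat \<Rightarrow> cochain \<Rightarrow> bit" where
  "integral_cells d f = (\<Sum>c | c \<in> cells d d \<and> f c \<noteq> 0. f c)"

datatype species = SpA | SpB

datatype qubit = Cell_Qubit species cell | Ancilla point nat

fun pos :: "qubit \<Rightarrow> point" where
  "pos (Cell_Qubit \<alpha> s) = fst s"
| "pos (Ancilla v k) = v"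

definition near :: "nat \<Rightarrow> qubit \<Rightarrow> qubit \<Rightarrow> bool" where
  "near R p q \<longleftrightarrow> (\<forall>i. \<bar>pos p i - pos q i\<bar> \<le> int R)"

definition cell_qubits :: "nat \<Rightarrow> nat \<Rightarrow> qubit set" where
  "cell_qubits d l = {Cell_Qubit \<alpha> s | \<alpha> s. s \<in> cells d l}"

definition ancillas :: "nat \<Rightarrow> nat \<Rightarrow> qubit set" where
  "ancillas d m = {Ancilla v k | v k. v \<in> points d \<and> k < m}"

text \<open>
  In the following, \<open>Q\<close> is the set of qubits of the system, and a map between operators matters
  only through its values on \<open>local_ops Q\<close>.
\<close>

definition qca :: "qubit set \<Rightarrow> (qubit local_op \<Rightarrow> qubit local_op) \<Rightarrow> bool" where
  "qca Q \<Phi> \<longleftrightarrow>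
     bij_betw \<Phi> (local_ops Q) (local_ops Q) \<and>
     (\<forall>a\<in>local_ops Q. \<forall>b\<in>local_ops Q. \<Phi> (a + b) = \<Phi> a + \<Phi> b \<and> \<Phi> (a * b) = \<Phi> a * \<Phi> b) \<and>
     (\<forall>a\<in>local_ops Q. \<forall>c. \<Phi> (scale c a) = scale c (\<Phi> a)) \<and>
     (\<forall>a\<in>local_ops Q. \<Phi> (adjoint_op a) = adjoint_op (\<Phi> a)) \<and>
     (\<exists>R. \<forall>F\<subseteq>Q. \<forall>a\<in>local_ops F. \<Phi> a \<in> local_ops {q \<in> Q. \<exists>p\<in>F. near R p q})"

text \<open>
  A layer is given by a set \<open>P\<close> of disjoint blocks of bounded diameter and a unitary \<open>U B\<close> on each
  block \<open>B\<close>. Conjugation by the infinite product of all gates is, on an operator supported on a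
  finite set \<open>F\<close>, conjugation by the finite product of the gates whose block meets \<open>F\<close>.
\<close>

definition gate_layer :: "qubit set \<Rightarrow> (qubit local_op \<Rightarrow> qubit local_op) \<Rightarrow> bool" where
  "gate_layer Q \<Phi> \<longleftrightarrow>
     (\<exists>P U R. pairwise disjnt P \<and>
        (\<forall>B\<in>P. B \<subseteq> Q \<and> (\<forall>p\<in>B. \<forall>q\<in>B. near R p q) \<and> U B \<in> local_ops B \<and> unitary_op (U B)) \<and>
        (\<forall>F a. finite F \<and> F \<subseteq> Q \<and> a \<in> local_ops F \<longrightarrow>
           (let W = op_prod U {B \<in> P. B \<inter> F \<noteq> {}} in \<Phi> a = W * a * adjoint_op W)))"

definition composite :: "qubit set \<Rightarrow> (qubit local_op \<Rightarrow> qubit local_op) list \<Rightarrow>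
    (qubit local_op \<Rightarrow> qubit local_op) \<Rightarrow> bool" where
  "composite Q \<Lambda>s \<Phi> \<longleftrightarrow> (\<forall>a\<in>local_ops Q. \<Phi> a = foldr (\<circ>) \<Lambda>s id a)"

definition finite_depth_circuit :: "qubit set \<Rightarrow> (qubit local_op \<Rightarrow> qubit local_op) \<Rightarrow> bool" where
  "finite_depth_circuit Q \<Phi> \<longleftrightarrow> (\<exists>\<Lambda>s. (\<forall>\<Lambda>\<in>set \<Lambda>s. gate_layer Q \<Lambda>) \<and> composite Q \<Lambda>s \<Phi>)"

text \<open>The permutation \<open>\<pi>\<close> moves an operator at the qubit \<open>q\<close> to the qubit \<open>\<pi> q\<close>.\<close>

definition shift :: "qubit set \<Rightarrow> (qubit local_op \<Rightarrow> qubit local_op) \<Rightarrow> bool" where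
  "shift Q \<Phi> \<longleftrightarrow>
     (\<exists>\<pi> R. \<pi> permutes Q \<and> (\<forall>q\<in>Q. near R q (\<pi> q)) \<and>
        (\<forall>a\<in>local_ops Q. \<forall>\<sigma> \<tau>. entry (\<Phi> a) \<sigma> \<tau> = entry a (\<sigma> \<circ> \<pi>) (\<tau> \<circ> \<pi>)))"

definition circuits_and_shifts :: "qubit set \<Rightarrow> (qubit local_op \<Rightarrow> qubit local_op) \<Rightarrow> bool" where
  "circuits_and_shifts Q \<Phi> \<longleftrightarrow>
     (\<exists>\<Lambda>s. (\<forall>\<Lambda>\<in>set \<Lambda>s. finite_depth_circuit Q \<Lambda> \<or> shift Q \<Lambda>) \<and> composite Q \<Lambda>s \<Phi>)"

text \<open>
  Ancillas are added with a fixed finite number \<open>m\<close> per lattice point; \<open>\<Psi>\<close> below is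
  the extension of \<open>\<Phi>\<close> by the identity on the ancillas.
\<close>

definition trivial_qca :: "nat \<Rightarrow> nat \<Rightarrow> (qubit local_op \<Rightarrow> qubit local_op) \<Rightarrow> bool" where
  "trivial_qca d l \<Phi> \<longleftrightarrow>
     (\<exists>m \<Psi>. qca (cell_qubits d l \<union> ancillas d m) \<Psi> \<and>
        (\<forall>a\<in>local_ops (cell_qubits d l). \<Psi> a = \<Phi> a) \<and>
        (\<forall>a\<in>local_ops (ancillas d m). \<Psi> a = a) \<and>
        circuits_and_shifts (cell_qubits d l \<union> ancillas d m) \<Psi>)"

definition X_op :: "species \<Rightarrow> cell \<Rightarrow> qubit local_op" where
  "X_op \<alpha> s = pauli_X (Cell_Qubit \<alpha> s)"

definition Z_op :: "species \<Rightarrow> cell \<Rightarrow> qubit local_op" where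
  "Z_op \<alpha> s = pauli_Z (Cell_Qubit \<alpha> s)"

definition G_op :: "nat \<Rightarrow> nat \<Rightarrow> species \<Rightarrow> cell \<Rightarrow> qubit local_op" where
  "G_op d l \<alpha> r =
     op_prod (X_op \<alpha>) {s \<in> cells d l. cobd (ind r) s = 1} *
     op_prod (Z_op \<alpha>) {s' \<in> cells d l. integral_cells d (cup1 l (cobd (ind r)) (ind s')) = 1}"

definition Z_bar :: "nat \<Rightarrow> nat \<Rightarrow> species \<Rightarrow> cell \<Rightarrow> qubit local_op" where
  "Z_bar d l \<alpha> s = Z_op \<alpha> s *
     (case \<alpha> of
        SpA \<Rightarrow> op_prod (G_op d l SpB)
          {r \<in> cells d (l - 1). integral_cells d (cup l (ind s) (ind r)) = 1}
      | SpB \<Rightarrow> op_prod (G_op d l SpA)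
          {r \<in> cells d (l - 1). integral_cells d (cup (l - 1) (ind r) (ind s)) = 1})"

definition U_op :: "nat \<Rightarrow> nat \<Rightarrow> species \<Rightarrow> cell \<Rightarrow> qubit local_op" where
  "U_op d l \<alpha> s = X_op \<alpha> s *
     op_prod (Z_op \<alpha>) {s' \<in> cells d l. integral_cells d (cup1 l (ind s') (ind s)) = 1}"

definition X_bar :: "nat \<Rightarrow> nat \<Rightarrow> species \<Rightarrow> cell \<Rightarrow> qubit local_op" where
  "X_bar d l \<alpha> s = U_op d l \<alpha> s *
     op_prod (Z_bar d l \<alpha>) {s' \<in> cells d l. integral_cells d (cup1 l (ind s') (ind s)) = 1}"

text \<open>
  \<open>X'\<close> and \<open>Z'\<close> are choices of phase multiples of the images that are Hermitian involutions;
  each single image is thereby determined up to a sign.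
\<close>

definition hermitian_images :: "nat \<Rightarrow> nat \<Rightarrow> (species \<Rightarrow> cell \<Rightarrow> qubit local_op) \<Rightarrow>
    (species \<Rightarrow> cell \<Rightarrow> qubit local_op) \<Rightarrow> bool" where
  "hermitian_images d l X' Z' \<longleftrightarrow>
     (\<forall>\<alpha>. \<forall>s\<in>cells d l.
        (\<exists>c. cmod c = 1 \<and> X' \<alpha> s = scale c (X_bar d l \<alpha> s)) \<and> hermitian_involution (X' \<alpha> s) \<and>
        (\<exists>c. cmod c = 1 \<and> Z' \<alpha> s = scale c (Z_bar d l \<alpha> s)) \<and> hermitian_involution (Z' \<alpha> s))"

definition qca_given_by :: "nat \<Rightarrow> nat \<Rightarrow> (species \<Rightarrow> cell \<Rightarrow> qubit local_op) \<Rightarrow>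
    (species \<Rightarrow> cell \<Rightarrow> qubit local_op) \<Rightarrow> (qubit local_op \<Rightarrow> qubit local_op) \<Rightarrow> bool" where
  "qca_given_by d l X' Z' \<Phi> \<longleftrightarrow> qca (cell_qubits d l) \<Phi> \<and>
     (\<forall>\<alpha>. \<forall>s\<in>cells d l. \<Phi> (X_op \<alpha> s) = X' \<alpha> s \<and> \<Phi> (Z_op \<alpha> s) = Z' \<alpha> s)"

end

theory Submission
  imports Defs "HOL-Library.Poly_Mapping"
begin

text \<open>
  Write \<open>V\<^sub>n\<close> for the product of the \<open>X\<close> over a set \<open>n\<close> of \<open>l\<close>-cells and of the \<open>Z\<close> over the cells
  \<open>s'\<close> with odd \<open>\<integral> n \<union>\<^sub>1 s'\<close>, so that \<open>V\<^sub>m V\<^sub>n = (-1)^(\<integral> m \<union>\<^sub>1 n) V\<^sub>m\<^sub>+\<^sub>n\<close> and the generator \<open>G\<^sub>r\<close> is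
  \<open>V\<^sub>\<delta>\<^sub>r\<close>. The operators \<open>U\<^sub>s\<close> commute with every \<open>V\<^sub>n\<close>, and since \<open>\<union>\<close> pairs each cell with a single
  dual cell, the automorphism fixes all \<open>U\<^sub>s\<close> and attaches to \<open>Z\<^sub>s\<close> of one species the generator \<open>G\<close> of
  the other species at a cell dual to \<open>s\<close>.

  If \<open>n\<close> were the joint eigenvalue configuration of the commuting generators of species \<open>B\<close> (indexed by
  dual \<open>l\<close>-cells), this would be conjugation by the operator that applies \<open>V\<^sub>n\<close> to species \<open>A\<close> when the
  configuration is \<open>n\<close>: it attaches the generator with index \<open>s\<close> to \<open>Z\<^sub>s\<close> of species \<open>A\<close>, and a \<open>Z\<close> of
  species \<open>B\<close>, which changes \<open>n\<close> by a coboundary \<open>\<delta>r\<close>, acquires the factor \<open>V\<^sub>n\<^sub>+\<^sub>\<delta>\<^sub>r V\<^sub>n\<^sup>-\<^sup>1\<close>, that is \<open>G\<^sub>r\<close>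
  of species \<open>A\<close> up to the sign \<open>(-1)^(\<integral> \<delta>r \<union>\<^sub>1 n)\<close>. This sign depends on \<open>n\<close>, and removing it is the
  only difficulty. It requires a local function \<open>f\<close> of closed cochains modulo two with
  \<open>f (n + \<delta>r) = f n + f (\<delta>r) + 2 \<integral> \<delta>r \<union>\<^sub>1 n\<close> modulo four, for then the phases \<open>i^(f n)\<close> turn the \<open>V\<^sub>n\<close>
  into a genuine representation on closed cochains. Such a function exists because \<open>l\<close> is odd: it is the
  square \<open>\<integral> n \<union>\<^sub>1 n + n \<union>\<^sub>2 \<delta>n\<close> of the integral 0-1 lift of \<open>n\<close> (lemma \<open>square_shift\<close>). Its phases couple pairs
  of generators by fourth roots of unity, so they are local but not Clifford.

  All eigenvalue configurations are closed, as the product of the generators dual to the faces of a cell is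
  trivial (\<open>flux_faces\<close>). The controlled operator is a product of local gates, one for each \<open>l\<close>-cell, up to signs
  from reordering the factors of \<open>V\<^sub>n\<close>; these are again local and are absorbed in the gates. Colouring the
  cells such that gates of one colour are disjoint makes it a circuit of finite depth (\<open>circuit_exists\<close>).
  As local operators are spanned by products of Pauli operators, any automorphism with the prescribed images
  is this circuit, after one layer of single-qubit Pauli operators that adjusts the signs.
\<close>

section \<open>The algebra of local operators\<close>

lemma local_op_eqI: "(\<And>\<sigma> \<tau>. entry a \<sigma> \<tau> = entry b \<sigma> \<tau>) \<Longrightarrow> a = b"
  by (metis entry_inject ext)

lemma scale_scale [simp]: "scale c (scale c' a) = scale (c * c') a"
  by transfer (simp add: mult.assoc)

lemma scale_one [simp]: "scale 1 a = a"
  by transfer simp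

lemma scale_zero_left [simp]: "scale 0 a = 0"
  by transfer simp

lemma scale_minus_one: "scale (- 1) a = - a"
  by transfer simp

lemma scale_add_right: "scale c (a + b) = scale c a + scale c b"
  by transfer (simp add: distrib_left)

lemma scale_add_left: "scale (c + c') a = scale c a + scale c' a"
  by transfer (simp add: distrib_right)

lemma scale_zero_right [simp]: "scale c 0 = 0"
  by transfer simp

lemma scale_sum_right: "scale c (sum f S) = (\<Sum>i\<in>S. scale c (f i))"
  by (induction S rule: infinite_finite_induct) (auto simp: scale_add_right)

lemma scale_sum_left: "scale (sum c S) a = (\<Sum>i\<in>S. scale (c i) a)"
  by (induction S rule: infinite_finite_induct) (auto simp: scale_add_left)

lemma scale_mult_left [simp]: "scale c a * b = scale c (a * b)"
proof (cases "c = 0")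
  case False
  then show ?thesis
    by transfer (simp add: kmult_def[abs_def] sum_distrib_left mult.assoc)
qed simp

lemma scale_mult_right [simp]: "a * scale c b = scale c (a * b)"
  by transfer (simp add: kmult_def[abs_def] sum_distrib_left mult.left_commute)

lemma adjoint_adjoint [simp]: "adjoint_op (adjoint_op a) = a"
  by transfer simp

lemma adjoint_scale [simp]: "adjoint_op (scale c a) = scale (cnj c) (adjoint_op a)"
  by transfer simp

lemma adjoint_add: "adjoint_op (a + b) = adjoint_op a + adjoint_op b"
  by transfer simp

lemma adjoint_zero [simp]: "adjoint_op 0 = 0"
  by transfer simp

lemma adjoint_sum: "adjoint_op (sum f S) = (\<Sum>i\<in>S. adjoint_op (f i))"
  by (induction S rule: infinite_finite_induct) (auto simp: adjoint_add)

lemma adjoint_one [simp]: "adjoint_op 1 = 1"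
  by transfer (intro ext, auto)

lemma adjoint_mult [simp]: "adjoint_op (a * b) = adjoint_op b * adjoint_op a"
proof transfer
  fix k k' :: "('a \<Rightarrow> bool) \<Rightarrow> ('a \<Rightarrow> bool) \<Rightarrow> complex"
  assume "\<exists>F. finite F \<and> acts_on F k" "\<exists>F. finite F \<and> acts_on F k'"
  then obtain F where F: "finite F" "acts_on F k" "acts_on F k'" by (rule two_supports)
  show "(\<lambda>\<sigma> \<tau>. cnj (kmult k k' \<tau> \<sigma>)) = kmult (\<lambda>\<sigma> \<tau>. cnj (k' \<tau> \<sigma>)) (\<lambda>\<sigma> \<tau>. cnj (k \<tau> \<sigma>))"
  proof (intro ext)
    fix \<sigma> \<tau>
    have "(\<Sum>\<rho>\<in>agree_off F \<tau>. k \<tau> \<rho> * k' \<rho> \<sigma>) = (\<Sum>\<rho>\<in>agree_off F \<sigma>. k' \<rho> \<sigma> * k \<tau> \<rho>)"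
    proof (cases "\<sigma> \<in> agree_off F \<tau>")
      case True
      then show ?thesis by (simp add: agree_off_cong mult.commute)
    next
      case False
      have "k \<tau> \<rho> * k' \<rho> \<sigma> = 0" for \<rho>
      proof (rule ccontr)
        assume "k \<tau> \<rho> * k' \<rho> \<sigma> \<noteq> 0"
        then have "\<tau> q = \<rho> q" "\<rho> q = \<sigma> q" if "q \<notin> F" for q
          using acts_on_supp[OF F(2) _ that] acts_on_supp[OF F(3) _ that] by auto
        then show False using False by (simp add: agree_off_def)
      qed
      then have "k \<tau> \<rho> * k' \<rho> \<sigma> = 0" "k' \<rho> \<sigma> * k \<tau> \<rho> = 0" for \<rho>
        by (simp_all add: mult.commute)
      then show ?thesis by (simp only: sum.neutral_const)
    qed
    then show "cnj (kmult k k' \<tau> \<sigma>) = kmult (\<lambda>\<sigma> \<tau>. cnj (k' \<tau> \<sigma>)) (\<lambda>\<sigma> \<tau>. cnj (k \<tau> \<sigma>)) \<sigma> \<tau>"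
      by (simp add: kmult_eq[OF F(1,2)] kmult_eq[OF F(1) acts_on_adjoint[OF F(3)]]
          flip: complex_cnj_mult cnj_sum)
  qed
qed

lemma local_opsI: "finite F \<Longrightarrow> F \<subseteq> S \<Longrightarrow> acts_on F (entry a) \<Longrightarrow> a \<in> local_ops S"
  by (auto simp: local_ops_def)

lemma local_ops_finite: "finite F \<Longrightarrow> a \<in> local_ops F \<longleftrightarrow> acts_on F (entry a)"
  by (auto simp: local_ops_def intro: acts_on_mono)

lemma local_ops_mono: "a \<in> local_ops S \<Longrightarrow> S \<subseteq> T \<Longrightarrow> a \<in> local_ops T"
  by (auto simp: local_ops_def)

lemma local_opsE:
  assumes "a \<in> local_ops S"
  obtains F where "finite F" "F \<subseteq> S" "a \<in> local_ops F"
  using assms by (auto simp: local_ops_def)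

lemma local_ops_zero [simp]: "0 \<in> local_ops S"
  by (rule local_opsI[of "{}"]) (auto simp: zero_local_op.rep_eq acts_on_zero)

lemma local_ops_one [simp]: "1 \<in> local_ops S"
  by (rule local_opsI[of "{}"]) (auto simp: one_local_op.rep_eq acts_on_one)

lemma local_ops_common:
  assumes "a \<in> local_ops S" "b \<in> local_ops S"
  obtains F where "finite F" "F \<subseteq> S" "acts_on F (entry a)" "acts_on F (entry b)"
proof -
  obtain F G where "finite F" "F \<subseteq> S" "acts_on F (entry a)"
    "finite G" "G \<subseteq> S" "acts_on G (entry b)"
    using assms by (auto simp: local_ops_def)
  then show ?thesis
    using that[of "F \<union> G"] acts_on_mono[of F _ "F \<union> G"] acts_on_mono[of G _ "F \<union> G"] by simp
qed

lemma local_ops_add [intro]: "a \<in> local_ops S \<Longrightarrow> b \<in> local_ops S \<Longrightarrow> a + b \<in> local_ops S"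
  by (erule (1) local_ops_common)
    (auto intro!: local_opsI simp: plus_local_op.rep_eq acts_on_add)

lemma local_ops_mult [intro]: "a \<in> local_ops S \<Longrightarrow> b \<in> local_ops S \<Longrightarrow> a * b \<in> local_ops S"
  by (erule (1) local_ops_common)
    (auto intro!: local_opsI simp: times_local_op.rep_eq acts_on_kmult)

lemma local_ops_scale [intro]: "a \<in> local_ops S \<Longrightarrow> scale c a \<in> local_ops S"
  by (auto simp: local_ops_def scale.rep_eq intro: acts_on_scale)

lemma local_ops_adjoint [intro]: "a \<in> local_ops S \<Longrightarrow> adjoint_op a \<in> local_ops S"
  by (auto simp: local_ops_def adjoint_op.rep_eq intro: acts_on_adjoint)

lemma local_ops_sum: "(\<And>i. i \<in> T \<Longrightarrow> f i \<in> local_ops S) \<Longrightarrow> sum f T \<in> local_ops S"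
  by (induction T rule: infinite_finite_induct) auto

lemma local_ops_prod_list: "(\<And>x. x \<in> set xs \<Longrightarrow> x \<in> local_ops S) \<Longrightarrow> prod_list xs \<in> local_ops S"
  by (induction xs) auto

lemma kmult_single:
  assumes F: "finite F" "acts_on F k" and \<rho>: "\<rho> \<in> agree_off F \<sigma>"
    and zero: "\<And>\<kappa>. k \<sigma> \<kappa> * k' \<kappa> \<tau> \<noteq> 0 \<Longrightarrow> \<kappa> = \<rho>"
  shows "kmult k k' \<sigma> \<tau> = k \<sigma> \<rho> * k' \<rho> \<tau>"
proof -
  have "kmult k k' \<sigma> \<tau> = (\<Sum>\<kappa>\<in>{\<rho>}. k \<sigma> \<kappa> * k' \<kappa> \<tau>)"
    unfolding kmult_eq[OF F]
    by (rule sum.mono_neutral_right) (use \<rho> zero F finite_agree_off in auto)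
  then show ?thesis by simp
qed

lemma kmult_commute:
  fixes k k' :: "('q \<Rightarrow> bool) \<Rightarrow> ('q \<Rightarrow> bool) \<Rightarrow> complex"
  assumes F: "finite F" "acts_on F k" and G: "finite G" "acts_on G k'" and disj: "F \<inter> G = {}"
  shows "kmult k k' = kmult k' k"
proof (intro ext)
  fix \<sigma> \<tau> :: "'q \<Rightarrow> bool"
  have nonzero: "\<sigma> q = \<tau> q"
    if "a \<sigma> \<kappa> * b \<kappa> \<tau> \<noteq> 0" "acts_on A a" "acts_on B b" "q \<notin> A" "q \<notin> B" for a b \<kappa> A B q
    using that acts_on_supp[of A a \<sigma> \<kappa> q] acts_on_supp[of B b \<kappa> \<tau> q] by auto
  show "kmult k k' \<sigma> \<tau> = kmult k' k \<sigma> \<tau>"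
  proof (cases "\<forall>q. q \<notin> F \<union> G \<longrightarrow> \<sigma> q = \<tau> q")
    case True
    define \<rho>1 \<rho>2 where "\<rho>1 = override_on \<sigma> \<tau> F" and "\<rho>2 = override_on \<sigma> \<tau> G"
    have 1: "kmult k k' \<sigma> \<tau> = k \<sigma> \<rho>1 * k' \<rho>1 \<tau>"
    proof (rule kmult_single[OF F])
      fix \<kappa> assume "k \<sigma> \<kappa> * k' \<kappa> \<tau> \<noteq> 0"
      then have "\<sigma> q = \<kappa> q" if "q \<notin> F" for q using acts_on_supp[OF F(2)] that by auto
      moreover have "\<kappa> q = \<tau> q" if "q \<notin> G" for q
        using acts_on_supp[OF G(2)] that \<open>k \<sigma> \<kappa> * k' \<kappa> \<tau> \<noteq> 0\<close> by auto
      ultimately show "\<kappa> = \<rho>1"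
        using disj by (auto simp: \<rho>1_def override_on_def fun_eq_iff)
    qed (simp add: \<rho>1_def agree_off_def)
    have 2: "kmult k' k \<sigma> \<tau> = k' \<sigma> \<rho>2 * k \<rho>2 \<tau>"
    proof (rule kmult_single[OF G])
      fix \<kappa> assume "k' \<sigma> \<kappa> * k \<kappa> \<tau> \<noteq> 0"
      then have "\<sigma> q = \<kappa> q" if "q \<notin> G" for q using acts_on_supp[OF G(2)] that by auto
      moreover have "\<kappa> q = \<tau> q" if "q \<notin> F" for q
        using acts_on_supp[OF F(2)] that \<open>k' \<sigma> \<kappa> * k \<kappa> \<tau> \<noteq> 0\<close> by auto
      ultimately show "\<kappa> = \<rho>2"
        using disj by (auto simp: \<rho>2_def override_on_def fun_eq_iff)
    qed (simp add: \<rho>2_def agree_off_def)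
    have "override_on \<rho>2 \<sigma> F = \<rho>2" "override_on \<rho>2 \<rho>1 F = \<tau>"
      "override_on \<rho>1 \<sigma> G = \<rho>1" "override_on \<rho>1 \<rho>2 G = \<tau>"
      using disj True by (auto simp: \<rho>1_def \<rho>2_def override_on_def fun_eq_iff)
    then have "k \<sigma> \<rho>1 = k \<rho>2 \<tau>" "k' \<sigma> \<rho>2 = k' \<rho>1 \<tau>"
      using acts_on_inv[OF F(2), of \<sigma> \<rho>1 \<rho>2] acts_on_inv[OF G(2), of \<sigma> \<rho>2 \<rho>1]
      by (auto simp: \<rho>1_def \<rho>2_def)
    with 1 2 show ?thesis by simp
  next
    case False
    then obtain q where q: "q \<notin> F" "q \<notin> G" "\<sigma> q \<noteq> \<tau> q" by auto
    have "k \<sigma> \<kappa> * k' \<kappa> \<tau> = 0" "k' \<sigma> \<kappa> * k \<kappa> \<tau> = 0" for \<kappa>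
      using nonzero[of k \<kappa> k' F G q] nonzero[of k' \<kappa> k G F q] F(2) G(2) q by auto
    then show ?thesis by (simp only: kmult_def sum.neutral_const)
  qed
qed

lemma local_ops_commute:
  assumes "a \<in> local_ops S" "b \<in> local_ops T" "S \<inter> T = {}"
  shows "a * b = b * a"
proof -
  obtain F where F: "finite F" "F \<subseteq> S" "acts_on F (entry a)"
    using assms(1) by (auto simp: local_ops_def)
  obtain G where G: "finite G" "G \<subseteq> T" "acts_on G (entry b)"
    using assms(2) by (auto simp: local_ops_def)
  have "entry (a * b) = entry (b * a)"
    unfolding times_local_op.rep_eq
    by (rule kmult_commute[OF F(1,3) G(1,3)]) (use assms F G in blast)
  then show ?thesis by (simp add: entry_inject)
qed

lemma unitary_opD: "unitary_op u \<Longrightarrow> u * adjoint_op u = 1" "unitary_op u \<Longrightarrow> adjoint_op u * u = 1"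
  by (auto simp: unitary_op_def)

lemma unitary_one [simp]: "unitary_op 1"
  by (simp add: unitary_op_def)

lemma unitary_mult:
  assumes "unitary_op u" "unitary_op v"
  shows "unitary_op (u * v)"
proof -
  have "u * v * (adjoint_op v * adjoint_op u) = u * (v * adjoint_op v) * adjoint_op u"
    "adjoint_op v * adjoint_op u * (u * v) = adjoint_op v * (adjoint_op u * u) * v"
    by (simp_all only: mult.assoc)
  then show ?thesis using assms by (simp add: unitary_op_def)
qed

lemma unitary_scale:
  assumes "unitary_op u" "cmod c = 1"
  shows "unitary_op (scale c u)"
proof -
  have "c * cnj c = 1" using assms(2) by (simp add: complex_norm_square[symmetric])
  then show ?thesis using assms(1) by (simp add: unitary_op_def mult.commute)
qed

lemma unitary_prod_list: "(\<And>x. x \<in> set xs \<Longrightarrow> unitary_op x) \<Longrightarrow> unitary_op (prod_list xs)"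
  by (induction xs) (auto intro: unitary_mult)

section \<open>Pauli operators\<close>

abbreviation symdiff :: "'a set \<Rightarrow> 'a set \<Rightarrow> 'a set" (infixl "\<triangle>" 65) where
  "A \<triangle> B \<equiv> sym_diff A B"

abbreviation sgn1 :: "nat \<Rightarrow> complex" where "sgn1 n \<equiv> (- 1) ^ n"

lemma sgn1_cong: "even m \<longleftrightarrow> even n \<Longrightarrow> sgn1 m = sgn1 n"
  by (cases "even n") auto

lemma card_sym_diff_parity:
  assumes "finite A" "finite B"
  shows "even (card (A \<triangle> B)) \<longleftrightarrow> (even (card A) \<longleftrightarrow> even (card B))"
proof -
  have "card (A \<triangle> B) = card (A - B) + card (B - A)"
    by (rule card_Un_disjoint) (use assms in auto)
  moreover have "card A = card (A - B) + card (A \<inter> B)" "card B = card (B - A) + card (A \<inter> B)"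
    using card_Int_Diff[of A B] card_Int_Diff[of B A] assms by (simp_all add: Int_commute)
  ultimately show ?thesis by presburger
qed

definition flip :: "'q set \<Rightarrow> ('q \<Rightarrow> bool) \<Rightarrow> 'q \<Rightarrow> bool" where
  "flip x \<tau> = (\<lambda>q. \<tau> q \<noteq> (q \<in> x))"

lemma flip_flip: "flip x (flip y \<tau>) = flip (x \<triangle> y) \<tau>"
  by (rule ext) (auto simp: flip_def)

lemma flip_empty [simp]: "flip {} \<tau> = \<tau>"
  by (rule ext) (auto simp: flip_def)

lemma eq_flip_iff: "\<sigma> = flip x \<tau> \<longleftrightarrow> \<tau> = flip x \<sigma>"
proof -
  have "flip x (flip x \<rho>) = \<rho>" for \<rho> :: "'a \<Rightarrow> bool" by (simp add: flip_flip)
  then show ?thesis by metis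
qed

lemma card_flip_parity:
  assumes "finite z"
  shows "even (card {q \<in> z. flip x \<tau> q}) \<longleftrightarrow> (even (card (z \<inter> x)) \<longleftrightarrow> even (card {q \<in> z. \<tau> q}))"
proof -
  have "{q \<in> z. flip x \<tau> q} = {q \<in> z. \<tau> q} \<triangle> (z \<inter> x)" by (auto simp: flip_def)
  then show ?thesis using card_sym_diff_parity[of "{q \<in> z. \<tau> q}" "z \<inter> x"] assms by auto
qed

text \<open>
  \<open>pauli x z\<close> is the product of the \<open>X\<close> on \<open>x\<close>, followed to the right by the \<open>Z\<close> on \<open>z\<close>; the
  order of the two factors fixes the sign.
\<close>

definition pauli_entry :: "'q set \<Rightarrow> 'q set \<Rightarrow> ('q \<Rightarrow> bool) \<Rightarrow> ('q \<Rightarrow> bool) \<Rightarrow> complex" where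
  "pauli_entry x z \<sigma> \<tau> =
     (if finite x \<and> finite z \<and> \<sigma> = flip x \<tau> then sgn1 (card {q \<in> z. \<tau> q}) else 0)"

lemma acts_on_pauli: "acts_on (x \<union> z) (pauli_entry x z)"
  unfolding acts_on_def
proof (intro conjI allI impI)
  fix \<sigma> \<tau> :: "'a \<Rightarrow> bool" and q
  assume "pauli_entry x z \<sigma> \<tau> \<noteq> 0" "q \<notin> x \<union> z"
  then show "\<sigma> q = \<tau> q" by (auto simp: pauli_entry_def flip_def split: if_splits)
next
  fix \<sigma> \<tau> \<rho> :: "'a \<Rightarrow> bool"
  let ?F = "x \<union> z"
  assume off: "\<forall>q. q \<notin> ?F \<longrightarrow> \<sigma> q = \<tau> q"
  have "(override_on \<rho> \<sigma> ?F q = (override_on \<rho> \<tau> ?F q \<noteq> (q \<in> x))) \<longleftrightarrow>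
      (\<sigma> q = (\<tau> q \<noteq> (q \<in> x)))" for q
    using off by (cases "q \<in> ?F") (auto simp: override_on_def)
  then have "override_on \<rho> \<sigma> ?F = flip x (override_on \<rho> \<tau> ?F) \<longleftrightarrow> \<sigma> = flip x \<tau>"
    unfolding flip_def fun_eq_iff by presburger
  moreover have "{q \<in> z. override_on \<rho> \<tau> ?F q} = {q \<in> z. \<tau> q}"
    by (auto simp: override_on_def)
  ultimately show "pauli_entry x z (override_on \<rho> \<sigma> ?F) (override_on \<rho> \<tau> ?F) = pauli_entry x z \<sigma> \<tau>"
    unfolding pauli_entry_def by presburger
qed

lift_definition pauli :: "'q set \<Rightarrow> 'q set \<Rightarrow> 'q local_op" is pauli_entry
proof -
  fix x z :: "'q set"
  show "\<exists>F. finite F \<and> acts_on F (pauli_entry x z)"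
  proof (cases "finite x \<and> finite z")
    case True
    then show ?thesis using acts_on_pauli[of x z] by blast
  next
    case False
    then have "pauli_entry x z = (\<lambda>\<sigma> \<tau>. 0)" by (intro ext) (auto simp: pauli_entry_def)
    then show ?thesis using acts_on_zero by fastforce
  qed
qed

lemma entry_pauli:
  "finite x \<Longrightarrow> finite z \<Longrightarrow>
   entry (pauli x z) \<sigma> \<tau> = (if \<sigma> = flip x \<tau> then sgn1 (card {q \<in> z. \<tau> q}) else 0)"
  by (simp add: pauli.rep_eq pauli_entry_def)

lemma pauli_local: "finite x \<Longrightarrow> finite z \<Longrightarrow> pauli x z \<in> local_ops (x \<union> z)"
  by (simp add: local_ops_finite pauli.rep_eq acts_on_pauli)

lemma pauli_empty [simp]: "pauli {} {} = 1"
  by (rule local_op_eqI) (simp add: entry_pauli one_local_op.rep_eq)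

lemma pauli_X_eq: "pauli_X q = pauli {q} {}"
proof (rule local_op_eqI)
  fix \<sigma> \<tau> :: "'a \<Rightarrow> bool"
  have "\<tau>(q := \<not> \<tau> q) = flip {q} \<tau>" by (rule ext) (simp add: flip_def)
  then show "entry (pauli_X q) \<sigma> \<tau> = entry (pauli {q} {}) \<sigma> \<tau>"
    by (simp add: entry_pauli pauli_X.rep_eq)
qed

lemma pauli_Z_eq: "pauli_Z q = pauli {} {q}"
proof (rule local_op_eqI)
  fix \<sigma> \<tau> :: "'a \<Rightarrow> bool"
  have "{p \<in> {q}. \<tau> p} = (if \<tau> q then {q} else {})" by auto
  then show "entry (pauli_Z q) \<sigma> \<tau> = entry (pauli {} {q}) \<sigma> \<tau>"
    by (simp add: entry_pauli pauli_Z.rep_eq)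
qed

lemma pauli_mult:
  assumes fin: "finite x" "finite z" "finite x'" "finite z'"
  shows "pauli x z * pauli x' z' = scale (sgn1 (card (z \<inter> x'))) (pauli (x \<triangle> x') (z \<triangle> z'))"
proof (rule local_op_eqI)
  fix \<sigma> \<tau> :: "'a \<Rightarrow> bool"
  have "entry (pauli x z * pauli x' z') \<sigma> \<tau> =
      entry (pauli x z) \<sigma> (flip x \<sigma>) * entry (pauli x' z') (flip x \<sigma>) \<tau>"
    unfolding times_local_op.rep_eq
  proof (rule kmult_single)
    show "finite (x \<union> z)" using fin by simp
    show "acts_on (x \<union> z) (entry (pauli x z))" by (simp add: pauli.rep_eq acts_on_pauli)
    show "flip x \<sigma> \<in> agree_off (x \<union> z) \<sigma>" by (auto simp: agree_off_def flip_def)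
    fix \<kappa> assume "entry (pauli x z) \<sigma> \<kappa> * entry (pauli x' z') \<kappa> \<tau> \<noteq> 0"
    then have "\<sigma> = flip x \<kappa>" using fin by (simp add: entry_pauli split: if_splits)
    then show "\<kappa> = flip x \<sigma>" by (simp add: flip_flip)
  qed
  also have "\<dots> = (if \<sigma> = flip (x \<triangle> x') \<tau>
      then sgn1 (card {q \<in> z. flip x' \<tau> q}) * sgn1 (card {q \<in> z'. \<tau> q}) else 0)"
  proof -
    have "flip x \<sigma> = flip x' \<tau> \<longleftrightarrow> \<sigma> = flip (x \<triangle> x') \<tau>"
      unfolding flip_flip[symmetric] by (metis eq_flip_iff)
    moreover have "entry (pauli x z) \<sigma> (flip x \<sigma>) = sgn1 (card {q \<in> z. flip x \<sigma> q})"
      using fin by (simp add: entry_pauli flip_flip)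
    moreover have "entry (pauli x' z') (flip x \<sigma>) \<tau> =
        (if flip x \<sigma> = flip x' \<tau> then sgn1 (card {q \<in> z'. \<tau> q}) else 0)"
      by (rule entry_pauli[OF fin(3,4)])
    ultimately show ?thesis by (cases "flip x \<sigma> = flip x' \<tau>") simp_all
  qed
  also have "sgn1 (card {q \<in> z. flip x' \<tau> q}) * sgn1 (card {q \<in> z'. \<tau> q}) =
      sgn1 (card (z \<inter> x')) * sgn1 (card {q \<in> z \<triangle> z'. \<tau> q})"
  proof -
    have "{q \<in> z \<triangle> z'. \<tau> q} = {q \<in> z. \<tau> q} \<triangle> {q \<in> z'. \<tau> q}" by auto
    then show ?thesis
      unfolding power_add[symmetric]
      using card_flip_parity[of z x' \<tau>] card_sym_diff_parity[of "{q \<in> z. \<tau> q}" "{q \<in> z'. \<tau> q}"] fin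
      by (intro sgn1_cong) auto
  qed
  finally show "entry (pauli x z * pauli x' z') \<sigma> \<tau> =
      entry (scale (sgn1 (card (z \<inter> x'))) (pauli (x \<triangle> x') (z \<triangle> z'))) \<sigma> \<tau>"
    using fin by (simp add: entry_pauli scale.rep_eq)
qed

lemma pauli_adjoint:
  assumes fin: "finite x" "finite z"
  shows "adjoint_op (pauli x z) = scale (sgn1 (card (z \<inter> x))) (pauli x z)"
proof (rule local_op_eqI)
  fix \<sigma> \<tau> :: "'a \<Rightarrow> bool"
  have "sgn1 (card {q \<in> z. flip x \<tau> q}) = sgn1 (card (z \<inter> x)) * sgn1 (card {q \<in> z. \<tau> q})"
    unfolding power_add[symmetric] using card_flip_parity[of z x \<tau>] fin by (intro sgn1_cong) auto
  then show "entry (adjoint_op (pauli x z)) \<sigma> \<tau> = entry (scale (sgn1 (card (z \<inter> x))) (pauli x z)) \<sigma> \<tau>"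
    using fin eq_flip_iff[of \<tau> x \<sigma>] by (simp add: adjoint_op.rep_eq scale.rep_eq entry_pauli)
qed

lemma sgn1_sgn1 [simp]: "sgn1 n * sgn1 n = 1"
  by (simp flip: power_mult_distrib)

lemma pauli_unitary: "finite x \<Longrightarrow> finite z \<Longrightarrow> unitary_op (pauli x z)"
  by (simp add: unitary_op_def pauli_adjoint pauli_mult)

lemma pauli_commute:
  assumes "finite x" "finite z" "finite x'" "finite z'"
  shows "pauli x z * pauli x' z' = scale (sgn1 (card (z \<inter> x') + card (z' \<inter> x))) (pauli x' z' * pauli x z)"
  using assms by (simp add: pauli_mult Un_commute power_add mult.assoc)

section \<open>Gate layers and circuits\<close>

definition conjugate :: "'q local_op \<Rightarrow> 'q local_op \<Rightarrow> 'q local_op" where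
  "conjugate w a = w * a * adjoint_op w"

lemma conjugate_comp: "conjugate (v * w) a = conjugate v (conjugate w a)"
  by (simp add: conjugate_def mult.assoc)

lemma conjugate_one [simp]: "conjugate 1 a = a"
  by (simp add: conjugate_def)

lemma conjugate_add: "conjugate w (a + b) = conjugate w a + conjugate w b"
  by (simp add: conjugate_def distrib_left distrib_right)

lemma conjugate_scale: "conjugate w (scale c a) = scale c (conjugate w a)"
  by (simp add: conjugate_def)

lemma conjugate_adjoint: "conjugate w (adjoint_op a) = adjoint_op (conjugate w a)"
  by (simp add: conjugate_def mult.assoc)

lemma conjugate_inverse: "unitary_op w \<Longrightarrow> conjugate (adjoint_op w) (conjugate w a) = a"
  by (simp add: unitary_opD flip: conjugate_comp)

lemma conjugate_inverse': "unitary_op w \<Longrightarrow> conjugate w (conjugate (adjoint_op w) a) = a"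
  by (simp add: unitary_opD flip: conjugate_comp)

lemma conjugate_mult:
  assumes "unitary_op w"
  shows "conjugate w (a * b) = conjugate w a * conjugate w b"
proof -
  have "conjugate w a * conjugate w b = w * a * (adjoint_op w * w) * b * adjoint_op w"
    by (simp only: conjugate_def mult.assoc)
  then show ?thesis using assms by (simp add: conjugate_def unitary_opD mult.assoc)
qed

lemma conjugate_eqI:
  assumes "unitary_op w" "w * a = b * w"
  shows "conjugate w a = b"
  using assms by (simp add: conjugate_def mult.assoc unitary_opD)

lemma conjugate_local: "w \<in> local_ops S \<Longrightarrow> a \<in> local_ops S \<Longrightarrow> conjugate w a \<in> local_ops S"
  unfolding conjugate_def by auto

lemma prod_list_move:
  fixes f :: "'i \<Rightarrow> 'a::monoid_mult"
  assumes "\<And>j. j \<in> set ys \<Longrightarrow> f i * f j = f j * f i"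
  shows "prod_list (map f (ys @ i # zs)) = f i * prod_list (map f (ys @ zs))"
  using assms
proof (induction ys)
  case (Cons y ys)
  then have "prod_list (map f ((y # ys) @ i # zs)) = f y * (f i * prod_list (map f (ys @ zs)))"
    by simp
  also have "\<dots> = f i * (f y * prod_list (map f (ys @ zs)))"
    using Cons.prems[of y] by (simp flip: mult.assoc)
  finally show ?case by simp
qed simp

lemma prod_list_perm:
  fixes f :: "'i \<Rightarrow> 'a::monoid_mult"
  assumes "distinct xs" "distinct ys" "set xs = set ys"
    and "\<And>i j. i \<in> set xs \<Longrightarrow> j \<in> set xs \<Longrightarrow> i \<noteq> j \<Longrightarrow> f i * f j = f j * f i"
  shows "prod_list (map f xs) = prod_list (map f ys)"
  using assms
proof (induction xs arbitrary: ys)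
  case (Cons x xs)
  then obtain us vs where ys: "ys = us @ x # vs" by (metis list.set_intros(1) split_list)
  have x: "x \<notin> set us" "x \<notin> set vs" "distinct (us @ vs)" using Cons.prems ys by auto
  then have sets: "set xs = set (us @ vs)" using Cons.prems(1,3) ys by auto
  have "prod_list (map f ys) = f x * prod_list (map f (us @ vs))"
    unfolding ys by (rule prod_list_move) (use Cons.prems x ys in auto)
  also have "prod_list (map f (us @ vs)) = prod_list (map f xs)"
    by (rule Cons.IH[symmetric]) (use Cons.prems(1,4) x sets in \<open>simp_all, blast?\<close>)
  finally show ?case by simp
qed simp

lemma op_prod_list:
  assumes "finite S"
  obtains xs where "distinct xs" "set xs = S" "op_prod f S = prod_list (map f xs)"
proof -
  have "\<exists>xs. distinct xs \<and> set xs = S" using finite_distinct_list[OF assms] by blast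
  from someI_ex[OF this] show ?thesis
    using that[of "SOME xs. distinct xs \<and> set xs = S"] by (simp add: op_prod_def)
qed

lemma near_refl [simp]: "near R p p"
  by (simp add: near_def)

lemma near_trans: "near R p q \<Longrightarrow> near R' q r \<Longrightarrow> near (R + R') p r"
  unfolding near_def
proof
  fix i
  assume "\<forall>i. \<bar>pos p i - pos q i\<bar> \<le> int R" "\<forall>i. \<bar>pos q i - pos r i\<bar> \<le> int R'"
  then have "\<bar>pos p i - pos q i\<bar> \<le> int R" "\<bar>pos q i - pos r i\<bar> \<le> int R'" by blast+
  then show "\<bar>pos p i - pos r i\<bar> \<le> int (R + R')" by linarith
qed

locale gate_blocks =
  fixes Q :: "qubit set" and J :: "'i set" and u :: "'i \<Rightarrow> qubit local_op"
    and blk :: "'i \<Rightarrow> qubit set" and R :: nat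
  assumes blk_sub: "i \<in> J \<Longrightarrow> blk i \<subseteq> Q"
    and blk_nonempty: "i \<in> J \<Longrightarrow> blk i \<noteq> {}"
    and blk_near: "i \<in> J \<Longrightarrow> p \<in> blk i \<Longrightarrow> q \<in> blk i \<Longrightarrow> near R p q"
    and gate_local: "i \<in> J \<Longrightarrow> u i \<in> local_ops (blk i)"
    and gate_unitary: "i \<in> J \<Longrightarrow> unitary_op (u i)"

locale disjoint_blocks = gate_blocks +
  assumes blk_disjoint: "i \<in> J \<Longrightarrow> j \<in> J \<Longrightarrow> i \<noteq> j \<Longrightarrow> blk i \<inter> blk j = {}"
begin

definition meets :: "qubit set \<Rightarrow> 'a set" where "meets F = {i \<in> J. blk i \<inter> F \<noteq> {}}"

definition spread :: "qubit set \<Rightarrow> qubit set" where "spread F = F \<union> (\<Union>i\<in>meets F. blk i)"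

lemma finite_meets:
  assumes "finite F"
  shows "finite (meets F)"
proof (rule finite_subset)
  show "meets F \<subseteq> (\<lambda>q. THE i. i \<in> J \<and> q \<in> blk i) ` F"
  proof
    fix i assume "i \<in> meets F"
    then obtain q where q: "i \<in> J" "q \<in> blk i" "q \<in> F" by (auto simp: meets_def)
    then have "(THE i. i \<in> J \<and> q \<in> blk i) = i"
      using blk_disjoint by (intro the_equality) auto
    then show "i \<in> (\<lambda>q. THE i. i \<in> J \<and> q \<in> blk i) ` F" using q by force
  qed
qed (use assms in simp)

lemma gates_commute: "i \<in> J \<Longrightarrow> j \<in> J \<Longrightarrow> i \<noteq> j \<Longrightarrow> u i * u j = u j * u i"
  using local_ops_commute gate_local blk_disjoint by metis

text \<open>
  Gates that do not meet the support of \<open>a\<close> drop out: all others act within the support enlarged by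
  their blocks, which is disjoint from the remaining blocks.
\<close>

lemma conjugate_filter:
  assumes "distinct xs" "set xs \<subseteq> J" "a \<in> local_ops F"
  shows "conjugate (prod_list (map u xs)) a = conjugate (prod_list (map u (filter (\<lambda>i. i \<in> meets F) xs))) a \<and>
    conjugate (prod_list (map u xs)) a \<in> local_ops (F \<union> (\<Union>i\<in>meets F \<inter> set xs. blk i))"
  using assms
proof (induction xs)
  case (Cons x xs)
  let ?b = "conjugate (prod_list (map u xs)) a"
  have IH: "?b = conjugate (prod_list (map u (filter (\<lambda>i. i \<in> meets F) xs))) a"
    "?b \<in> local_ops (F \<union> (\<Union>i\<in>meets F \<inter> set xs. blk i))"
    using Cons by auto
  have x: "x \<in> J" "x \<notin> set xs" using Cons.prems by auto
  have step: "conjugate (prod_list (map u (x # xs))) a = conjugate (u x) ?b"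
    by (simp add: conjugate_comp)
  show ?case
  proof (cases "x \<in> meets F")
    case True
    have "u x \<in> local_ops (F \<union> (\<Union>i\<in>meets F \<inter> set (x # xs). blk i))"
      by (rule local_ops_mono[OF gate_local[OF x(1)]]) (use True in auto)
    moreover have "?b \<in> local_ops (F \<union> (\<Union>i\<in>meets F \<inter> set (x # xs). blk i))"
      by (rule local_ops_mono[OF IH(2)]) auto
    ultimately show ?thesis
      unfolding step using True IH(1) by (auto simp: conjugate_comp intro: conjugate_local)
  next
    case False
    have "blk x \<inter> (F \<union> (\<Union>i\<in>meets F \<inter> set xs. blk i)) = {}"
      using False x blk_disjoint by (fastforce simp: meets_def)
    then have "u x * ?b = ?b * u x" by (rule local_ops_commute[OF gate_local[OF x(1)] IH(2)])
    then have "conjugate (u x) ?b = ?b" by (rule conjugate_eqI[OF gate_unitary[OF x(1)]])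
    moreover have "meets F \<inter> set (x # xs) = meets F \<inter> set xs" using False by auto
    ultimately show ?thesis unfolding step using False IH by simp
  qed
qed simp

lemma conjugate_cong:
  assumes "distinct xs" "set xs \<subseteq> J" "distinct ys" "set ys \<subseteq> J" "a \<in> local_ops F"
    and "meets F \<subseteq> set xs" "meets F \<subseteq> set ys"
  shows "conjugate (prod_list (map u xs)) a = conjugate (prod_list (map u ys)) a"
proof -
  have "prod_list (map u (filter (\<lambda>i. i \<in> meets F) xs)) = prod_list (map u (filter (\<lambda>i. i \<in> meets F) ys))"
  proof (rule prod_list_perm)
    fix i j assume "i \<in> set (filter (\<lambda>i. i \<in> meets F) xs)" "j \<in> set (filter (\<lambda>i. i \<in> meets F) xs)" "i \<noteq> j"
    then show "u i * u j = u j * u i" using gates_commute assms(2) by auto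
  qed (use assms in auto)
  then show ?thesis
    using conjugate_filter[OF assms(1,2,5)] conjugate_filter[OF assms(3,4,5)] by simp
qed

definition act :: "qubit local_op \<Rightarrow> qubit local_op" where
  "act a = conjugate (op_prod u (meets (SOME F. finite F \<and> F \<subseteq> Q \<and> a \<in> local_ops F))) a"

text \<open>
  A layer can be evaluated with any finite set of gates that includes those meeting the support;
  this is what makes it a homomorphism, since finitely many operators can share one set of gates.
\<close>

lemma act_eq:
  assumes F: "finite F" "F \<subseteq> Q" "a \<in> local_ops F"
    and xs: "distinct xs" "set xs \<subseteq> J" "meets F \<subseteq> set xs"
  shows "act a = conjugate (prod_list (map u xs)) a"
proof -
  define G where "G = (SOME F. finite F \<and> F \<subseteq> Q \<and> a \<in> local_ops F)"
  have G: "finite G" "G \<subseteq> Q" "a \<in> local_ops G"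
    using someI_ex[of "\<lambda>F. finite F \<and> F \<subseteq> Q \<and> a \<in> local_ops F"] F unfolding G_def by blast+
  obtain ys where ys: "distinct ys" "set ys = meets G" "op_prod u (meets G) = prod_list (map u ys)"
    by (rule op_prod_list[OF finite_meets[OF G(1)]])
  obtain zs where zs: "distinct zs" "set zs = meets F \<union> meets G"
    using finite_distinct_list[of "meets F \<union> meets G"] finite_meets F(1) G(1) by auto
  have sub: "meets X \<subseteq> J" for X by (auto simp: meets_def)
  have "act a = conjugate (prod_list (map u ys)) a"
    unfolding act_def G_def[symmetric] ys(3) ..
  also have "\<dots> = conjugate (prod_list (map u zs)) a"
    by (rule conjugate_cong[OF _ _ _ _ G(3)]) (use ys zs sub in auto)
  also have "\<dots> = conjugate (prod_list (map u xs)) a"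
    by (rule conjugate_cong[OF _ _ _ _ F(3)]) (use xs zs sub in auto)
  finally show ?thesis .
qed

lemma gates_covering:
  assumes "finite F"
  obtains xs where "distinct xs" "set xs = meets F" "unitary_op (prod_list (map u xs))"
proof -
  obtain xs where xs: "distinct xs" "set xs = meets F"
    using finite_distinct_list[OF finite_meets[OF assms]] by blast
  moreover have "unitary_op (prod_list (map u xs))"
    by (rule unitary_prod_list) (use xs gate_unitary in \<open>auto simp: meets_def\<close>)
  ultimately show ?thesis using that by blast
qed

lemma meets_sub: "meets F \<subseteq> J"
  by (auto simp: meets_def)

lemma act_spread:
  assumes "finite F" "F \<subseteq> Q" "a \<in> local_ops F"
  shows "act a \<in> local_ops (spread F)"
proof -
  obtain xs where xs: "distinct xs" "set xs = meets F" by (rule gates_covering[OF assms(1)])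
  then show ?thesis
    using conjugate_filter[of xs a F] act_eq[OF assms, of xs] meets_sub assms
    by (simp add: spread_def Int_absorb)
qed

lemma spread_sub:
  assumes "F \<subseteq> Q"
  shows "spread F \<subseteq> {q \<in> Q. \<exists>p\<in>F. near R p q}"
proof
  fix q assume q: "q \<in> spread F"
  show "q \<in> {q \<in> Q. \<exists>p\<in>F. near R p q}"
  proof (cases "q \<in> F")
    case True
    then show ?thesis using assms by (auto intro: bexI[of _ q])
  next
    case False
    then obtain i p where "i \<in> J" "q \<in> blk i" "p \<in> blk i" "p \<in> F"
      using q by (auto simp: spread_def meets_def)
    then show ?thesis using blk_near[of i p q] blk_sub[of i] by blast
  qed
qed

lemma gate_layer_act: "gate_layer Q act"
  unfolding gate_layer_def
proof (intro exI conjI ballI allI impI)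
  let ?U = "\<lambda>B. u (inv_into J blk B)"
  have inj: "inj_on blk J"
  proof (rule inj_onI, rule ccontr)
    fix i j assume "i \<in> J" "j \<in> J" "blk i = blk j" "i \<noteq> j"
    then show False using blk_disjoint[of i j] blk_nonempty[of i] by simp
  qed
  show "pairwise disjnt (blk ` J)"
    using blk_disjoint by (auto simp: pairwise_def disjnt_def)
  show "B \<subseteq> Q" "?U B \<in> local_ops B" "unitary_op (?U B)" if "B \<in> blk ` J" for B
    using that blk_sub gate_local gate_unitary by (auto simp: inv_into_f_f[OF inj])
  show "near R p q" if "B \<in> blk ` J" "p \<in> B" "q \<in> B" for B p q
    using that blk_near by auto
  fix F a assume F: "finite F \<and> F \<subseteq> Q \<and> a \<in> local_ops F"
  have B: "{B \<in> blk ` J. B \<inter> F \<noteq> {}} = blk ` meets F" by (auto simp: meets_def)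
  obtain Bs where Bs: "distinct Bs" "set Bs = blk ` meets F"
    "op_prod ?U (blk ` meets F) = prod_list (map ?U Bs)"
    using op_prod_list[of "blk ` meets F" ?U] finite_meets F by blast
  define xs where "xs = map (inv_into J blk) Bs"
  have set: "set xs = meets F"
    using Bs(2) meets_sub inj by (force simp: xs_def inv_into_f_f image_image)
  have "inj_on (inv_into J blk) (set Bs)"
    unfolding Bs(2) by (rule inj_on_inv_into) (use meets_sub in auto)
  then have "distinct xs" using Bs(1) by (simp add: xs_def distinct_map)
  then have "act a = conjugate (prod_list (map u xs)) a"
    by (intro act_eq[of F]) (use F set meets_sub in auto)
  then show "let W = op_prod ?U {B \<in> blk ` J. B \<inter> F \<noteq> {}} in act a = W * a * adjoint_op W"
    unfolding B Bs(3) by (simp add: xs_def conjugate_def o_def)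
qed

text \<open>
  For surjectivity, the gates meeting the support of \<open>b\<close> are undone. This enlarges the support by
  blocks that met it already, so the layer applies exactly the same gates to the preimage.
\<close>

lemma qca_act: "qca Q act"
proof -
  have cover: "\<exists>w. unitary_op w \<and> act a = conjugate w a \<and> act b = conjugate w b \<and>
      act (a + b) = conjugate w (a + b) \<and> act (a * b) = conjugate w (a * b) \<and>
      act (scale c a) = conjugate w (scale c a) \<and> act (adjoint_op a) = conjugate w (adjoint_op a)"
    if ab: "a \<in> local_ops Q" "b \<in> local_ops Q" for a b c
  proof -
    obtain F where F: "finite F" "F \<subseteq> Q" "acts_on F (entry a)" "acts_on F (entry b)"
      by (rule local_ops_common[OF ab])
    then have loc: "a \<in> local_ops F" "b \<in> local_ops F" by (simp_all add: local_ops_finite)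
    obtain xs where xs: "distinct xs" "set xs = meets F" "unitary_op (prod_list (map u xs))"
      by (rule gates_covering[OF F(1)])
    have "act x = conjugate (prod_list (map u xs)) x" if "x \<in> local_ops F" for x
      using act_eq[OF F(1,2) that xs(1)] xs(2) meets_sub by auto
    then show ?thesis using xs(3) loc by blast
  qed
  have maps: "act a \<in> local_ops Q" if a: "a \<in> local_ops Q" for a
  proof -
    obtain F where F: "finite F" "F \<subseteq> Q" "a \<in> local_ops F" by (rule local_opsE[OF a])
    show ?thesis by (rule local_ops_mono[OF act_spread[OF F]]) (use spread_sub[OF F(2)] in auto)
  qed
  have "inj_on act (local_ops Q)"
  proof (rule inj_onI)
    fix a b assume ab: "a \<in> local_ops Q" "b \<in> local_ops Q" "act a = act b"
    obtain w where w: "unitary_op w" "act a = conjugate w a" "act b = conjugate w b"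
      using cover[OF ab(1,2)] by blast
    have "a = conjugate (adjoint_op w) (act a)" by (simp only: w(2) conjugate_inverse[OF w(1)])
    also have "\<dots> = b" by (simp only: ab(3) w(3) conjugate_inverse[OF w(1)])
    finally show "a = b" .
  qed
  moreover have "\<exists>a\<in>local_ops Q. act a = b" if b: "b \<in> local_ops Q" for b
  proof -
    obtain F where F: "finite F" "F \<subseteq> Q" "b \<in> local_ops F" by (rule local_opsE[OF b])
    obtain xs where xs: "distinct xs" "set xs = meets F" "unitary_op (prod_list (map u xs))"
      by (rule gates_covering[OF F(1)])
    let ?w = "prod_list (map u xs)"
    let ?a = "conjugate (adjoint_op ?w) b"
    have "?w \<in> local_ops (spread F)"
    proof (rule local_ops_prod_list)
      fix x assume "x \<in> set (map u xs)"
      then obtain i where i: "i \<in> meets F" "x = u i" using xs(2) by auto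
      then show "x \<in> local_ops (spread F)"
        using gate_local[of i] meets_sub by (auto simp: spread_def intro: local_ops_mono)
    qed
    moreover have "b \<in> local_ops (spread F)"
      by (rule local_ops_mono[OF F(3)]) (simp add: spread_def)
    ultimately have a: "?a \<in> local_ops (spread F)" by (intro conjugate_local) auto
    have "spread F \<subseteq> Q" using spread_sub[OF F(2)] by auto
    obtain G where G: "finite G" "G \<subseteq> spread F" "?a \<in> local_ops G" by (rule local_opsE[OF a])
    have "meets G \<subseteq> meets F"
    proof
      fix i assume "i \<in> meets G"
      then obtain q where q: "i \<in> J" "q \<in> blk i" "q \<in> spread F" using G(2) by (auto simp: meets_def)
      show "i \<in> meets F"
      proof (cases "q \<in> F")
        case False
        then obtain j where "j \<in> meets F" "q \<in> blk j" using q by (auto simp: spread_def)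
        then show ?thesis using q blk_disjoint[of i j] meets_sub by blast
      qed (use q in \<open>auto simp: meets_def\<close>)
    qed
    then have "act ?a = conjugate ?w ?a"
      using act_eq[OF G(1) _ G(3) xs(1)] G(2) \<open>spread F \<subseteq> Q\<close> xs(2) meets_sub by blast
    then have "act ?a = b" using conjugate_inverse'[OF xs(3)] by simp
    then show ?thesis using local_ops_mono[OF a \<open>spread F \<subseteq> Q\<close>] by blast
  qed
  ultimately have bij: "bij_betw act (local_ops Q) (local_ops Q)"
    using maps by (auto simp: bij_betw_def)
  show ?thesis
    unfolding qca_def
  proof (intro conjI ballI allI)
    fix a b assume ab: "a \<in> local_ops Q" "b \<in> local_ops Q"
    obtain w where w: "unitary_op w" "act a = conjugate w a" "act b = conjugate w b"
      "act (a + b) = conjugate w (a + b)" "act (a * b) = conjugate w (a * b)"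
      using cover[OF ab] by blast
    show "act (a + b) = act a + act b" by (simp only: w conjugate_add)
    show "act (a * b) = act a * act b" by (simp only: w conjugate_mult[OF w(1)])
  next
    fix a c assume a: "a \<in> local_ops Q"
    obtain w where w: "act a = conjugate w a" "act (scale c a) = conjugate w (scale c a)"
      "act (adjoint_op a) = conjugate w (adjoint_op a)"
      using cover[OF a a] by blast
    show "act (scale c a) = scale c (act a)" by (simp only: w conjugate_scale)
    show "act (adjoint_op a) = adjoint_op (act a)" by (simp only: w conjugate_adjoint)
  next
    show "\<exists>R. \<forall>F\<subseteq>Q. \<forall>a\<in>local_ops F. act a \<in> local_ops {q \<in> Q. \<exists>p\<in>F. near R p q}"
    proof (intro exI allI impI ballI)
      fix F a assume "F \<subseteq> Q" "a \<in> local_ops F"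
      then obtain G where G: "finite G" "G \<subseteq> F" "a \<in> local_ops G" by (auto elim: local_opsE)
      have "spread G \<subseteq> {q \<in> Q. \<exists>p\<in>F. near R p q}"
        using spread_sub[of G] G(2) \<open>F \<subseteq> Q\<close> by blast
      then show "act a \<in> local_ops {q \<in> Q. \<exists>p\<in>F. near R p q}"
        using act_spread[OF G(1) _ G(3)] G(2) \<open>F \<subseteq> Q\<close> by (auto intro: local_ops_mono)
    qed
  qed (fact bij)
qed

end

lemma qcaD:
  assumes "qca Q \<Phi>"
  shows qca_bij: "bij_betw \<Phi> (local_ops Q) (local_ops Q)"
    and qca_maps: "a \<in> local_ops Q \<Longrightarrow> \<Phi> a \<in> local_ops Q"
    and qca_add: "a \<in> local_ops Q \<Longrightarrow> b \<in> local_ops Q \<Longrightarrow> \<Phi> (a + b) = \<Phi> a + \<Phi> b"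
    and qca_mult: "a \<in> local_ops Q \<Longrightarrow> b \<in> local_ops Q \<Longrightarrow> \<Phi> (a * b) = \<Phi> a * \<Phi> b"
    and qca_scale: "a \<in> local_ops Q \<Longrightarrow> \<Phi> (scale c a) = scale c (\<Phi> a)"
    and qca_adjoint: "a \<in> local_ops Q \<Longrightarrow> \<Phi> (adjoint_op a) = adjoint_op (\<Phi> a)"
proof -
  show bij: "bij_betw \<Phi> (local_ops Q) (local_ops Q)" using assms unfolding qca_def by blast
  show "a \<in> local_ops Q \<Longrightarrow> \<Phi> a \<in> local_ops Q" using bij_betwE[OF bij] by blast
qed (use assms in \<open>unfold qca_def, blast+\<close>)

lemma qca_local:
  assumes "qca Q \<Phi>"
  obtains R where "\<And>F a. F \<subseteq> Q \<Longrightarrow> a \<in> local_ops F \<Longrightarrow> \<Phi> a \<in> local_ops {q \<in> Q. \<exists>p\<in>F. near R p q}"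
proof -
  have "\<exists>R. \<forall>F\<subseteq>Q. \<forall>a\<in>local_ops F. \<Phi> a \<in> local_ops {q \<in> Q. \<exists>p\<in>F. near R p q}"
    using assms unfolding qca_def by blast
  then show ?thesis using that by blast
qed

lemma qca_comp:
  assumes \<Phi>: "qca Q \<Phi>" and \<Psi>: "qca Q \<Psi>"
  shows "qca Q (\<Phi> \<circ> \<Psi>)"
proof -
  obtain R where
    R: "\<And>F a. F \<subseteq> Q \<Longrightarrow> a \<in> local_ops F \<Longrightarrow> \<Phi> a \<in> local_ops {q \<in> Q. \<exists>p\<in>F. near R p q}"
    by (rule qca_local[OF \<Phi>]) blast
  obtain R' where
    R': "\<And>F a. F \<subseteq> Q \<Longrightarrow> a \<in> local_ops F \<Longrightarrow> \<Psi> a \<in> local_ops {q \<in> Q. \<exists>p\<in>F. near R' p q}"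
    by (rule qca_local[OF \<Psi>]) blast
  note maps = qca_maps[OF \<Psi>]
  have loc: "(\<Phi> \<circ> \<Psi>) a \<in> local_ops {q \<in> Q. \<exists>p\<in>F. near (R' + R) p q}"
    if "F \<subseteq> Q" "a \<in> local_ops F" for F a
  proof -
    have "\<Phi> (\<Psi> a) \<in> local_ops {q \<in> Q. \<exists>p\<in>{q \<in> Q. \<exists>p\<in>F. near R' p q}. near R p q}"
      by (rule R[OF _ R'[OF that]]) auto
    then show ?thesis
      unfolding o_apply by (rule local_ops_mono) (use near_trans in blast)
  qed
  show ?thesis
    unfolding qca_def
  proof (intro conjI ballI allI)
    show "bij_betw (\<Phi> \<circ> \<Psi>) (local_ops Q) (local_ops Q)"
      by (rule bij_betw_trans[OF qca_bij[OF \<Psi>] qca_bij[OF \<Phi>]])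
    show "\<exists>R. \<forall>F\<subseteq>Q. \<forall>a\<in>local_ops F. (\<Phi> \<circ> \<Psi>) a \<in> local_ops {q \<in> Q. \<exists>p\<in>F. near R p q}"
      using loc by blast
  qed (simp_all add: maps qca_add[OF \<Psi>] qca_add[OF \<Phi>] qca_mult[OF \<Psi>] qca_mult[OF \<Phi>]
      qca_scale[OF \<Psi>] qca_scale[OF \<Phi>] qca_adjoint[OF \<Psi>] qca_adjoint[OF \<Phi>])
qed

locale coloured_gates = gate_blocks +
  fixes col :: "'a \<Rightarrow> nat" and K :: nat
  assumes col_less: "i \<in> J \<Longrightarrow> col i < K"
    and col_disjoint: "i \<in> J \<Longrightarrow> j \<in> J \<Longrightarrow> i \<noteq> j \<Longrightarrow> col i = col j \<Longrightarrow> blk i \<inter> blk j = {}"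
begin

lemma disjoint_blocks: "disjoint_blocks Q {i \<in> J. col i = c} u blk R"
  using blk_sub blk_nonempty blk_near gate_local gate_unitary col_disjoint
  by unfold_locales auto

definition layer :: "nat \<Rightarrow> qubit local_op \<Rightarrow> qubit local_op" where
  "layer c = disjoint_blocks.act Q {i \<in> J. col i = c} u blk"

definition layers :: "nat \<Rightarrow> (qubit local_op \<Rightarrow> qubit local_op) list" where
  "layers n = rev (map layer [0..<n])"

definition circuit :: "nat \<Rightarrow> qubit local_op \<Rightarrow> qubit local_op" where
  "circuit n = foldr (\<circ>) (layers n) id"

lemma circuit_0: "circuit 0 = id"
  by (simp add: circuit_def layers_def)

lemma circuit_Suc: "circuit (Suc n) = layer n \<circ> circuit n"
  by (simp add: circuit_def layers_def)

lemma qca_layer: "qca Q (layer c)"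
  unfolding layer_def by (rule disjoint_blocks.qca_act[OF disjoint_blocks])

lemma qca_id: "qca Q id"
proof -
  have "F \<subseteq> Q \<Longrightarrow> a \<in> local_ops F \<Longrightarrow> a \<in> local_ops {q \<in> Q. \<exists>p\<in>F. near 0 p q}" for F a
    by (erule local_ops_mono) (auto intro: near_refl)
  then show ?thesis unfolding qca_def by auto
qed

lemma qca_circuit: "qca Q (circuit n)"
proof (induction n)
  case 0
  show ?case unfolding circuit_0 by (rule qca_id)
next
  case (Suc n)
  show ?case unfolding circuit_Suc by (rule qca_comp[OF qca_layer Suc])
qed

lemma finite_depth_circuit: "finite_depth_circuit Q (circuit n)"
  unfolding finite_depth_circuit_def composite_def circuit_def
  using disjoint_blocks.gate_layer_act[OF disjoint_blocks]
  by (intro exI[of _ "layers n"]) (auto simp: layers_def layer_def)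

text \<open>
  On a given local operator the circuit is conjugation by any sufficiently large finite product of
  gates, ordered by colour with the first layer to the right.
\<close>

lemma circuit_limit:
  assumes "a \<in> local_ops Q"
  shows "\<exists>T. finite T \<and> T \<subseteq> {i \<in> J. col i < n} \<and> (\<forall>xs. distinct xs \<and> sorted_wrt (\<lambda>i j. col j \<le> col i) xs \<and>
     T \<subseteq> set xs \<and> set xs \<subseteq> {i \<in> J. col i < n} \<longrightarrow> circuit n a = conjugate (prod_list (map u xs)) a)"
proof (induction n)
  case 0
  show ?case by (intro exI[of _ "{}"]) (auto simp: circuit_0)
next
  case (Suc n)
  then obtain T where T: "finite T" "T \<subseteq> {i \<in> J. col i < n}" and
    lim: "\<forall>xs. distinct xs \<and> sorted_wrt (\<lambda>i j. col j \<le> col i) xs \<and> T \<subseteq> set xs \<and>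
      set xs \<subseteq> {i \<in> J. col i < n} \<longrightarrow> circuit n a = conjugate (prod_list (map u xs)) a"
    by (elim exE conjE) (rule that)
  interpret disjoint_blocks Q "{i \<in> J. col i = n}" u blk R by (rule disjoint_blocks)
  have "circuit n a \<in> local_ops Q"
    using qca_circuit[of n] assms by (auto simp: qca_def bij_betw_def)
  then obtain F where F: "finite F" "F \<subseteq> Q" "circuit n a \<in> local_ops F" by (rule local_opsE)
  show ?case
  proof (intro exI[of _ "T \<union> meets F"] conjI allI impI)
    show "finite (T \<union> meets F)" using T finite_meets[OF F(1)] by simp
    show "T \<union> meets F \<subseteq> {i \<in> J. col i < Suc n}" using T meets_sub[of F] by auto
    fix xs
    assume "distinct xs \<and> sorted_wrt (\<lambda>i j. col j \<le> col i) xs \<and>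
     T \<union> meets F \<subseteq> set xs \<and> set xs \<subseteq> {i \<in> J. col i < Suc n}"
    then have xs: "distinct xs" "sorted_wrt (\<lambda>i j. col j \<le> col i) xs" "T \<subseteq> set xs" "meets F \<subseteq> set xs"
      "set xs \<subseteq> {i \<in> J. col i < Suc n}" by auto
    let ?ys = "filter (\<lambda>i. col i = n) xs" and ?zs = "filter (\<lambda>i. col i < n) xs"
    have split: "xs = ?ys @ ?zs"
      using xs(2,5)
    proof (induction xs)
      case (Cons x xs)
      show ?case
      proof (cases "col x = n")
        case False
        then have "\<forall>i\<in>set (x # xs). col i < n" using Cons.prems by auto
        then have "filter (\<lambda>i. col i = n) (x # xs) = []" "filter (\<lambda>i. col i < n) (x # xs) = x # xs"
          by (auto simp: filter_empty_conv filter_id_conv)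
        then show ?thesis by simp
      qed (use Cons in simp)
    qed simp
    have "circuit n a = conjugate (prod_list (map u ?zs)) a"
      by (rule lim[rule_format]) (use xs T in \<open>auto intro: sorted_wrt_filter\<close>)
    moreover have "act (circuit n a) = conjugate (prod_list (map u ?ys)) (circuit n a)"
      by (rule act_eq[OF F]) (use xs meets_sub[of F] in auto)
    moreover have "prod_list (map u xs) = prod_list (map u ?ys) * prod_list (map u ?zs)"
      by (subst split) simp
    ultimately show "circuit (Suc n) a = conjugate (prod_list (map u xs)) a"
      by (simp add: circuit_Suc layer_def conjugate_comp)
  qed
qed

end

section \<open>Local operators are spanned by Pauli operators\<close>

lemma character_sum:
  assumes F: "finite F"
  shows "(\<Sum>z\<in>Pow F. sgn1 (card (z \<inter> y))) = (if y \<inter> F = {} then 2 ^ card F else 0)"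
proof (cases "y \<inter> F = {}")
  case True
  then have "z \<inter> y = {}" if "z \<in> Pow F" for z using that by auto
  then have "(\<Sum>z\<in>Pow F. sgn1 (card (z \<inter> y))) = (\<Sum>z\<in>Pow F. 1)" by (intro sum.cong) auto
  then show ?thesis using True F by (simp add: card_Pow)
next
  case False
  then obtain q where q: "q \<in> y" "q \<in> F" by auto
  have "(\<Sum>z\<in>Pow F. sgn1 (card (z \<inter> y))) = (\<Sum>z\<in>Pow F. - sgn1 (card (z \<inter> y)))"
  proof (rule sum.reindex_bij_witness[of _ "\<lambda>z. z \<triangle> {q}" "\<lambda>z. z \<triangle> {q}"])
    fix z assume z: "z \<in> Pow F"
    have "(z \<triangle> {q}) \<inter> y = (z \<inter> y) \<triangle> {q}" using q by auto
    moreover have "finite (z \<inter> y)" using z F by (auto intro: finite_subset)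
    ultimately have "odd (card ((z \<triangle> {q}) \<inter> y) + card (z \<inter> y))"
      using card_sym_diff_parity[of "z \<inter> y" "{q}"] by auto
    then show "- sgn1 (card ((z \<triangle> {q}) \<inter> y)) = sgn1 (card (z \<inter> y))"
      by (cases "even (card (z \<inter> y))") auto
  qed (use q in auto)
  then show ?thesis using False by (simp add: sum_negf)
qed

lemma character_orthogonality:
  assumes F: "finite F" and y: "y \<subseteq> F" "y' \<subseteq> F"
  shows "(\<Sum>z\<in>Pow F. sgn1 (card (z \<inter> y)) * sgn1 (card (z \<inter> y'))) = (if y = y' then 2 ^ card F else 0)"
proof -
  have "(\<Sum>z\<in>Pow F. sgn1 (card (z \<inter> y)) * sgn1 (card (z \<inter> y'))) =
      (\<Sum>z\<in>Pow F. sgn1 (card (z \<inter> (y \<triangle> y'))))"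
  proof (rule sum.cong)
    fix z assume "z \<in> Pow F"
    then have "finite (z \<inter> y)" "finite (z \<inter> y')" using F by (auto intro: finite_subset)
    moreover have "z \<inter> (y \<triangle> y') = (z \<inter> y) \<triangle> (z \<inter> y')" by auto
    ultimately show "sgn1 (card (z \<inter> y)) * sgn1 (card (z \<inter> y')) = sgn1 (card (z \<inter> (y \<triangle> y')))"
      unfolding power_add[symmetric]
      using card_sym_diff_parity[of "z \<inter> y" "z \<inter> y'"] by (intro sgn1_cong) auto
  qed simp
  also have "\<dots> = (if y = y' then 2 ^ card F else 0)"
    unfolding character_sum[OF F] using y by auto
  finally show ?thesis .
qed

lemma entry_sum: "entry (sum f S) \<sigma> \<tau> = (\<Sum>i\<in>S. entry (f i) \<sigma> \<tau>)"
  by (induction S rule: infinite_finite_induct) (auto simp: zero_local_op.rep_eq plus_local_op.rep_eq)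

text \<open>
  Every matrix is a sum over \<open>x\<close> of a diagonal matrix times the flip of \<open>x\<close>; the diagonal matrices are
  expanded into characters of the configurations of \<open>F\<close>.
\<close>

lemma pauli_expansion:
  assumes F: "finite F" and a: "a \<in> local_ops F"
  shows "\<exists>c. a = (\<Sum>x\<in>Pow F. \<Sum>z\<in>Pow F. scale (c x z) (pauli x z))"
proof -
  have acts: "acts_on F (entry a)" using a F by (simp add: local_ops_finite)
  define \<kappa> where "\<kappa> x y = entry a (flip x (\<lambda>q. q \<in> y)) (\<lambda>q. q \<in> y)" for x y
  define c where "c x z = (\<Sum>y\<in>Pow F. sgn1 (card (z \<inter> y)) * \<kappa> x y) / 2 ^ card F" for x z
  have "a = (\<Sum>x\<in>Pow F. \<Sum>z\<in>Pow F. scale (c x z) (pauli x z))"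
  proof (rule local_op_eqI)
    fix \<sigma> \<tau> :: "'a \<Rightarrow> bool"
    define x0 where "x0 = {q. \<sigma> q \<noteq> \<tau> q}"
    define y0 where "y0 = {q \<in> F. \<tau> q}"
    have x0: "\<sigma> = flip x \<tau> \<longleftrightarrow> x = x0" for x
      by (auto simp: x0_def flip_def)
    have entry_x: "(\<Sum>z\<in>Pow F. entry (scale (c x z) (pauli x z)) \<sigma> \<tau>) = (if x = x0 then \<kappa> x y0 else 0)"
      if "x \<in> Pow F" for x
    proof (cases "x = x0")
      case True
      have "(\<Sum>z\<in>Pow F. entry (scale (c x z) (pauli x z)) \<sigma> \<tau>) = (\<Sum>z\<in>Pow F. c x z * sgn1 (card (z \<inter> y0)))"
      proof (rule sum.cong)
        fix z assume z: "z \<in> Pow F"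
        then have "{q \<in> z. \<tau> q} = z \<inter> y0" by (auto simp: y0_def)
        moreover have "finite x" "finite z" using z that F by (auto intro: finite_subset)
        moreover have "\<sigma> = flip x \<tau>" using True x0 by blast
        ultimately show "entry (scale (c x z) (pauli x z)) \<sigma> \<tau> = c x z * sgn1 (card (z \<inter> y0))"
          by (simp add: scale.rep_eq entry_pauli)
      qed simp
      also have "\<dots> = (\<Sum>z\<in>Pow F. \<Sum>y\<in>Pow F.
          \<kappa> x y / 2 ^ card F * (sgn1 (card (z \<inter> y)) * sgn1 (card (z \<inter> y0))))"
        unfolding c_def sum_divide_distrib sum_distrib_right by (intro sum.cong refl) (simp add: mult_ac)
      also have "\<dots> = (\<Sum>y\<in>Pow F. \<kappa> x y / 2 ^ card F *
          (\<Sum>z\<in>Pow F. sgn1 (card (z \<inter> y)) * sgn1 (card (z \<inter> y0))))"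
        by (subst sum.swap) (simp add: sum_distrib_left)
      also have "\<dots> = (\<Sum>y\<in>Pow F. if y = y0 then \<kappa> x y else 0)"
      proof (rule sum.cong)
        fix y assume "y \<in> Pow F"
        then show "\<kappa> x y / 2 ^ card F * (\<Sum>z\<in>Pow F. sgn1 (card (z \<inter> y)) * sgn1 (card (z \<inter> y0))) =
            (if y = y0 then \<kappa> x y else 0)"
          using character_orthogonality[OF F, of y y0] by (auto simp: y0_def)
      qed simp
      also have "\<dots> = \<kappa> x y0" using F by (subst sum.delta) (auto simp: y0_def)
      finally show ?thesis using True by simp
    next
      case False
      have "entry (scale (c x z) (pauli x z)) \<sigma> \<tau> = 0" for z
        using False x0 by (simp add: scale.rep_eq pauli.rep_eq pauli_entry_def)
      then show ?thesis using False by simp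
    qed
    have "entry (\<Sum>x\<in>Pow F. \<Sum>z\<in>Pow F. scale (c x z) (pauli x z)) \<sigma> \<tau> =
        (\<Sum>x\<in>Pow F. if x = x0 then \<kappa> x y0 else 0)"
      by (simp add: entry_sum entry_x)
    also have "\<dots> = (if x0 \<subseteq> F then \<kappa> x0 y0 else 0)" using F by (simp add: sum.delta)
    also have "\<dots> = entry a \<sigma> \<tau>"
    proof (cases "x0 \<subseteq> F")
      case True
      have "override_on (\<lambda>_. False) \<tau> F = (\<lambda>q. q \<in> y0)"
        by (rule ext) (auto simp: override_on_def y0_def)
      moreover have "override_on (\<lambda>_. False) \<sigma> F = flip x0 (\<lambda>q. q \<in> y0)"
        using True by (intro ext) (auto simp: override_on_def y0_def x0_def flip_def)
      ultimately have "\<kappa> x0 y0 = entry a \<sigma> \<tau>"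
        using acts_on_inv[OF acts, of \<sigma> \<tau> "\<lambda>_. False"] True by (force simp: \<kappa>_def x0_def)
      then show ?thesis using True by simp
    next
      case False
      then obtain q where "q \<notin> F" "\<sigma> q \<noteq> \<tau> q" by (auto simp: x0_def)
      then have "entry a \<sigma> \<tau> = 0" using acts_on_supp[OF acts] by blast
      then show ?thesis using False by simp
    qed
    finally show "entry a \<sigma> \<tau> = entry (\<Sum>x\<in>Pow F. \<Sum>z\<in>Pow F. scale (c x z) (pauli x z)) \<sigma> \<tau>" ..
  qed
  then show ?thesis by blast
qed

lemma qca_one:
  assumes "qca Q \<Phi>"
  shows "\<Phi> 1 = 1"
proof -
  have "1 \<in> \<Phi> ` local_ops Q" using qca_bij[OF assms] by (simp add: bij_betw_def)
  then obtain a where a: "a \<in> local_ops Q" "\<Phi> a = 1" by force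
  have "\<Phi> (1 * a) = \<Phi> 1 * \<Phi> a" by (rule qca_mult[OF assms]) (use a in auto)
  then show ?thesis using a by simp
qed

lemma qca_zero:
  assumes "qca Q \<Phi>"
  shows "\<Phi> 0 = 0"
  using qca_scale[OF assms, of 0 0] by simp

lemma pauli_subset_local: "finite x \<Longrightarrow> finite z \<Longrightarrow> x \<subseteq> Q \<Longrightarrow> z \<subseteq> Q \<Longrightarrow> pauli x z \<in> local_ops Q"
  by (rule local_ops_mono[OF pauli_local]) auto

lemma qca_eqI:
  assumes \<Phi>: "qca Q \<Phi>" and \<Psi>: "qca Q \<Psi>"
    and eq: "\<And>q. q \<in> Q \<Longrightarrow> \<Phi> (pauli_X q) = \<Psi> (pauli_X q)"
      "\<And>q. q \<in> Q \<Longrightarrow> \<Phi> (pauli_Z q) = \<Psi> (pauli_Z q)"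
    and a: "a \<in> local_ops Q"
  shows "\<Phi> a = \<Psi> a"
proof -
  have mult: "\<Phi> (b * c) = \<Psi> (b * c)"
    if "\<Phi> b = \<Psi> b" "\<Phi> c = \<Psi> c" "b \<in> local_ops Q" "c \<in> local_ops Q" for b c
    using that qca_mult[OF \<Phi>] qca_mult[OF \<Psi>] by simp
  have sum: "\<Phi> (sum f S) = \<Psi> (sum f S)"
    if "\<And>i. i \<in> S \<Longrightarrow> \<Phi> (f i) = \<Psi> (f i) \<and> f i \<in> local_ops Q" for f and S :: "qubit set set"
    using that
  proof (induction S rule: infinite_finite_induct)
    case (insert i S)
    have "sum f S \<in> local_ops Q" using insert by (auto intro: local_ops_sum)
    then show ?case
      using insert qca_add[OF \<Phi>, of "f i" "sum f S"] qca_add[OF \<Psi>, of "f i" "sum f S"] by simp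
  qed (simp_all add: qca_zero[OF \<Phi>] qca_zero[OF \<Psi>])
  have X: "\<Phi> (pauli x {}) = \<Psi> (pauli x {})" if "finite x" "x \<subseteq> Q" for x
    using that
  proof (induction x)
    case (insert q x)
    have "pauli (insert q x) {} = pauli_X q * pauli x {}"
      using insert by (simp add: pauli_X_eq pauli_mult insert_Diff_if)
    then show ?case
      using insert eq by (simp add: mult pauli_X_eq pauli_subset_local)
  qed (simp add: qca_one[OF \<Phi>] qca_one[OF \<Psi>])
  have Z: "\<Phi> (pauli {} z) = \<Psi> (pauli {} z)" if "finite z" "z \<subseteq> Q" for z
    using that
  proof (induction z)
    case (insert q z)
    have "pauli {} (insert q z) = pauli_Z q * pauli {} z"
      using insert by (simp add: pauli_Z_eq pauli_mult insert_Diff_if)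
    then show ?case
      using insert eq by (simp add: mult pauli_Z_eq pauli_subset_local)
  qed (simp add: qca_one[OF \<Phi>] qca_one[OF \<Psi>])
  have XZ: "\<Phi> (pauli x z) = \<Psi> (pauli x z)" if "finite x" "x \<subseteq> Q" "finite z" "z \<subseteq> Q" for x z
  proof -
    have "pauli x z = pauli x {} * pauli {} z" using that by (simp add: pauli_mult)
    then show ?thesis using that X Z by (simp add: mult pauli_subset_local)
  qed
  obtain F where F: "finite F" "F \<subseteq> Q" "a \<in> local_ops F" by (rule local_opsE[OF a])
  obtain c where c: "a = (\<Sum>x\<in>Pow F. \<Sum>z\<in>Pow F. scale (c x z) (pauli x z))"
    using pauli_expansion[OF F(1,3)] by blast
  have fin: "finite x" "x \<subseteq> Q" if "x \<in> Pow F" for x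
    using that F by (auto intro: finite_subset)
  show ?thesis
    unfolding c
  proof (rule sum, rule conjI, rule sum)
    fix x z assume xz: "x \<in> Pow F" "z \<in> Pow F"
    have "pauli x z \<in> local_ops Q" using fin xz by (simp add: pauli_subset_local)
    then show "\<Phi> (scale (c x z) (pauli x z)) = \<Psi> (scale (c x z) (pauli x z)) \<and>
        scale (c x z) (pauli x z) \<in> local_ops Q"
      using XZ[of x z] fin xz by (auto simp: qca_scale[OF \<Phi>] qca_scale[OF \<Psi>])
  next
    fix x assume x: "x \<in> Pow F"
    show "(\<Sum>z\<in>Pow F. scale (c x z) (pauli x z)) \<in> local_ops Q"
      using fin x by (intro local_ops_sum local_ops_scale pauli_subset_local) auto
  qed
qed

section \<open>Signed cup products on the hypercubic lattice\<close>

type_synonym chain = "cell \<Rightarrow>\<^sub>0 int"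

abbreviation "lookup \<equiv> Poly_Mapping.lookup"
abbreviation "keys \<equiv> Poly_Mapping.keys"

definition pairing :: "('a \<Rightarrow> int) \<Rightarrow> ('a \<Rightarrow>\<^sub>0 int) \<Rightarrow> int" where
  "pairing f x = lookup (frag_extend (\<lambda>k. frag_cmul (f k) (frag_of ())) x) ()"

lemma pairing_zero [simp]: "pairing f 0 = 0"
  by (simp add: pairing_def)

lemma pairing_of [simp]: "pairing f (frag_of k) = f k"
  by (simp add: pairing_def)

lemma pairing_add: "pairing f (x + y) = pairing f x + pairing f y"
  by (simp add: pairing_def frag_extend_add lookup_add)

lemma pairing_diff: "pairing f (x - y) = pairing f x - pairing f y"
  by (simp add: pairing_def frag_extend_diff lookup_minus)

lemma pairing_cmul: "pairing f (frag_cmul c x) = c * pairing f x"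
  by (simp add: pairing_def frag_extend_cmul)

lemma pairing_sum: "pairing f (sum g S) = (\<Sum>i\<in>S. pairing f (g i))"
  by (induction S rule: infinite_finite_induct) (auto simp: pairing_add)

lemma pairing_eq_sum: "pairing f x = (\<Sum>k\<in>keys x. lookup x k * f k)"
proof -
  have "lookup (\<Sum>i\<in>S. frag_cmul (lookup x i) (frag_cmul (f i) (frag_of ()))) () =
      (\<Sum>k\<in>S. lookup x k * f k)" for S
    by (induction S rule: infinite_finite_induct) (auto simp: lookup_add)
  then show ?thesis by (simp add: pairing_def frag_extend_def)
qed

lemma pairing_add_fun: "pairing (\<lambda>k. f k + g k) x = pairing f x + pairing g x"
  by (simp add: pairing_eq_sum distrib_left sum.distrib)

lemma pairing_cmul_fun: "pairing (\<lambda>k. c * f k) x = c * pairing f x"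
  by (simp add: pairing_eq_sum sum_distrib_left mult.left_commute)

lemma pairing_frag_extend: "pairing f (frag_extend g x) = pairing (\<lambda>k. pairing f (g k)) x"
  by (simp add: frag_extend_def pairing_sum pairing_cmul) (simp add: pairing_eq_sum)

text \<open>
  A cell is a list of \<open>d\<close> one-dimensional cells, each a vertex or an edge; the flag of a component
  says that it is an edge. The forms that occur are sums of products over the directions, up to
  the Koszul sign for moving the edges of the second cell past those of the first.
\<close>

type_synonym component = "int \<times> bool"

definition comp_at :: "cell \<Rightarrow> nat \<Rightarrow> component" where
  "comp_at s i = (fst s i, i \<in> snd s)"

definition koszul :: "nat set \<Rightarrow> nat set \<Rightarrow> int" where
  "koszul I J = (-1) ^ (\<Sum>i\<in>I. card {j \<in> J. j < i})"

lemma koszul_insert_left: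
  "finite I \<Longrightarrow> i \<notin> I \<Longrightarrow> koszul (insert i I) J = (-1) ^ card {j \<in> J. j < i} * koszul I J"
  by (simp add: koszul_def power_add)

lemma koszul_insert_right:
  assumes "finite I" "finite J" "j \<notin> J"
  shows "koszul I (insert j J) = (-1) ^ card {i \<in> I. j < i} * koszul I J"
proof -
  have "card {j' \<in> insert j J. j' < i} = of_bool (j < i) + card {j' \<in> J. j' < i}" for i
  proof (cases "j < i")
    case True
    then have "{j' \<in> insert j J. j' < i} = insert j {j' \<in> J. j' < i}" by auto
    then show ?thesis using True assms by simp
  next
    case False
    then have "{j' \<in> insert j J. j' < i} = {j' \<in> J. j' < i}" by auto
    then show ?thesis using False by simp
  qed
  moreover have "(\<Sum>i\<in>I. of_bool (j < i)) = card {i \<in> I. j < i}"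
    using assms(1) by (simp add: of_bool_def sum.If_cases Int_def)
  ultimately show ?thesis by (simp add: koszul_def sum.distrib power_add)
qed

text \<open>
  Each pair from disjoint \<open>I\<close> and \<open>J\<close> is inverted in exactly one of the two orders.
\<close>

lemma koszul_commute:
  assumes "finite I" "finite J" "I \<inter> J = {}"
  shows "koszul I J * koszul J I = (-1) ^ (card I * card J)"
  using assms
proof (induction I)
  case (insert i I)
  have "card J = card {j \<in> J. j < i} + card {j \<in> J. i < j}"
  proof -
    have "J = {j \<in> J. j < i} \<union> {j \<in> J. i < j}" using insert by auto
    moreover have "card ({j \<in> J. j < i} \<union> {j \<in> J. i < j}) = card {j \<in> J. j < i} + card {j \<in> J. i < j}"
      using insert by (intro card_Un_disjoint) auto
    ultimately show ?thesis by metis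
  qed
  then have "(-1 :: int) ^ card J = (-1) ^ card {j \<in> J. j < i} * (-1) ^ card {j \<in> J. i < j}"
    by (simp add: power_add)
  then show ?case
    using insert by (simp add: koszul_insert_left koszul_insert_right power_add mult_ac)
qed (simp add: koszul_def)

lemma koszul_square [simp]: "koszul I J * koszul I J = 1"
  by (simp add: koszul_def flip: power_add mult_2)

definition cup_form :: "component \<Rightarrow> component \<Rightarrow> int" where
  "cup_form p q = of_bool (\<not> snd p \<and> snd q \<and> fst p = fst q \<or> snd p \<and> \<not> snd q \<and> fst q = fst p + 1)"

definition edge_form :: "component \<Rightarrow> component \<Rightarrow> int" where
  "edge_form p q = of_bool (snd p \<and> snd q \<and> fst p = fst q)"

definition flipped :: "('a \<Rightarrow> 'a \<Rightarrow> 'b) \<Rightarrow> 'a \<Rightarrow> 'a \<Rightarrow> 'b" where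
  "flipped \<phi> p q = \<phi> q p"

text \<open>The one-dimensional coboundary, applied to either argument with the Koszul sign.\<close>

definition leibniz :: "(component \<Rightarrow> component \<Rightarrow> int) \<Rightarrow> component \<Rightarrow> component \<Rightarrow> int" where
  "leibniz \<phi> p q =
     (if snd p then 0 else \<phi> (fst p - 1, True) q - \<phi> (fst p, True) q) +
     (if snd q then 0 else (if snd p then - 1 else 1) * (\<phi> p (fst q - 1, True) - \<phi> p (fst q, True)))"

lemma leibniz_cup_form: "leibniz cup_form p q = 0"
  by (auto simp: leibniz_def cup_form_def)

lemma leibniz_flipped_cup_form: "leibniz (flipped cup_form) p q = 0"
  by (auto simp: leibniz_def cup_form_def flipped_def)

lemma leibniz_edge_form: "leibniz edge_form p q = flipped cup_form p q - cup_form p q"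
  by (auto simp: leibniz_def cup_form_def flipped_def edge_form_def)

lemma telescope:
  fixes f :: "nat \<Rightarrow> int"
  assumes "m \<le> n"
  shows "(\<Sum>c\<in>{m..<n}. f c - f (Suc c)) = f m - f n"
  using assms by (induction n rule: dec_induct) auto

lemma pairing_sum_fun: "pairing (\<lambda>s. \<Sum>c\<in>S. g c * h c s) x = (\<Sum>c\<in>S. g c * pairing (h c) x)"
  by (simp add: pairing_eq_sum sum_distrib_left mult.left_commute sum.swap[of _ S])

locale lattice =
  fixes d :: nat
begin

definition coboundary_cell :: "cell \<Rightarrow> chain" where
  "coboundary_cell r = (\<Sum>i\<in>{1..d} - snd r. frag_cmul ((-1) ^ card {j \<in> snd r. j < i})
     (frag_of ((fst r)(i := fst r i - 1), insert i (snd r)) - frag_of (fst r, insert i (snd r))))"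

definition coboundary :: "chain \<Rightarrow> chain" where
  "coboundary = frag_extend coboundary_cell"

definition unsigned_form :: "(nat \<Rightarrow> component \<Rightarrow> component \<Rightarrow> int) \<Rightarrow> cell \<Rightarrow> cell \<Rightarrow> int" where
  "unsigned_form \<phi> a b = (\<Prod>i\<in>{1..d}. \<phi> i (comp_at a i) (comp_at b i))"

definition form :: "(nat \<Rightarrow> component \<Rightarrow> component \<Rightarrow> int) \<Rightarrow> cell \<Rightarrow> cell \<Rightarrow> int" where
  "form \<phi> a b = koszul (snd a) (snd b) * unsigned_form \<phi> a b"

lemma unsigned_form_remove:
  assumes "i \<in> {1..d}" "\<And>j. j \<noteq> i \<Longrightarrow> comp_at a' j = comp_at a j" "\<And>j. j \<noteq> i \<Longrightarrow> comp_at b' j = comp_at b j"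
  shows "unsigned_form \<phi> a' b' =
    \<phi> i (comp_at a' i) (comp_at b' i) * (\<Prod>j\<in>{1..d} - {i}. \<phi> j (comp_at a j) (comp_at b j))"
proof -
  have "unsigned_form \<phi> a' b' =
      \<phi> i (comp_at a' i) (comp_at b' i) * (\<Prod>j\<in>{1..d} - {i}. \<phi> j (comp_at a' j) (comp_at b' j))"
    unfolding unsigned_form_def by (rule prod.remove) (use assms in auto)
  also have "(\<Prod>j\<in>{1..d} - {i}. \<phi> j (comp_at a' j) (comp_at b' j)) =
      (\<Prod>j\<in>{1..d} - {i}. \<phi> j (comp_at a j) (comp_at b j))"
    by (rule prod.cong) (use assms in auto)
  finally show ?thesis .
qed

lemma unsigned_form_split:
  assumes "c \<in> {1..d}" "\<And>j. j \<noteq> c \<Longrightarrow> \<phi> j = \<psi> j"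
  shows "unsigned_form \<phi> a b =
    \<phi> c (comp_at a c) (comp_at b c) * (\<Prod>j\<in>{1..d} - {c}. \<psi> j (comp_at a j) (comp_at b j))"
  unfolding unsigned_form_remove[OF assms(1) refl refl] using assms(2) by auto

text \<open>
  Products of one-dimensional forms obey the Leibniz rule direction by direction: the sign of the
  coboundary in direction \<open>i\<close>, combined with the change of the Koszul sign, is the parity of the total
  degree of the factors before \<open>i\<close>.
\<close>

lemma form_leibniz:
  assumes cells: "snd a \<subseteq> {1..d}" "snd b \<subseteq> {1..d}"
    and parity: "\<And>i p q. \<phi> i p q \<noteq> 0 \<Longrightarrow> even (deg i + of_bool (snd p) + of_bool (snd q))"
  shows "pairing (\<lambda>s. form \<phi> s b) (coboundary_cell a) +
      (-1) ^ card (snd a) * pairing (form \<phi> a) (coboundary_cell b) =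
    koszul (snd a) (snd b) * (\<Sum>i\<in>{1..d}. (-1) ^ (\<Sum>j\<in>{1..<i}. deg j) *
      leibniz (\<phi> i) (comp_at a i) (comp_at b i) * (\<Prod>j\<in>{1..d} - {i}. \<phi> j (comp_at a j) (comp_at b j)))"
proof -
  let ?I = "snd a" and ?J = "snd b"
  let ?P = "\<lambda>i. \<Prod>j\<in>{1..d} - {i}. \<phi> j (comp_at a j) (comp_at b j)"
  let ?k = "koszul ?I ?J"
  have fin: "finite ?I" "finite ?J" using cells finite_subset by auto
  let ?L = "\<lambda>i. if i \<in> ?I then 0 else (-1) ^ card {j \<in> ?I. j < i} * ((-1) ^ card {j \<in> ?J. j < i} * ?k) *
      (\<phi> i (fst a i - 1, True) (comp_at b i) - \<phi> i (fst a i, True) (comp_at b i)) * ?P i"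
  let ?R = "\<lambda>i. if i \<in> ?J then 0 else (-1) ^ card {j \<in> ?J. j < i} * ((-1) ^ card {j \<in> ?I. i < j} * ?k) *
      (\<phi> i (comp_at a i) (fst b i - 1, True) - \<phi> i (comp_at a i) (fst b i, True)) * ?P i"
  have "pairing (\<lambda>s. form \<phi> s b) (coboundary_cell a) = (\<Sum>i\<in>{1..d} - ?I. ?L i)"
    unfolding coboundary_cell_def pairing_sum
  proof (rule sum.cong)
    fix i assume i: "i \<in> {1..d} - ?I"
    have new: "unsigned_form \<phi> (v, insert i ?I) b = \<phi> i (v i, True) (comp_at b i) * ?P i"
      if "\<And>j. j \<noteq> i \<Longrightarrow> v j = fst a j" for v
      using unsigned_form_remove[of i "(v, insert i ?I)" a b b \<phi>] i that by (auto simp: comp_at_def)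
    have "koszul (insert i ?I) ?J = (-1) ^ card {j \<in> ?J. j < i} * ?k"
      using i fin by (simp add: koszul_insert_left)
    then show "pairing (\<lambda>s. form \<phi> s b) (frag_cmul ((-1) ^ card {j \<in> ?I. j < i})
        (frag_of ((fst a)(i := fst a i - 1), insert i ?I) - frag_of (fst a, insert i ?I))) = ?L i"
      using i by (simp add: pairing_cmul pairing_diff form_def new algebra_simps)
  qed simp
  also have "\<dots> = (\<Sum>i\<in>{1..d}. ?L i)"
    by (rule sum.mono_neutral_left) auto
  finally have L: "pairing (\<lambda>s. form \<phi> s b) (coboundary_cell a) = (\<Sum>i\<in>{1..d}. ?L i)" .
  have "pairing (form \<phi> a) (coboundary_cell b) = (\<Sum>i\<in>{1..d} - ?J. ?R i)"
    unfolding coboundary_cell_def pairing_sum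
  proof (rule sum.cong)
    fix i assume i: "i \<in> {1..d} - ?J"
    have new: "unsigned_form \<phi> a (v, insert i ?J) = \<phi> i (comp_at a i) (v i, True) * ?P i"
      if "\<And>j. j \<noteq> i \<Longrightarrow> v j = fst b j" for v
      using unsigned_form_remove[of i a a "(v, insert i ?J)" b \<phi>] i that by (auto simp: comp_at_def)
    have "koszul ?I (insert i ?J) = (-1) ^ card {j \<in> ?I. i < j} * ?k"
      using i fin by (simp add: koszul_insert_right)
    then show "pairing (form \<phi> a) (frag_cmul ((-1) ^ card {j \<in> ?J. j < i})
        (frag_of ((fst b)(i := fst b i - 1), insert i ?J) - frag_of (fst b, insert i ?J))) = ?R i"
      using i by (simp add: pairing_cmul pairing_diff form_def new algebra_simps)
  qed simp
  also have "\<dots> = (\<Sum>i\<in>{1..d}. ?R i)"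
    by (rule sum.mono_neutral_left) auto
  finally have R: "pairing (form \<phi> a) (coboundary_cell b) = (\<Sum>i\<in>{1..d}. ?R i)" .
  have "?L i + (-1) ^ card ?I * ?R i = ?k * ((-1) ^ (\<Sum>j\<in>{1..<i}. deg j) *
      leibniz (\<phi> i) (comp_at a i) (comp_at b i) * ?P i)" if i: "i \<in> {1..d}" for i
  proof (cases "?P i = 0")
    case False
    let ?m = "card {j \<in> ?I. j < i}" and ?n = "card {j \<in> ?J. j < i}"
    have card_below: "card {j \<in> A. j < i} = (\<Sum>j\<in>{1..<i}. of_bool (j \<in> A))" if "A \<subseteq> {1..d}" for A
    proof -
      have "{j \<in> A. j < i} = {1..<i} \<inter> {j. j \<in> A}" using that by auto
      then show ?thesis by (simp add: of_bool_def sum.If_cases)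
    qed
    have "even ((\<Sum>j\<in>{1..<i}. deg j) + (?m + ?n))"
    proof -
      have "even (deg j + of_bool (j \<in> ?I) + of_bool (j \<in> ?J))" if "j \<in> {1..<i}" for j
      proof -
        have "\<phi> j (comp_at a j) (comp_at b j) \<noteq> 0" using False i that by auto
        then show ?thesis using parity[of j "comp_at a j" "comp_at b j"] by (simp add: comp_at_def)
      qed
      then have "even (\<Sum>j\<in>{1..<i}. deg j + of_bool (j \<in> ?I) + of_bool (j \<in> ?J))"
        by (intro dvd_sum) auto
      then show ?thesis by (simp add: card_below[OF cells(1)] card_below[OF cells(2)] sum.distrib add.assoc)
    qed
    then have sign: "(-1 :: int) ^ (\<Sum>j\<in>{1..<i}. deg j) = (-1) ^ ?m * (-1) ^ ?n"
      unfolding minus_one_power_iff by auto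
    have "card ?I = ?m + of_bool (i \<in> ?I) + card {j \<in> ?I. i < j}"
    proof -
      have "card ?I = card ({j \<in> ?I. j < i} \<union> ({j \<in> ?I. j = i} \<union> {j \<in> ?I. i < j}))"
        by (rule arg_cong[where f = card]) auto
      also have "\<dots> = ?m + card ({j \<in> ?I. j = i} \<union> {j \<in> ?I. i < j})"
        using fin by (intro card_Un_disjoint) auto
      also have "card ({j \<in> ?I. j = i} \<union> {j \<in> ?I. i < j}) = card {j \<in> ?I. j = i} + card {j \<in> ?I. i < j}"
        using fin by (intro card_Un_disjoint) auto
      also have "{j \<in> ?I. j = i} = (if i \<in> ?I then {i} else {})" by auto
      finally show ?thesis by simp
    qed
    then have above: "(-1 :: int) ^ card {j \<in> ?I. i < j} = (-1) ^ card ?I * (-1) ^ ?m * (if i \<in> ?I then - 1 else 1)"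
      unfolding minus_one_power_iff by auto
    have sq: "(-1 :: int) ^ n * ((-1) ^ n * x) = x" for n x by (simp add: mult.assoc[symmetric] flip: power_add mult_2)
    show ?thesis
      unfolding leibniz_def sign above by (simp add: comp_at_def sq algebra_simps)
  next
    case True
    show ?thesis unfolding True by simp
  qed
  then show ?thesis
    unfolding L R sum_distrib_left sum.distrib[symmetric] by (intro sum.cong) auto
qed

definition cup0_form :: "cell \<Rightarrow> cell \<Rightarrow> int" where
  "cup0_form = form (\<lambda>_. cup_form)"

definition cup0_flipped :: "cell \<Rightarrow> cell \<Rightarrow> int" where
  "cup0_flipped = form (\<lambda>_. flipped cup_form)"

definition factors1 :: "nat \<Rightarrow> nat \<Rightarrow> component \<Rightarrow> component \<Rightarrow> int" where
  "factors1 c i = (if i < c then cup_form else if i = c then edge_form else flipped cup_form)"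

definition cup1_form :: "cell \<Rightarrow> cell \<Rightarrow> int" where
  "cup1_form a b = (\<Sum>c\<in>{1..d}. (-1) ^ (c - 1) * form (factors1 c) a b)"

lemma factors1_parity:
  "factors1 c i p q \<noteq> 0 \<Longrightarrow> even ((if i = c then 0 else 1) + of_bool (snd p) + of_bool (snd q))"
  by (cases p; cases q) (auto simp: factors1_def flipped_def cup_form_def edge_form_def split: if_splits)

text \<open>
  Only the edge factor of each summand has a nonzero coboundary, and it replaces that factor by the
  difference of the two kinds of factors on its sides; the sum over its position \<open>c\<close> telescopes.
\<close>

lemma cup1_leibniz:
  assumes cells: "snd a \<subseteq> {1..d}" "snd b \<subseteq> {1..d}"
  shows "pairing (\<lambda>s. cup1_form s b) (coboundary_cell a) +
      (-1) ^ card (snd a) * pairing (cup1_form a) (coboundary_cell b) =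
    cup0_flipped a b - cup0_form a b"
proof -
  let ?A = "\<lambda>c. unsigned_form (\<lambda>i. if i < c then cup_form else flipped cup_form) a b"
  have step: "pairing (\<lambda>s. form (factors1 c) s b) (coboundary_cell a) +
      (-1) ^ card (snd a) * pairing (form (factors1 c) a) (coboundary_cell b) =
      koszul (snd a) (snd b) * ((-1) ^ (c - 1) * (?A c - ?A (Suc c)))" if c: "c \<in> {1..d}" for c
  proof -
    let ?P = "\<Prod>j\<in>{1..d} - {c}. factors1 c j (comp_at a j) (comp_at b j)"
    have deg: "(\<Sum>j\<in>{1..<c}. if j = c then 0 else 1) = c - 1" by simp
    have "pairing (\<lambda>s. form (factors1 c) s b) (coboundary_cell a) +
      (-1) ^ card (snd a) * pairing (form (factors1 c) a) (coboundary_cell b) =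
      koszul (snd a) (snd b) * (\<Sum>i\<in>{1..d}. (-1) ^ (\<Sum>j\<in>{1..<i}. if j = c then 0 else 1) *
      leibniz (factors1 c i) (comp_at a i) (comp_at b i) * (\<Prod>j\<in>{1..d} - {i}. factors1 c j (comp_at a j) (comp_at b j)))"
      by (rule form_leibniz[OF cells factors1_parity])
    also have "(\<Sum>i\<in>{1..d}. (-1) ^ (\<Sum>j\<in>{1..<i}. if j = c then 0 else 1) *
      leibniz (factors1 c i) (comp_at a i) (comp_at b i) * (\<Prod>j\<in>{1..d} - {i}. factors1 c j (comp_at a j) (comp_at b j))) =
      (\<Sum>i\<in>{c}. (-1) ^ (\<Sum>j\<in>{1..<i}. if j = c then 0 else 1) *
      leibniz (factors1 c i) (comp_at a i) (comp_at b i) * (\<Prod>j\<in>{1..d} - {i}. factors1 c j (comp_at a j) (comp_at b j)))"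
      by (rule sum.mono_neutral_right)
        (use c in \<open>auto simp: factors1_def leibniz_cup_form leibniz_flipped_cup_form\<close>)
    also have "\<dots> = (-1) ^ (c - 1) * (?A c - ?A (Suc c))"
    proof -
      have "?A c = flipped cup_form (comp_at a c) (comp_at b c) * ?P"
        "?A (Suc c) = cup_form (comp_at a c) (comp_at b c) * ?P"
        using c by (subst unsigned_form_split[of c _ "factors1 c"]; auto simp: factors1_def)+
      then show ?thesis
        using deg by (simp add: leibniz_edge_form factors1_def left_diff_distrib)
    qed
    finally show ?thesis .
  qed
  have "pairing (\<lambda>s. cup1_form s b) (coboundary_cell a) +
      (-1) ^ card (snd a) * pairing (cup1_form a) (coboundary_cell b) =
    (\<Sum>c\<in>{1..d}. (-1) ^ (c - 1) * (pairing (\<lambda>s. form (factors1 c) s b) (coboundary_cell a) +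
      (-1) ^ card (snd a) * pairing (form (factors1 c) a) (coboundary_cell b)))"
    by (simp add: cup1_form_def[abs_def] pairing_sum_fun distrib_left sum.distrib sum_distrib_left mult.left_commute)
  also have "\<dots> = (\<Sum>c\<in>{1..d}. koszul (snd a) (snd b) * (?A c - ?A (Suc c)))"
    using step by (intro sum.cong) (auto simp: mult.left_commute mult.assoc[symmetric] simp flip: power_add mult_2)
  also have "\<dots> = koszul (snd a) (snd b) * (?A 1 - ?A (Suc d))"
    unfolding sum_distrib_left[symmetric] atLeastLessThanSuc_atLeastAtMost[symmetric]
    by (subst telescope) auto
  also have "?A 1 = unsigned_form (\<lambda>_. flipped cup_form) a b"
    unfolding unsigned_form_def by (rule prod.cong) auto
  also have "?A (Suc d) = unsigned_form (\<lambda>_. cup_form) a b"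
    unfolding unsigned_form_def by (rule prod.cong) auto
  finally show ?thesis
    by (simp add: cup0_form_def cup0_flipped_def form_def right_diff_distrib)
qed

definition factors2 :: "nat \<Rightarrow> nat \<Rightarrow> nat \<Rightarrow> component \<Rightarrow> component \<Rightarrow> int" where
  "factors2 c c' i = (if i < c then cup_form else if i = c then edge_form
     else if i < c' then flipped cup_form else if i = c' then edge_form else cup_form)"

text \<open>
  The signs are such that both partial sums in the Leibniz rule telescope, and that their common end terms,
  with a single edge factor and no flipped factor, cancel.
\<close>

definition cup2_form :: "cell \<Rightarrow> cell \<Rightarrow> int" where
  "cup2_form a b = (\<Sum>(c, c') \<in> {(c, c'). c \<in> {1..d} \<and> c' \<in> {1..d} \<and> c < c'}.
     (-1) ^ (c - 1 + c') * form (factors2 c c') a b)"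

lemma factors2_parity:
  "c < c' \<Longrightarrow> factors2 c c' i p q \<noteq> 0 \<Longrightarrow>
   even ((if i = c \<or> i = c' then 0 else 1) + of_bool (snd p) + of_bool (snd q))"
  by (cases p; cases q) (auto simp: factors2_def flipped_def cup_form_def edge_form_def split: if_splits)

lemma sum_pairs:
  fixes f :: "nat \<Rightarrow> nat \<Rightarrow> int"
  shows "(\<Sum>(c, c') \<in> {(c, c'). c \<in> {1..d} \<and> c' \<in> {1..d} \<and> c < c'}. f c c') =
      (\<Sum>c'\<in>{1..d}. \<Sum>c\<in>{1..<c'}. f c c')"
    and "(\<Sum>(c, c') \<in> {(c, c'). c \<in> {1..d} \<and> c' \<in> {1..d} \<and> c < c'}. f c c') =
      (\<Sum>c\<in>{1..d}. \<Sum>c'\<in>{Suc c..<Suc d}. f c c')"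
proof -
  have "(\<Sum>c'\<in>{1..d}. \<Sum>c\<in>{1..<c'}. f c c') = (\<Sum>(c', c)\<in>(SIGMA c':{1..d}. {1..<c'}). f c c')"
    by (rule sum.Sigma) auto
  also have "\<dots> = (\<Sum>(c, c') \<in> {(c, c'). c \<in> {1..d} \<and> c' \<in> {1..d} \<and> c < c'}. f c c')"
    by (rule sum.reindex_bij_witness[of _ prod.swap prod.swap]) auto
  finally show "(\<Sum>(c, c') \<in> {(c, c'). c \<in> {1..d} \<and> c' \<in> {1..d} \<and> c < c'}. f c c') =
      (\<Sum>c'\<in>{1..d}. \<Sum>c\<in>{1..<c'}. f c c')" ..
  have "(\<Sum>c\<in>{1..d}. \<Sum>c'\<in>{Suc c..<Suc d}. f c c') = (\<Sum>(c, c')\<in>(SIGMA c:{1..d}. {Suc c..<Suc d}). f c c')"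
    by (rule sum.Sigma) auto
  also have "(SIGMA c:{1..d}. {Suc c..<Suc d}) = {(c, c'). c \<in> {1..d} \<and> c' \<in> {1..d} \<and> c < c'}"
    by auto
  finally show "(\<Sum>(c, c') \<in> {(c, c'). c \<in> {1..d} \<and> c' \<in> {1..d} \<and> c < c'}. f c c') =
      (\<Sum>c\<in>{1..d}. \<Sum>c'\<in>{Suc c..<Suc d}. f c c')" ..
qed

lemma cup2_leibniz:
  assumes cells: "snd a \<subseteq> {1..d}" "snd b \<subseteq> {1..d}"
  shows "pairing (\<lambda>s. cup2_form s b) (coboundary_cell a) +
      (-1) ^ card (snd a) * pairing (cup2_form a) (coboundary_cell b) =
    cup1_form a b - koszul (snd a) (snd b) * koszul (snd b) (snd a) * cup1_form b a"
proof -
  let ?S = "{(c, c'). c \<in> {1..d} \<and> c' \<in> {1..d} \<and> c < c'}"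
  let ?X = "\<lambda>c' c. unsigned_form (\<lambda>i. if i < c then cup_form else if i < c' then flipped cup_form
      else if i = c' then edge_form else cup_form) a b"
  let ?Z = "\<lambda>c c'. unsigned_form (\<lambda>i. if i < c then cup_form else if i = c then edge_form
      else if i < c' then flipped cup_form else cup_form) a b"
  let ?k = "koszul (snd a) (snd b)"
  have step: "pairing (\<lambda>s. form (factors2 c c') s b) (coboundary_cell a) +
      (-1) ^ card (snd a) * pairing (form (factors2 c c') a) (coboundary_cell b) =
      ?k * ((-1) ^ (c - 1) * (?X c' c - ?X c' (Suc c)) - (-1) ^ c' * (?Z c c' - ?Z c (Suc c')))"
    if c: "c \<in> {1..d}" "c' \<in> {1..d}" "c < c'" for c c'
  proof -
    let ?T = "\<lambda>i. (-1) ^ (\<Sum>j\<in>{1..<i}. if j = c \<or> j = c' then 0 else 1) *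
      leibniz (factors2 c c' i) (comp_at a i) (comp_at b i) *
      (\<Prod>j\<in>{1..d} - {i}. factors2 c c' j (comp_at a j) (comp_at b j))"
    let ?P = "\<lambda>c0. \<Prod>j\<in>{1..d} - {c0}. factors2 c c' j (comp_at a j) (comp_at b j)"
    have deg: "(\<Sum>j\<in>{1..<c}. if j = c \<or> j = c' then 0 else 1) = c - 1"
    proof -
      have "(\<Sum>j\<in>{1..<c}. if j = c \<or> j = c' then 0 else 1) = (\<Sum>j\<in>{1..<c}. 1 :: nat)"
        by (rule sum.cong) (use c in auto)
      then show ?thesis by simp
    qed
    have deg': "Suc (Suc (\<Sum>j\<in>{1..<c'}. if j = c \<or> j = c' then 0 else 1)) = c'"
    proof -
      have "(\<Sum>j\<in>{1..<c'}. if j = c \<or> j = c' then 0 else 1) = (\<Sum>j\<in>{1..<c'} - {c}. 1 :: nat)"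
        by (rule sum.mono_neutral_cong_right) (use c in auto)
      then show ?thesis using c by simp
    qed
    have "pairing (\<lambda>s. form (factors2 c c') s b) (coboundary_cell a) +
      (-1) ^ card (snd a) * pairing (form (factors2 c c') a) (coboundary_cell b) = ?k * (\<Sum>i\<in>{1..d}. ?T i)"
      by (rule form_leibniz[OF cells factors2_parity[OF c(3)]])
    also have "(\<Sum>i\<in>{1..d}. ?T i) = (\<Sum>i\<in>{c, c'}. ?T i)"
      by (rule sum.mono_neutral_right)
        (use c in \<open>auto simp: factors2_def leibniz_cup_form leibniz_flipped_cup_form\<close>)
    also have "\<dots> = ?T c + ?T c'" using c by simp
    also have "?T c = (-1) ^ (c - 1) * (?X c' c - ?X c' (Suc c))"
    proof -
      have "?X c' c = flipped cup_form (comp_at a c) (comp_at b c) * ?P c"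
        "?X c' (Suc c) = cup_form (comp_at a c) (comp_at b c) * ?P c"
        using c by (subst unsigned_form_split[of c _ "factors2 c c'"]; auto simp: factors2_def)+
      then show ?thesis
        unfolding deg using c by (simp add: leibniz_edge_form factors2_def left_diff_distrib)
    qed
    also have "?T c' = - ((-1) ^ c' * (?Z c c' - ?Z c (Suc c')))"
    proof -
      have Z: "?Z c c' = cup_form (comp_at a c') (comp_at b c') * ?P c'"
        "?Z c (Suc c') = flipped cup_form (comp_at a c') (comp_at b c') * ?P c'"
        using c by (subst unsigned_form_split[of c' _ "factors2 c c'"]; auto simp: factors2_def)+
      have sign: "(-1 :: int) ^ (\<Sum>j\<in>{1..<c'}. if j = c \<or> j = c' then 0 else 1) = (-1) ^ c'"
      proof -
        have "(-1 :: int) ^ c' = (-1) ^ Suc (Suc (\<Sum>j\<in>{1..<c'}. if j = c \<or> j = c' then 0 else 1))"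
          by (simp only: deg')
        then show ?thesis by (simp only: power_Suc mult_minus1 minus_minus)
      qed
      have "factors2 c c' c' = edge_form" using c by (simp add: factors2_def)
      then show ?thesis
        unfolding sign Z by (simp only: leibniz_edge_form left_diff_distrib right_diff_distrib mult.assoc minus_diff_eq)
    qed
    finally show ?thesis by simp
  qed
  have "pairing (\<lambda>s. cup2_form s b) (coboundary_cell a) +
      (-1) ^ card (snd a) * pairing (cup2_form a) (coboundary_cell b) =
    (\<Sum>(c, c')\<in>?S. (-1) ^ (c - 1 + c') * (pairing (\<lambda>s. form (factors2 c c') s b) (coboundary_cell a) +
      (-1) ^ card (snd a) * pairing (form (factors2 c c') a) (coboundary_cell b)))"
    by (simp add: cup2_form_def[abs_def] case_prod_unfold pairing_sum_fun distrib_left sum.distrib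
        sum_distrib_left mult.left_commute)
  also have "\<dots> = (\<Sum>(c, c')\<in>?S. ?k * ((-1) ^ c' * (?X c' c - ?X c' (Suc c))) +
      - ?k * ((-1) ^ (c - 1) * (?Z c c' - ?Z c (Suc c'))))"
  proof (rule sum.cong[OF refl], clarify)
    fix c c' assume c: "c \<in> {1..d}" "c' \<in> {1..d}" "c < c'"
    have sq: "(-1 :: int) ^ n * ((-1) ^ n * x) = x" for n x
      by (simp add: mult.assoc[symmetric] flip: power_add mult_2)
    show "(-1) ^ (c - 1 + c') * (pairing (\<lambda>s. form (factors2 c c') s b) (coboundary_cell a) +
      (-1) ^ card (snd a) * pairing (form (factors2 c c') a) (coboundary_cell b)) =
      ?k * ((-1) ^ c' * (?X c' c - ?X c' (Suc c))) +
      - ?k * ((-1) ^ (c - 1) * (?Z c c' - ?Z c (Suc c')))"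
      unfolding step[OF c] power_add by (simp add: right_diff_distrib mult_ac sq)
  qed
  also have "\<dots> = (\<Sum>(c, c')\<in>?S. ?k * ((-1) ^ c' * (?X c' c - ?X c' (Suc c)))) +
      (\<Sum>(c, c')\<in>?S. - ?k * ((-1) ^ (c - 1) * (?Z c c' - ?Z c (Suc c'))))"
    by (simp only: case_prod_unfold sum.distrib)
  also have "(\<Sum>(c, c')\<in>?S. ?k * ((-1) ^ c' * (?X c' c - ?X c' (Suc c)))) =
      (\<Sum>c\<in>{1..d}. ?k * ((-1) ^ c * (?X c 1 - ?X c c)))"
    unfolding sum_pairs(1) sum_distrib_left[symmetric]
    by (intro arg_cong[where f = "(*) ?k"] sum.cong arg_cong2[where f = "(*)"] refl telescope) auto
  also have "(\<Sum>(c, c')\<in>?S. - ?k * ((-1) ^ (c - 1) * (?Z c c' - ?Z c (Suc c')))) =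
      (\<Sum>c\<in>{1..d}. - ?k * ((-1) ^ (c - 1) * (?Z c (Suc c) - ?Z c (Suc d))))"
    unfolding sum_pairs(2) sum_distrib_left[symmetric]
    by (intro arg_cong[where f = "(*) (- ?k)"] sum.cong arg_cong2[where f = "(*)"] refl telescope) auto
  also have "(\<Sum>c\<in>{1..d}. ?k * ((-1) ^ c * (?X c 1 - ?X c c))) +
      (\<Sum>c\<in>{1..d}. - ?k * ((-1) ^ (c - 1) * (?Z c (Suc c) - ?Z c (Suc d)))) =
      (\<Sum>c\<in>{1..d}. ?k * ((-1) ^ (c - 1) * (unsigned_form (factors1 c) a b - unsigned_form (factors1 c) b a)))"
    unfolding sum.distrib[symmetric]
  proof (rule sum.cong[OF refl])
    fix c assume c: "c \<in> {1..d}"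
    have "?X c 1 = unsigned_form (factors1 c) b a"
      unfolding unsigned_form_def
      by (rule prod.cong) (auto simp: factors1_def flipped_def edge_form_def of_bool_def)
    moreover have "?X c c = ?Z c (Suc c)"
      unfolding unsigned_form_def by (rule prod.cong) auto
    moreover have "?Z c (Suc d) = unsigned_form (factors1 c) a b"
      unfolding unsigned_form_def by (rule prod.cong) (auto simp: factors1_def)
    moreover have "(-1 :: int) ^ c = - ((-1) ^ (c - 1))" using c by (cases c) auto
    ultimately show "?k * ((-1) ^ c * (?X c 1 - ?X c c)) +
        - ?k * ((-1) ^ (c - 1) * (?Z c (Suc c) - ?Z c (Suc d))) =
        ?k * ((-1) ^ (c - 1) * (unsigned_form (factors1 c) a b - unsigned_form (factors1 c) b a))"
      by (simp add: algebra_simps)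
  qed
  also have "\<dots> = cup1_form a b - ?k * koszul (snd b) (snd a) * cup1_form b a"
    unfolding cup1_form_def sum_distrib_left sum_subtractf[symmetric]
  proof (rule sum.cong[OF refl])
    fix c
    have "koszul (snd b) (snd a) * form (factors1 c) b a = unsigned_form (factors1 c) b a"
      by (simp add: form_def mult.assoc[symmetric])
    then show "?k * ((-1) ^ (c - 1) * (unsigned_form (factors1 c) a b - unsigned_form (factors1 c) b a)) =
        (-1) ^ (c - 1) * form (factors1 c) a b -
        ?k * koszul (snd b) (snd a) * ((-1) ^ (c - 1) * form (factors1 c) b a)"
      by (simp add: form_def right_diff_distrib mult_ac)
  qed
  finally show ?thesis .
qed

end

section \<open>A quadratic function with values modulo four\<close>

definition bilinear :: "(cell \<Rightarrow> cell \<Rightarrow> int) \<Rightarrow> chain \<Rightarrow> chain \<Rightarrow> int" where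
  "bilinear c a b = pairing (\<lambda>s. pairing (c s) b) a"

lemma bilinear_of [simp]: "bilinear c (frag_of s) (frag_of t) = c s t"
  by (simp add: bilinear_def)

lemma bilinear_eq_sum: "bilinear c a b = (\<Sum>s\<in>keys a. \<Sum>t\<in>keys b. lookup a s * lookup b t * c s t)"
  by (simp add: bilinear_def pairing_eq_sum sum_distrib_left mult.assoc)

lemma bilinear_add_left: "bilinear c (a + a') b = bilinear c a b + bilinear c a' b"
  by (simp add: bilinear_def pairing_add)

lemma bilinear_add_right: "bilinear c a (b + b') = bilinear c a b + bilinear c a b'"
  by (simp add: bilinear_def pairing_add pairing_add_fun)

lemma bilinear_cmul_left: "bilinear c (frag_cmul k a) b = k * bilinear c a b"
  by (simp add: bilinear_def pairing_cmul)

lemma bilinear_cmul_right: "bilinear c a (frag_cmul k b) = k * bilinear c a b"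
  by (simp add: bilinear_def pairing_cmul pairing_cmul_fun)

lemma bilinear_zero_left [simp]: "bilinear c 0 b = 0"
  by (simp add: bilinear_def)

lemma bilinear_zero_right [simp]: "bilinear c a 0 = 0"
  by (simp add: bilinear_def pairing_eq_sum)

lemma bilinear_add_fun: "bilinear (\<lambda>s t. c s t + c' s t) a b = bilinear c a b + bilinear c' a b"
  by (simp add: bilinear_def pairing_add_fun)

lemma bilinear_cmul_fun: "bilinear (\<lambda>s t. k * c s t) a b = k * bilinear c a b"
  by (simp add: bilinear_def pairing_cmul_fun)

lemma bilinear_flip: "bilinear c a b = bilinear (\<lambda>t s. c s t) b a"
  unfolding bilinear_eq_sum by (subst sum.swap) (simp add: mult_ac)

lemma bilinear_cong:
  "(\<And>s t. s \<in> keys a \<Longrightarrow> t \<in> keys b \<Longrightarrow> c s t = c' s t) \<Longrightarrow> bilinear c a b = bilinear c' a b"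
  unfolding bilinear_eq_sum by (intro sum.cong refl) auto

lemma bilinear_eq_0:
  "(\<And>s t. s \<in> keys a \<Longrightarrow> t \<in> keys b \<Longrightarrow> c s t = 0) \<Longrightarrow> bilinear c a b = 0"
  unfolding bilinear_eq_sum by (intro sum.neutral ballI) auto

lemma bilinear_extend_right:
  "bilinear c a (frag_extend g b) = bilinear (\<lambda>s k. pairing (c s) (g k)) a b"
  by (simp add: bilinear_def pairing_frag_extend)

lemma bilinear_extend_left:
  "bilinear c (frag_extend g a) b = bilinear (\<lambda>k t. pairing (\<lambda>s. c s t) (g k)) a b"
  by (subst (1 2) bilinear_flip) (simp add: bilinear_extend_right)

lemma even_bilinear:
  assumes "\<And>s t. s \<in> keys a \<Longrightarrow> t \<in> keys b \<Longrightarrow> even (c s t)"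
  shows "even (bilinear c a b)"
  unfolding bilinear_eq_sum using assms by (intro dvd_sum) auto

definition half :: "('a \<Rightarrow>\<^sub>0 int) \<Rightarrow> ('a \<Rightarrow>\<^sub>0 int)" where
  "half x = Poly_Mapping.map (\<lambda>k. k div 2) x"

lemma lookup_half [simp]: "lookup (half x) k = lookup x k div 2"
  by (auto simp: half_def Poly_Mapping.map.rep_eq when_def)

lemma keys_half: "keys (half x) \<subseteq> keys x"
  by (auto simp: in_keys_iff)

lemma frag_cmul_diff_distrib2: "frag_cmul c (a - b) = frag_cmul c a - frag_cmul c b"
  by (rule poly_mapping_eqI) (simp add: lookup_minus right_diff_distrib)

definition near_cells :: "nat \<Rightarrow> cell \<Rightarrow> cell \<Rightarrow> bool" where
  "near_cells R a b \<longleftrightarrow> (\<forall>i. \<bar>fst a i - fst b i\<bar> \<le> int R)"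

lemma near_cells_sym: "near_cells R a b \<Longrightarrow> near_cells R b a"
  by (simp add: near_cells_def abs_minus_commute)

lemma near_cells_refl [simp]: "near_cells R a a"
  by (simp add: near_cells_def)

lemma near_cells_trans:
  assumes "near_cells R a b" "near_cells R' b c"
  shows "near_cells (R + R') a c"
  unfolding near_cells_def
proof
  fix i
  have "\<bar>fst a i - fst b i\<bar> \<le> int R" "\<bar>fst b i - fst c i\<bar> \<le> int R'"
    using assms by (auto simp: near_cells_def)
  then show "\<bar>fst a i - fst c i\<bar> \<le> int (R + R')" by linarith
qed

lemma near_cells_mono: "near_cells R a b \<Longrightarrow> R \<le> R' \<Longrightarrow> near_cells R' a b"
  unfolding near_cells_def by (meson of_nat_mono order_trans)

definition chain_of :: "cell set \<Rightarrow> chain" where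
  "chain_of n = (\<Sum>s\<in>n. frag_of s)"

lemma lookup_chain_of: "finite n \<Longrightarrow> lookup (chain_of n) s = of_bool (s \<in> n)"
  unfolding chain_of_def by (induction n rule: finite_induct) (auto simp: lookup_add)

lemma keys_chain_of: "finite n \<Longrightarrow> keys (chain_of n) = n"
  by (auto simp: in_keys_iff lookup_chain_of)

lemma pairing_chain_of: "pairing f (chain_of n) = sum f n"
  by (simp add: chain_of_def pairing_sum)

lemma chain_of_empty [simp]: "chain_of {} = 0"
  by (simp add: chain_of_def)

lemma cellsD: "s \<in> cells d p \<Longrightarrow> snd s \<subseteq> {1..d} \<and> card (snd s) = p \<and> fst s \<in> points d"
  by (auto simp: cells_def)

context lattice
begin

lemma forms_near:
  "cup_form p q \<noteq> 0 \<Longrightarrow> \<bar>fst p - fst q\<bar> \<le> 1" "flipped cup_form p q \<noteq> 0 \<Longrightarrow> \<bar>fst p - fst q\<bar> \<le> 1"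
  "edge_form p q \<noteq> 0 \<Longrightarrow> \<bar>fst p - fst q\<bar> \<le> 1"
  by (auto simp: cup_form_def edge_form_def flipped_def of_bool_def split: if_splits)

lemma near_cells_of_components:
  assumes "fst a \<in> points d" "fst b \<in> points d" "unsigned_form \<phi> a b \<noteq> 0"
    and "\<And>i p q. \<phi> i p q \<noteq> 0 \<Longrightarrow> \<bar>fst p - fst q\<bar> \<le> 1"
  shows "near_cells 1 a b"
  unfolding near_cells_def
proof
  fix i
  show "\<bar>fst a i - fst b i\<bar> \<le> int 1"
  proof (cases "i \<in> {1..d}")
    case True
    then have "\<phi> i (comp_at a i) (comp_at b i) \<noteq> 0"
      using assms(3) by (auto simp: unsigned_form_def)
    then show ?thesis using assms(4) by (fastforce simp: comp_at_def)
  next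
    case False
    then have "fst a i = 0" "fst b i = 0" using assms(1,2) unfolding points_def by blast+
    then show ?thesis by simp
  qed
qed

lemma cup1_form_near:
  assumes "fst a \<in> points d" "fst b \<in> points d" "cup1_form a b \<noteq> 0"
  shows "near_cells 1 a b"
proof -
  obtain c where "unsigned_form (factors1 c) a b \<noteq> 0"
    using assms(3) unfolding cup1_form_def form_def by (metis (no_types, lifting) mult_eq_0_iff sum.neutral)
  then show ?thesis
    by (rule near_cells_of_components[OF assms(1,2)])
      (simp add: factors1_def forms_near split: if_splits)
qed

lemma cup2_form_near:
  assumes "fst a \<in> points d" "fst b \<in> points d" "cup2_form a b \<noteq> 0"
  shows "near_cells 1 a b"
proof -
  obtain c c' where "unsigned_form (factors2 c c') a b \<noteq> 0"
  proof (rule ccontr)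
    assume "\<not> thesis"
    then have "unsigned_form (factors2 c c') a b = 0" for c c' using that by blast
    then show False using assms(3) by (simp add: cup2_form_def form_def)
  qed
  then show ?thesis
    by (rule near_cells_of_components[OF assms(1,2)])
      (simp add: factors2_def forms_near split: if_splits)
qed

lemma keys_sum_subset: "keys (sum f S) \<subseteq> (\<Union>i\<in>S. keys (f i))"
proof (induction S rule: infinite_finite_induct)
  case (insert x F)
  then show ?case using keys_add[of "f x" "sum f F"] by auto
qed auto

lemma keys_coboundary_cell:
  assumes "t \<in> keys (coboundary_cell r)"
  obtains i where "i \<in> {1..d} - snd r"
    "t = (fst r, insert i (snd r)) \<or> t = ((fst r)(i := fst r i - 1), insert i (snd r))"
proof -
  let ?f = "\<lambda>i. frag_of ((fst r)(i := fst r i - 1), insert i (snd r)) - frag_of (fst r, insert i (snd r))"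
  have "t \<in> (\<Union>i\<in>{1..d} - snd r. keys (frag_cmul ((-1) ^ card {j \<in> snd r. j < i}) (?f i)))"
    by (rule subsetD[OF keys_sum_subset assms[unfolded coboundary_cell_def]])
  then obtain i where i: "i \<in> {1..d} - snd r" "t \<in> keys (frag_cmul ((-1) ^ card {j \<in> snd r. j < i}) (?f i))"
    by (rule UN_E)
  then have "t \<in> keys (?f i)" using subsetD[OF keys_cmul] by blast
  then have "t \<in> keys (frag_of ((fst r)(i := fst r i - 1), insert i (snd r))) \<union> keys (frag_of (fst r, insert i (snd r)))"
    by (rule subsetD[OF keys_diff])
  then have "t = (fst r, insert i (snd r)) \<or> t = ((fst r)(i := fst r i - 1), insert i (snd r))" by auto
  then show ?thesis using that i(1) by blast
qed

lemma coboundary_cell_near: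
  assumes "t \<in> keys (coboundary_cell r)"
  shows "near_cells 1 r t"
  by (rule keys_coboundary_cell[OF assms]) (auto simp: near_cells_def)

lemma coboundary_cell_cells:
  assumes r: "r \<in> cells d p" and t: "t \<in> keys (coboundary_cell r)"
  shows "t \<in> cells d (Suc p)"
proof -
  obtain i where i: "i \<in> {1..d} - snd r"
    "t = (fst r, insert i (snd r)) \<or> t = ((fst r)(i := fst r i - 1), insert i (snd r))"
    by (rule keys_coboundary_cell[OF t])
  have "finite (snd r)" using cellsD[OF r] finite_subset by auto
  then have "card (insert i (snd r)) = Suc p" using i(1) cellsD[OF r] by simp
  moreover have "(fst r)(i := fst r i - 1) \<in> points d" using cellsD[OF r] i(1) by (auto simp: points_def)
  ultimately show ?thesis using i cellsD[OF r] by (auto simp: cells_def)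
qed

lemma keys_coboundary: "keys (coboundary a) \<subseteq> (\<Union>r\<in>keys a. keys (coboundary_cell r))"
  unfolding coboundary_def by (rule keys_frag_extend)

lemma keys_coboundary_cells:
  "keys a \<subseteq> cells d p \<Longrightarrow> keys (coboundary a) \<subseteq> cells d (Suc p)"
  using keys_coboundary coboundary_cell_cells by blast

lemma coboundary_of [simp]: "coboundary (frag_of r) = coboundary_cell r"
  by (simp add: coboundary_def)

lemma coboundary_add: "coboundary (a + b) = coboundary a + coboundary b"
  by (simp add: coboundary_def frag_extend_add)

lemma coboundary_diff: "coboundary (a - b) = coboundary a - coboundary b"
  by (simp add: coboundary_def frag_extend_diff)

lemma coboundary_cmul: "coboundary (frag_cmul k a) = frag_cmul k (coboundary a)"
  by (simp add: coboundary_def frag_extend_cmul)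

lemma coboundary_sum: "coboundary (sum f S) = (\<Sum>i\<in>S. coboundary (f i))"
  by (induction S rule: infinite_finite_induct) (auto simp: coboundary_def frag_extend_add)

text \<open>
  Exchanging the order of the two added directions reverses the sign, so the chain equals its negative.
\<close>

lemma coboundary_coboundary_cell:
  assumes r: "snd r \<subseteq> {1..d}"
  shows "coboundary (coboundary_cell r) = 0"
proof -
  let ?J = "snd r" and ?w = "fst r"
  let ?N = "{1..d} - ?J"
  let ?dn = "\<lambda>i v :: point. v(i := v i - 1)"
  let ?sg = "\<lambda>J i. (-1 :: int) ^ card {j \<in> J. j < i}"
  let ?K = "\<lambda>i j. insert j (insert i ?J)"
  define X where "X i j = frag_of (?dn j (?dn i ?w), ?K i j) - frag_of (?dn i ?w, ?K i j) -
      frag_of (?dn j ?w, ?K i j) + frag_of (?w, ?K i j)" for i j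
  define g where "g i j = frag_cmul (?sg ?J i * ?sg (insert i ?J) j) (X i j)" for i j
  have fin: "finite ?J" using r finite_subset by auto
  have "coboundary (coboundary_cell r) = (\<Sum>i\<in>?N. \<Sum>j\<in>?N - {i}. g i j)"
    unfolding coboundary_cell_def[of r] coboundary_sum
  proof (rule sum.cong[OF refl])
    fix i
    have N: "{1..d} - insert i ?J = ?N - {i}" by auto
    show "coboundary (frag_cmul (?sg ?J i) (frag_of (?dn i ?w, insert i ?J) - frag_of (?w, insert i ?J))) =
        (\<Sum>j\<in>?N - {i}. g i j)"
      unfolding coboundary_cmul coboundary_diff coboundary_of coboundary_cell_def fst_conv snd_conv N
        sum_subtractf[symmetric] frag_cmul_sum g_def X_def
      by (rule sum.cong) (simp_all add: frag_cmul_diff_distrib2 frag_cmul_distrib2 algebra_simps)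
  qed
  also have "\<dots> = (\<Sum>(i, j)\<in>(SIGMA i:?N. ?N - {i}). g i j)"
    by (rule sum.Sigma) auto
  finally have S: "coboundary (coboundary_cell r) = (\<Sum>(i, j)\<in>(SIGMA i:?N. ?N - {i}). g i j)" .
  also have "\<dots> = (\<Sum>(i, j)\<in>(SIGMA i:?N. ?N - {i}). - g i j)"
  proof (rule sum.reindex_bij_witness[of _ prod.swap prod.swap])
    fix a assume "a \<in> (SIGMA i:?N. ?N - {i})"
    then obtain i j where a: "a = (i, j)" "i \<notin> ?J" "j \<notin> ?J" "i \<noteq> j" by auto
    have X: "X j i = X i j"
      using a(4) by (simp add: X_def insert_commute fun_upd_twist algebra_simps)
    have "card {k \<in> insert i ?J. k < j} = of_bool (i < j) + card {k \<in> ?J. k < j}"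
      if "i \<notin> ?J" for i j
    proof -
      have "{k \<in> insert i ?J. k < j} = (if i < j then insert i {k \<in> ?J. k < j} else {k \<in> ?J. k < j})" by auto
      then show ?thesis using that fin by simp
    qed
    then have "?sg ?J j * ?sg (insert j ?J) i = - (?sg ?J i * ?sg (insert i ?J) j)"
      using a by (auto simp: power_add)
    then show "(case prod.swap a of (i, j) \<Rightarrow> - g i j) = (case a of (i, j) \<Rightarrow> g i j)"
      using X a by (simp add: g_def)
  qed auto
  also have "\<dots> = - coboundary (coboundary_cell r)"
    unfolding S by (simp add: case_prod_unfold sum_negf)
  finally have "lookup (coboundary (coboundary_cell r)) k = - lookup (coboundary (coboundary_cell r)) k" for k
    by (metis lookup_uminus)
  then show ?thesis by (intro poly_mapping_eqI) (simp add: eq_neg_iff_add_eq_0)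
qed

lemma coboundary_coboundary:
  assumes "keys a \<subseteq> cells d p"
  shows "coboundary (coboundary a) = 0"
proof -
  have "coboundary (coboundary a) =
      (\<Sum>r\<in>keys a. frag_cmul (lookup a r) (coboundary (coboundary_cell r)))"
    by (subst (2) coboundary_def) (simp add: frag_extend_def coboundary_sum coboundary_cmul)
  also have "\<dots> = 0"
    using coboundary_coboundary_cell assms cellsD by (intro sum.neutral) (metis frag_cmul_zero2 subsetD)
  finally show ?thesis .
qed

lemma bilinear_coboundary_left:
  "bilinear c (coboundary a) b = bilinear (\<lambda>k t. pairing (\<lambda>s. c s t) (coboundary_cell k)) a b"
  by (simp add: coboundary_def bilinear_extend_left)

lemma bilinear_coboundary_right:
  "bilinear c a (coboundary b) = bilinear (\<lambda>s k. pairing (c s) (coboundary_cell k)) a b"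
  by (simp add: coboundary_def bilinear_extend_right)

definition cup0_defect :: "cell \<Rightarrow> cell \<Rightarrow> int" where
  "cup0_defect a b = cup0_flipped a b - cup0_form a b"

lemma cup1_leibniz_chains:
  assumes "keys a \<subseteq> cells d p" "keys b \<subseteq> cells d q"
  shows "bilinear cup1_form (coboundary a) b + (-1) ^ p * bilinear cup1_form a (coboundary b) =
    bilinear cup0_defect a b"
  unfolding bilinear_coboundary_left bilinear_coboundary_right bilinear_cmul_fun[symmetric]
    bilinear_add_fun[symmetric]
proof (rule bilinear_cong)
  fix s t assume "s \<in> keys a" "t \<in> keys b"
  then have "s \<in> cells d p" "t \<in> cells d q" using assms by auto
  from cellsD[OF this(1)] cellsD[OF this(2)]
  show "pairing (\<lambda>s. cup1_form s t) (coboundary_cell s) +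
      (-1) ^ p * pairing (cup1_form s) (coboundary_cell t) = cup0_defect s t"
    using cup1_leibniz[of s t] by (simp add: cup0_defect_def)
qed

lemma cup2_leibniz_chains:
  assumes "keys a \<subseteq> cells d p" "keys b \<subseteq> cells d q"
  shows "even (bilinear cup2_form (coboundary a) b + bilinear cup2_form a (coboundary b) +
    (bilinear cup1_form a b + bilinear cup1_form b a))"
  unfolding bilinear_coboundary_left bilinear_coboundary_right
  unfolding bilinear_flip[of cup1_form b a] unfolding bilinear_add_fun[symmetric]
proof (rule even_bilinear)
  fix s t assume "s \<in> keys a" "t \<in> keys b"
  then have st: "s \<in> cells d p" "t \<in> cells d q" using assms by auto
  have sign: "odd (koszul I J)" for I J by (simp add: koszul_def)
  have "even (pairing (\<lambda>x. cup2_form x t) (coboundary_cell s) +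
      (-1) ^ card (snd s) * pairing (cup2_form s) (coboundary_cell t) -
    (cup1_form s t - koszul (snd s) (snd t) * koszul (snd t) (snd s) * cup1_form t s))"
    using cup2_leibniz[of s t] cellsD[OF st(1)] cellsD[OF st(2)] by simp
  then show "even (pairing (\<lambda>x. cup2_form x t) (coboundary_cell s) + pairing (cup2_form s) (coboundary_cell t) +
      (cup1_form s t + cup1_form t s))"
    by (simp add: sign)
qed

lemma cup0_defect_flip:
  assumes "s \<in> cells d p" "t \<in> cells d q" "even (p * q)"
  shows "cup0_defect t s = - cup0_defect s t"
proof -
  have fin: "finite (snd s)" "finite (snd t)" using cellsD[OF assms(1)] cellsD[OF assms(2)] finite_subset by auto
  have eq: "koszul (snd s) (snd t) = koszul (snd t) (snd s)" if "snd s \<inter> snd t = {}"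
  proof -
    have "koszul (snd s) (snd t) * koszul (snd t) (snd s) = 1"
      using koszul_commute[OF fin that] assms cellsD by (metis neg_one_even_power)
    then show ?thesis unfolding koszul_def minus_one_power_iff by (simp split: if_splits)
  qed
  have disj: "snd s \<inter> snd t = {}" if "unsigned_form (\<lambda>_. \<phi>) s t \<noteq> 0" "\<phi> = cup_form \<or> \<phi> = flipped cup_form" for \<phi>
  proof (rule ccontr)
    assume "snd s \<inter> snd t \<noteq> {}"
    then obtain i where "i \<in> snd s" "i \<in> snd t" by auto
    then have "\<phi> (comp_at s i) (comp_at t i) = 0" "i \<in> {1..d}"
      using that(2) cellsD[OF assms(1)] by (auto simp: cup_form_def flipped_def comp_at_def)
    then show False using that(1) by (auto simp: unsigned_form_def)
  qed
  have flip: "unsigned_form (\<lambda>_. flipped cup_form) t s = unsigned_form (\<lambda>_. cup_form) s t"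
    "unsigned_form (\<lambda>_. cup_form) t s = unsigned_form (\<lambda>_. flipped cup_form) s t"
    by (simp_all add: unsigned_form_def flipped_def)
  show ?thesis
  proof (cases "snd s \<inter> snd t = {}")
    case True
    then show ?thesis
      unfolding cup0_defect_def cup0_flipped_def cup0_form_def form_def flip using eq by simp
  next
    case False
    then have "unsigned_form (\<lambda>_. cup_form) s t = 0" "unsigned_form (\<lambda>_. flipped cup_form) s t = 0"
      using disj by blast+
    then show ?thesis unfolding cup0_defect_def cup0_flipped_def cup0_form_def form_def flip by simp
  qed
qed

text \<open>
  The square \<open>n \<union>\<^sub>1 n + n \<union>\<^sub>2 \<delta>n\<close> of the integral 0-1 lift of \<open>n\<close>, an analogue of the Pontryagin square.
  The second term makes the value modulo four independent of the lift when \<open>n\<close> is closed modulo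
  two. In that case half of \<open>\<delta>n\<close> is exact; in general it is rounded, which keeps the function local.
\<close>

definition square :: "cell set \<Rightarrow> int" where
  "square n = bilinear cup1_form (chain_of n) (chain_of n) +
     2 * bilinear cup2_form (chain_of n) (half (coboundary (chain_of n)))"

definition coboundary_set :: "cell \<Rightarrow> cell set" where
  "coboundary_set r = {s. odd (lookup (coboundary_cell r) s)}"

lemma coboundary_set_keys: "coboundary_set r \<subseteq> keys (coboundary_cell r)"
  by (auto simp: coboundary_set_def in_keys_iff)

lemma finite_coboundary_set: "finite (coboundary_set r)"
  using coboundary_set_keys finite_keys finite_subset by metis

text \<open>
  The radius two covers all cells where \<open>square\<close> notices a change of \<open>n\<close> by the coboundary of \<open>r\<close>.
\<close>

definition closed_near :: "nat \<Rightarrow> cell \<Rightarrow> cell set \<Rightarrow> bool" where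
  "closed_near p r n \<longleftrightarrow>
     (\<forall>t\<in>cells d p. near_cells 2 r t \<longrightarrow> even (lookup (coboundary (chain_of n)) t))"

text \<open>
  The new 0-1 lift is \<open>n + \<delta>r + 2 m\<close> with an integral cochain \<open>m\<close>. By the Leibniz rule for \<open>\<union>\<^sub>2\<close> the terms
  with \<open>m\<close> cancel modulo four against the change of the second term of the square. By the Leibniz rule for \<open>\<union>\<^sub>1\<close>,
  \<open>n \<union>\<^sub>1 \<delta>r + \<delta>r \<union>\<^sub>1 n\<close> is twice a \<open>\<union>\<^sub>0\<close>-term, up to \<open>\<union>\<^sub>1\<close>-terms with \<open>\<delta>n\<close> that cancel
  against the rest by the Leibniz rule for \<open>\<union>\<^sub>2\<close> once more.
\<close>

lemma square_shift_aux:
  assumes r: "r \<in> cells d p" and p: "even p"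
    and n: "finite n" "n \<subseteq> cells d (Suc p)" and closed: "closed_near (Suc (Suc p)) r n"
  shows "\<exists>k. square (n \<triangle> coboundary_set r) = square n +
    bilinear cup1_form (coboundary_cell r) (coboundary_cell r) +
    2 * bilinear cup0_defect (frag_of r) (chain_of n) + 4 * k"
    and "even (bilinear cup1_form (coboundary_cell r) (chain_of n) -
      bilinear cup0_defect (frag_of r) (chain_of n))"
proof -
  let ?B = "bilinear cup1_form" and ?E = "bilinear cup2_form" and ?Y = "bilinear cup0_defect"
  let ?R = "frag_of r"
  define N where "N = chain_of n"
  define N' where "N' = chain_of (n \<triangle> coboundary_set r)"
  define h where "h = coboundary_cell r"
  define m where "m = half (N' - N - h)"
  define D where "D = coboundary N"
  define K where "K = half D"
  \<comment> \<open>the failure of \<open>n\<close> to be closed, which lies too far from \<open>r\<close> to contribute\<close>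
  define w where "w = D - frag_cmul 2 K"
  have fin': "finite (n \<triangle> coboundary_set r)" using n finite_coboundary_set by auto
  have lookup_N: "lookup N s = of_bool (s \<in> n)" "lookup N' s = of_bool (s \<in> n \<triangle> coboundary_set r)" for s
    unfolding N_def N'_def using lookup_chain_of[OF n(1)] lookup_chain_of[OF fin'] by blast+
  have N': "N' = N + h + frag_cmul 2 m"
  proof (rule poly_mapping_eqI)
    fix s
    have "even (lookup N' s - lookup N s - lookup h s)"
      by (auto simp: lookup_N coboundary_set_def h_def)
    then show "lookup N' s = lookup (N + h + frag_cmul 2 m) s"
      by (simp add: m_def lookup_add lookup_minus)
  qed
  have keys_N: "keys N \<subseteq> cells d (Suc p)" using n by (simp add: N_def keys_chain_of)
  have keys_R: "keys ?R \<subseteq> cells d p" using r by simp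
  have keys_h: "keys h \<subseteq> cells d (Suc p)" using coboundary_cell_cells[OF r] by (auto simp: h_def)
  have keys_m: "keys m \<subseteq> keys h"
  proof
    fix s assume "s \<in> keys m"
    then have "lookup N' s - lookup N s - lookup h s \<noteq> 0" by (auto simp: m_def in_keys_iff lookup_minus)
    show "s \<in> keys h"
    proof (rule ccontr)
      assume "s \<notin> keys h"
      then have "lookup h s = 0" "s \<notin> coboundary_set r"
        using coboundary_set_keys[of r] by (auto simp: h_def in_keys_iff)
      moreover from this(2) have "s \<in> n \<triangle> coboundary_set r \<longleftrightarrow> s \<in> n" by blast
      ultimately show False using \<open>lookup N' s - lookup N s - lookup h s \<noteq> 0\<close> by (simp only: lookup_N)
    qed
  qed
  have D: "D = frag_cmul 2 K + w" by (simp add: w_def)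
  have keys_D: "keys D \<subseteq> cells d (Suc (Suc p))" unfolding D_def by (rule keys_coboundary_cells[OF keys_N])
  have keys_K: "keys K \<subseteq> cells d (Suc (Suc p))" using keys_half[of D] keys_D by (auto simp: K_def)
  have lookup_w: "lookup w t = lookup D t mod 2" for t
    by (simp add: w_def K_def lookup_minus minus_mult_div_eq_mod)
  have far: "t \<in> cells d (Suc (Suc p))" "\<not> near_cells 2 r t" if t: "t \<in> keys w" for t
  proof -
    have odd: "odd (lookup D t)" using t by (auto simp: in_keys_iff lookup_w odd_iff_mod_2_eq_one)
    then have "t \<in> keys D" by (auto simp: in_keys_iff)
    then show cell: "t \<in> cells d (Suc (Suc p))" using keys_D by auto
    show "\<not> near_cells 2 r t" using closed odd cell by (auto simp: closed_near_def D_def N_def)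
  qed
  have points_w: "fst t \<in> points d" if "t \<in> keys w" for t using cellsD[OF far(1)[OF that]] by simp
  have point_r: "fst r \<in> points d" using cellsD[OF r] by simp
  have Bwr: "?B w ?R = 0" "?B ?R w = 0"
    using cup1_form_near points_w point_r far(2) near_cells_mono[of 1 _ _ 2] near_cells_sym
    by (auto intro!: bilinear_eq_0) (metis one_le_numeral)+
  have Ewm: "?E w m = 0"
  proof (rule bilinear_eq_0, rule ccontr)
    fix t s assume t: "t \<in> keys w" and s: "s \<in> keys m" and nz: "cup2_form t s \<noteq> 0"
    have s': "s \<in> keys h" using s keys_m by auto
    have "fst s \<in> points d" using s' keys_h cellsD by blast
    then have "near_cells 1 s t" using cup2_form_near[OF points_w[OF t] _ nz] near_cells_sym by blast
    moreover have "near_cells 1 r s" using s' unfolding h_def by (rule coboundary_cell_near)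
    ultimately have "near_cells (1 + 1) r t" by (rule near_cells_trans[rotated])
    then show False using far(2)[OF t] by (simp only: one_add_one)
  qed
  have dh: "coboundary h = 0" unfolding h_def using cellsD[OF r] by (simp add: coboundary_coboundary_cell)
  have dD: "frag_cmul 2 (coboundary K) + coboundary w = 0"
    using coboundary_coboundary[OF keys_N] unfolding D_def[symmetric]
    by (subst (asm) D) (simp add: coboundary_add coboundary_cmul)
  have "?E ?R (coboundary w) = 0"
    unfolding bilinear_coboundary_right
  proof (rule bilinear_eq_0)
    fix x t assume "x \<in> keys ?R" and t: "t \<in> keys w"
    then have x: "x = r" by simp
    have "cup2_form r y = 0" if y: "y \<in> keys (coboundary_cell t)" for y
    proof (rule ccontr)
      assume nz: "cup2_form r y \<noteq> 0"
      have "fst y \<in> points d" using cellsD[OF coboundary_cell_cells[OF far(1)[OF t] y]] by simp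
      then have "near_cells 1 r y" using cup2_form_near[OF point_r _ nz] by blast
      moreover have "near_cells 1 y t" using coboundary_cell_near[OF y] near_cells_sym by blast
      ultimately have "near_cells (1 + 1) r t" by (rule near_cells_trans)
      then show False using far(2)[OF t] by (simp only: one_add_one)
    qed
    then show "pairing (cup2_form x) (coboundary_cell t) = 0" by (simp add: x pairing_eq_sum)
  qed
  moreover have "2 * ?E ?R (coboundary K) + ?E ?R (coboundary w) = 0"
    unfolding bilinear_cmul_right[symmetric] bilinear_add_right[symmetric] dD by simp
  ultimately have ErdK: "?E ?R (coboundary K) = 0" by simp
  have dN': "coboundary N' = D + frag_cmul 2 (coboundary m)"
    by (simp add: N' D_def coboundary_add coboundary_cmul dh)
  have K': "half (coboundary N') = K + coboundary m"
    by (rule poly_mapping_eqI) (simp add: dN' K_def lookup_add)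
  have sq: "square n = ?B N N + 2 * ?E N K"
    by (simp add: square_def N_def D_def K_def)
  have sq': "square (n \<triangle> coboundary_set r) = ?B N' N' + 2 * ?E N' (K + coboundary m)"
    unfolding K'[symmetric] by (simp add: square_def N'_def)
  have keys_x: "keys (N + h) \<subseteq> cells d (Suc p)" using keys_add[of N h] keys_N keys_h by auto
  have keys_m': "keys m \<subseteq> cells d (Suc p)" using keys_m keys_h by auto
  have dx: "coboundary (N + h) = frag_cmul 2 K + w" by (simp add: coboundary_add dh flip: D_def D)
  have "even (2 * ?E K m + ?E (N + h) (coboundary m) + (?B (N + h) m + ?B m (N + h)))"
    using cup2_leibniz_chains[OF keys_x keys_m']
    by (simp only: dx bilinear_add_left[of _ _ w] bilinear_cmul_left Ewm add_0_right)
  then obtain j1 where j1: "2 * ?E K m + ?E (N + h) (coboundary m) + (?B (N + h) m + ?B m (N + h)) = 2 * j1"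
    by (rule evenE)
  have "even (?E h K + (?B ?R K + ?B K ?R))"
    using cup2_leibniz_chains[OF keys_R keys_K] by (simp only: ErdK coboundary_of h_def add_0_right)
  then obtain j2 where j2: "?E h K + (?B ?R K + ?B K ?R) = 2 * j2"
    by (rule evenE)
  have L1: "?B h N + ?B ?R D = ?Y ?R N"
    using cup1_leibniz_chains[OF keys_R keys_N] p by (simp add: h_def D_def)
  have L2: "?B D ?R - ?B N h = ?Y N ?R"
    using cup1_leibniz_chains[OF keys_N keys_R] p by (simp add: h_def D_def)
  have Y: "?Y N ?R = - ?Y ?R N"
  proof -
    have "?Y N ?R = bilinear (\<lambda>t s. - 1 * cup0_defect t s) ?R N"
      unfolding bilinear_flip[of _ N]
    proof (rule bilinear_cong)
      fix s t assume "s \<in> keys ?R" "t \<in> keys N"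
      then have st: "s \<in> cells d p" "t \<in> cells d (Suc p)" using r keys_N by auto
      have "cup0_defect t s = - cup0_defect s t" by (rule cup0_defect_flip[OF st]) (use p in simp)
      then show "cup0_defect t s = - 1 * cup0_defect s t" by (simp only: mult_minus1)
    qed
    then show ?thesis unfolding bilinear_cmul_fun by simp
  qed
  have BrD: "?B ?R D = 2 * ?B ?R K" "?B D ?R = 2 * ?B K ?R"
    by (subst D, simp add: bilinear_add_left bilinear_add_right bilinear_cmul_left bilinear_cmul_right Bwr)+
  have "square (n \<triangle> coboundary_set r) = square n + ?B h h + 2 * ?Y ?R N +
      4 * (j1 + j2 - ?E K m - ?B ?R K + ?B m m + ?E m K + ?E m (coboundary m))"
    using j1 j2 L1 L2 Y BrD unfolding sq sq' N'
    by (simp add: bilinear_add_left bilinear_add_right bilinear_cmul_left bilinear_cmul_right algebra_simps)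
  then show "\<exists>k. square (n \<triangle> coboundary_set r) = square n + ?B (coboundary_cell r) (coboundary_cell r) +
      2 * ?Y ?R (chain_of n) + 4 * k"
    unfolding h_def N_def by blast
  have "?B h N - ?Y ?R N = - (2 * ?B ?R K)" using L1 BrD by simp
  then show "even (?B (coboundary_cell r) (chain_of n) - ?Y ?R (chain_of n))"
    unfolding h_def N_def by simp
qed

text \<open>
  Adding a coboundary changes the square by a term linear in \<open>n\<close>. The oddness of the degree of \<open>n\<close>
  enters here: it makes the two contributions \<open>n \<union>\<^sub>1 \<delta>r\<close> and \<open>\<delta>r \<union>\<^sub>1 n\<close> add up instead of cancelling.
\<close>

lemma square_shift:
  assumes r: "r \<in> cells d p" and p: "even p"
    and n: "finite n" "n \<subseteq> cells d (Suc p)" and closed: "closed_near (Suc (Suc p)) r n"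
  shows "\<exists>k. square (n \<triangle> coboundary_set r) = square n + square (coboundary_set r) +
    2 * (\<Sum>s\<in>coboundary_set r. \<Sum>t\<in>n. cup1_form s t) + 4 * k"
proof -
  let ?B = "bilinear cup1_form" and ?h = "coboundary_cell r" and ?C = "coboundary_set r"
  obtain k where k: "square (n \<triangle> ?C) = square n + ?B ?h ?h +
      2 * bilinear cup0_defect (frag_of r) (chain_of n) + 4 * k"
    using square_shift_aux(1)[OF assms] by blast
  have empty: "closed_near (Suc (Suc p)) r {}" by (simp add: closed_near_def coboundary_def)
  have sq0: "square {} = 0" by (simp add: square_def)
  obtain k' where k': "square ?C = ?B ?h ?h + 4 * k'"
    using square_shift_aux(1)[OF r p _ _ empty] by (auto simp: sq0)
  have "even (?B ?h (chain_of n) - ?B (chain_of ?C) (chain_of n))"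
  proof -
    have h: "?h = chain_of ?C + frag_cmul 2 (half (?h - chain_of ?C))"
    proof (rule poly_mapping_eqI)
      fix s
      have "even (lookup ?h s - lookup (chain_of ?C) s)"
        unfolding lookup_chain_of[OF finite_coboundary_set] by (simp add: coboundary_set_def)
      then show "lookup ?h s = lookup (chain_of ?C + frag_cmul 2 (half (?h - chain_of ?C))) s"
        by (simp add: lookup_add lookup_minus)
    qed
    have "?B ?h (chain_of n) = ?B (chain_of ?C) (chain_of n) + 2 * ?B (half (?h - chain_of ?C)) (chain_of n)"
      by (subst h) (simp add: bilinear_add_left bilinear_cmul_left)
    then show ?thesis by simp
  qed
  with square_shift_aux(2)[OF assms]
  have "even (bilinear cup0_defect (frag_of r) (chain_of n) - ?B (chain_of ?C) (chain_of n))"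
    by presburger
  then obtain j where "bilinear cup0_defect (frag_of r) (chain_of n) = ?B (chain_of ?C) (chain_of n) + 2 * j"
    by (metis evenE add.commute diff_add_cancel)
  moreover have "?B (chain_of ?C) (chain_of n) = (\<Sum>s\<in>?C. \<Sum>t\<in>n. cup1_form s t)"
    by (simp add: bilinear_def pairing_chain_of)
  ultimately have "square (n \<triangle> ?C) = square n + square ?C +
      2 * (\<Sum>s\<in>?C. \<Sum>t\<in>n. cup1_form s t) + 4 * (k + j - k')"
    using k k' by simp
  then show ?thesis by blast
qed

end

section \<open>Operators controlled by commuting involutions\<close>

text \<open>
  A unitary representation \<open>h\<close> of the finite subsets of \<open>S\<close>, with symmetric difference as addition. The
  operators \<open>proj R y\<close> are its spectral projections: on the range of \<open>proj R y\<close>, the involution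
  \<open>h {i}\<close>, \<open>i \<in> R\<close>, is \<open>-1\<close> if \<open>i \<in> y\<close> and \<open>1\<close> otherwise.
\<close>

locale involutions =
  fixes h :: "'i set \<Rightarrow> 'q local_op" and S :: "'i set"
  assumes h_mult: "finite x \<Longrightarrow> x \<subseteq> S \<Longrightarrow> finite y \<Longrightarrow> y \<subseteq> S \<Longrightarrow> h x * h y = h (x \<triangle> y)"
    and h_empty: "h {} = 1"
    and h_adjoint: "finite x \<Longrightarrow> x \<subseteq> S \<Longrightarrow> adjoint_op (h x) = h x"
begin

definition proj :: "'i set \<Rightarrow> 'i set \<Rightarrow> 'q local_op" where
  "proj R y = scale (1 / 2 ^ card R) (\<Sum>x\<in>Pow R. scale (sgn1 (card (x \<inter> y))) (h x))"

definition controlled :: "'i set \<Rightarrow> ('i set \<Rightarrow> 'q local_op) \<Rightarrow> 'q local_op" where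
  "controlled R A = (\<Sum>y\<in>Pow R. proj R y * A y)"

lemma sgn1_sym_diff:
  assumes "finite x" "finite x'"
  shows "sgn1 (card ((x \<triangle> x') \<inter> y)) = sgn1 (card (x \<inter> y)) * sgn1 (card (x' \<inter> y))"
    and "sgn1 (card (y \<inter> (x \<triangle> x'))) = sgn1 (card (y \<inter> x)) * sgn1 (card (y \<inter> x'))"
proof -
  have "(x \<triangle> x') \<inter> y = (x \<inter> y) \<triangle> (x' \<inter> y)" by auto
  then show 1: "sgn1 (card ((x \<triangle> x') \<inter> y)) = sgn1 (card (x \<inter> y)) * sgn1 (card (x' \<inter> y))"
    unfolding power_add[symmetric] using card_sym_diff_parity[of "x \<inter> y" "x' \<inter> y"] assms
    by (intro sgn1_cong) auto
  show "sgn1 (card (y \<inter> (x \<triangle> x'))) = sgn1 (card (y \<inter> x)) * sgn1 (card (y \<inter> x'))"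
    using 1 by (simp only: Int_commute)
qed

lemma sum_pow_shift:
  fixes f :: "'i set \<Rightarrow> 'c::comm_monoid_add"
  assumes "C \<subseteq> R"
  shows "(\<Sum>x\<in>Pow R. f (x \<triangle> C)) = (\<Sum>x\<in>Pow R. f x)"
  by (rule sum.reindex_bij_witness[of _ "\<lambda>x. x \<triangle> C" "\<lambda>x. x \<triangle> C"]) (use assms in auto)

lemma h_proj:
  assumes R: "finite R" "R \<subseteq> S" and x: "x \<subseteq> R"
  shows "h x * proj R y = scale (sgn1 (card (x \<inter> y))) (proj R y)"
proof -
  have fin: "finite x'" if "x' \<subseteq> R" for x' using that R finite_subset by auto
  have "h x * (\<Sum>x'\<in>Pow R. scale (sgn1 (card (x' \<inter> y))) (h x')) =
      (\<Sum>x'\<in>Pow R. scale (sgn1 (card (x \<inter> y))) (scale (sgn1 (card ((x' \<triangle> x) \<inter> y))) (h (x' \<triangle> x))))"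
    unfolding sum_distrib_left
  proof (rule sum.cong[OF refl])
    fix x' assume "x' \<in> Pow R"
    then have x': "x' \<subseteq> R" "finite x'" using fin by auto
    have "sgn1 (card (x \<inter> y)) * sgn1 (card ((x' \<triangle> x) \<inter> y)) = sgn1 (card (x' \<inter> y))"
      using sgn1_sym_diff(1)[OF x'(2) fin[OF x]] by (simp add: mult.left_commute)
    moreover have "h x * h x' = h (x' \<triangle> x)"
      using h_mult[of x x'] x' x fin R by (auto simp: Un_commute)
    ultimately show "h x * scale (sgn1 (card (x' \<inter> y))) (h x') =
        scale (sgn1 (card (x \<inter> y))) (scale (sgn1 (card ((x' \<triangle> x) \<inter> y))) (h (x' \<triangle> x)))"
      by simp
  qed
  also have "\<dots> = scale (sgn1 (card (x \<inter> y))) (\<Sum>x'\<in>Pow R. scale (sgn1 (card (x' \<inter> y))) (h x'))"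
    unfolding scale_sum_right[symmetric]
    by (subst sum_pow_shift[OF x, of "\<lambda>x'. scale (sgn1 (card (x' \<inter> y))) (h x')"]) (rule refl)
  finally show ?thesis by (simp add: proj_def mult.commute)
qed

lemma proj_mult:
  assumes R': "finite R'" "R' \<subseteq> S" and sub: "R \<subseteq> R'" "y \<subseteq> R" "y' \<subseteq> R'"
  shows "proj R y * proj R' y' = (if y = y' \<inter> R then proj R' y' else 0)"
proof -
  have R: "finite R" by (rule finite_subset[OF sub(1) R'(1)])
  have "(\<Sum>x\<in>Pow R. scale (sgn1 (card (x \<inter> y))) (h x)) * proj R' y' =
      (\<Sum>x\<in>Pow R. scale (sgn1 (card (x \<inter> y)) * sgn1 (card (x \<inter> (y' \<inter> R)))) (proj R' y'))"
    unfolding sum_distrib_right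
  proof (rule sum.cong[OF refl])
    fix x assume "x \<in> Pow R"
    then have "x \<subseteq> R'" "x \<inter> (y' \<inter> R) = x \<inter> y'" using sub by auto
    then show "scale (sgn1 (card (x \<inter> y))) (h x) * proj R' y' =
        scale (sgn1 (card (x \<inter> y)) * sgn1 (card (x \<inter> (y' \<inter> R)))) (proj R' y')"
      using h_proj[OF R'] by simp
  qed
  also have "\<dots> = scale (if y = y' \<inter> R then 2 ^ card R else 0) (proj R' y')"
    unfolding scale_sum_left[symmetric] using character_orthogonality[OF R sub(2), of "y' \<inter> R"] by simp
  finally show ?thesis unfolding proj_def[of R y] by simp
qed

lemma sum_proj:
  assumes R: "finite R"
  shows "(\<Sum>y\<in>Pow R. proj R y) = 1"
proof -
  have "(\<Sum>y\<in>Pow R. proj R y) =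
      scale (1 / 2 ^ card R) (\<Sum>x\<in>Pow R. scale (\<Sum>y\<in>Pow R. sgn1 (card (y \<inter> x))) (h x))"
    unfolding proj_def scale_sum_right[symmetric] scale_sum_left
    by (subst sum.swap) (simp only: Int_commute)
  also have "(\<Sum>x\<in>Pow R. scale (\<Sum>y\<in>Pow R. sgn1 (card (y \<inter> x))) (h x)) =
      (\<Sum>x\<in>{{}}. scale (2 ^ card R) (h x))"
    unfolding character_sum[OF R]
    by (rule sum.mono_neutral_cong_right) (use R in \<open>auto simp: Int_absorb2\<close>)
  finally show ?thesis by (simp add: h_empty)
qed

lemma proj_refine:
  assumes "finite R'" "R' \<subseteq> S" "R \<subseteq> R'" "y \<subseteq> R"
  shows "proj R y = (\<Sum>y'\<in>Pow R'. if y = y' \<inter> R then proj R' y' else 0)"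
proof -
  have "proj R y = proj R y * (\<Sum>y'\<in>Pow R'. proj R' y')" by (simp add: sum_proj assms)
  also have "\<dots> = (\<Sum>y'\<in>Pow R'. if y = y' \<inter> R then proj R' y' else 0)"
    unfolding sum_distrib_left by (rule sum.cong) (use proj_mult[OF assms] in auto)
  finally show ?thesis .
qed

lemma proj_adjoint:
  assumes "finite R" "R \<subseteq> S"
  shows "adjoint_op (proj R y) = proj R y"
proof -
  have "adjoint_op (h x) = h x" if "x \<in> Pow R" for x
    using that assms finite_subset[of x R] by (intro h_adjoint) auto
  then show ?thesis by (simp add: proj_def adjoint_sum)
qed

text \<open>
  A relation among the involutions excludes the spectral values that violate it.
\<close>

lemma proj_eq_0:
  assumes "finite R" "R \<subseteq> S" "t \<subseteq> R" "h t = 1" "odd (card (t \<inter> y))"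
  shows "proj R y = 0"
proof -
  have "proj R y = scale (- 1) (proj R y)" using h_proj[OF assms(1-3), of y] assms(4,5) by simp
  then have "proj R y + proj R y = 0" unfolding scale_minus_one eq_neg_iff_add_eq_0 .
  then have "scale (1 / 2) (proj R y + proj R y) = 0" by simp
  moreover have "scale (1 / 2) (proj R y + proj R y) = proj R y"
    by (simp add: scale_add_right flip: scale_add_left)
  ultimately show ?thesis by simp
qed

lemma proj_local:
  assumes "\<And>x. x \<subseteq> R \<Longrightarrow> h x \<in> local_ops T"
  shows "proj R y \<in> local_ops T"
  unfolding proj_def using assms by (intro local_ops_scale local_ops_sum) auto

lemma proj_commute:
  assumes "\<And>x. x \<subseteq> R \<Longrightarrow> a * h x = h x * a"
  shows "a * proj R y = proj R y * a"
  unfolding proj_def using assms by (simp add: sum_distrib_left sum_distrib_right)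

lemma proj_flip:
  assumes R: "finite R" and C: "C \<subseteq> R" and y: "y \<subseteq> R"
    and a: "\<And>x. x \<subseteq> R \<Longrightarrow> a * h x = scale (sgn1 (card (x \<inter> C))) (h x * a)"
  shows "a * proj R y = proj R (y \<triangle> C) * a"
proof -
  have fin: "finite x" if "x \<subseteq> R" for x using that R finite_subset by auto
  have "a * (\<Sum>x\<in>Pow R. scale (sgn1 (card (x \<inter> y))) (h x)) =
      (\<Sum>x\<in>Pow R. scale (sgn1 (card (x \<inter> (y \<triangle> C)))) (h x)) * a"
    unfolding sum_distrib_left sum_distrib_right
  proof (rule sum.cong[OF refl])
    fix x assume "x \<in> Pow R"
    then show "a * scale (sgn1 (card (x \<inter> y))) (h x) = scale (sgn1 (card (x \<inter> (y \<triangle> C)))) (h x) * a"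
      using a[of x] sgn1_sym_diff(2)[OF fin[OF y] fin[OF C], of x] by simp
  qed
  then show ?thesis by (simp add: proj_def)
qed

lemma controlled_one: "finite R \<Longrightarrow> controlled R (\<lambda>_. 1) = 1"
  by (simp add: controlled_def sum_proj)

lemma controlled_extend:
  assumes "finite R'" "R' \<subseteq> S" "R \<subseteq> R'"
  shows "controlled R A = controlled R' (\<lambda>y. A (y \<inter> R))"
proof -
  have "finite R" by (rule finite_subset[OF assms(3,1)])
  have "controlled R A = (\<Sum>y\<in>Pow R. \<Sum>y'\<in>Pow R'. if y = y' \<inter> R then proj R' y' * A y else 0)"
    unfolding controlled_def
  proof (rule sum.cong[OF refl])
    fix y assume "y \<in> Pow R"
    then show "proj R y * A y = (\<Sum>y'\<in>Pow R'. if y = y' \<inter> R then proj R' y' * A y else 0)"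
      using proj_refine[OF assms, of y] by (auto simp: sum_distrib_right intro!: sum.cong)
  qed
  also have "\<dots> = (\<Sum>y'\<in>Pow R'. \<Sum>y\<in>Pow R. if y = y' \<inter> R then proj R' y' * A y else 0)"
    by (rule sum.swap)
  also have "\<dots> = controlled R' (\<lambda>y. A (y \<inter> R))"
    unfolding controlled_def
  proof (rule sum.cong[OF refl])
    fix y'
    show "(\<Sum>y\<in>Pow R. if y = y' \<inter> R then proj R' y' * A y else 0) = proj R' y' * A (y' \<inter> R)"
      using \<open>finite R\<close> by (subst sum.delta) auto
  qed
  finally show ?thesis .
qed

lemma controlled_mult:
  assumes R: "finite R" "R \<subseteq> S"
    and A: "\<And>x y. x \<subseteq> R \<Longrightarrow> y \<subseteq> R \<Longrightarrow> A y * h x = h x * A y"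
  shows "controlled R A * controlled R B = controlled R (\<lambda>y. A y * B y)"
proof -
  have "controlled R A * controlled R B =
      (\<Sum>y\<in>Pow R. \<Sum>y'\<in>Pow R. if y = y' then proj R y * (A y * B y) else 0)"
    unfolding controlled_def sum_distrib_left sum_distrib_right
  proof (subst sum.swap, rule sum.cong[OF refl], rule sum.cong[OF refl])
    fix y y' assume y: "y \<in> Pow R" "y' \<in> Pow R"
    have "proj R y * A y * (proj R y' * B y') = proj R y * (A y * proj R y') * B y'"
      by (simp only: mult.assoc)
    also have "A y * proj R y' = proj R y' * A y" by (rule proj_commute) (use A y in auto)
    also have "proj R y * (proj R y' * A y) * B y' = (proj R y * proj R y') * (A y * B y')"
      by (simp only: mult.assoc)
    also have "proj R y * proj R y' = (if y = y' then proj R y else 0)"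
      using proj_mult[OF R, of R y y'] y by (auto simp: Int_absorb2)
    finally show "proj R y * A y * (proj R y' * B y') = (if y = y' then proj R y * (A y * B y) else 0)"
      by auto
  qed
  also have "\<dots> = controlled R (\<lambda>y. A y * B y)"
    unfolding controlled_def using R by (intro sum.cong refl) (simp add: sum.delta')
  finally show ?thesis .
qed

lemma controlled_adjoint:
  assumes R: "finite R" "R \<subseteq> S"
    and A: "\<And>x y. x \<subseteq> R \<Longrightarrow> y \<subseteq> R \<Longrightarrow> A y * h x = h x * A y"
  shows "adjoint_op (controlled R A) = controlled R (\<lambda>y. adjoint_op (A y))"
  unfolding controlled_def adjoint_sum
proof (rule sum.cong[OF refl])
  fix y assume "y \<in> Pow R"
  then have "A y * proj R y = proj R y * A y" by (intro proj_commute) (use A in auto)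
  then have "proj R y * A y = A y * proj R y" ..
  then show "adjoint_op (proj R y * A y) = proj R y * adjoint_op (A y)"
    by (simp add: proj_adjoint[OF R])
qed

lemma controlled_prod_list:
  assumes R: "finite R" "R \<subseteq> S"
    and A: "\<And>i x y. i \<in> set is \<Longrightarrow> x \<subseteq> R \<Longrightarrow> y \<subseteq> R \<Longrightarrow> A i y * h x = h x * A i y"
  shows "prod_list (map (\<lambda>i. controlled R (A i)) is) = controlled R (\<lambda>y. prod_list (map (\<lambda>i. A i y) is))"
  using A by (induction "is") (simp_all add: controlled_one R controlled_mult)

lemma controlled_cong:
  "(\<And>y. y \<subseteq> R \<Longrightarrow> A y = B y) \<Longrightarrow> controlled R A = controlled R B"
  by (simp add: controlled_def)

lemma controlled_unitary:
  assumes R: "finite R" "R \<subseteq> S"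
    and A: "\<And>x y. x \<subseteq> R \<Longrightarrow> y \<subseteq> R \<Longrightarrow> A y * h x = h x * A y"
    and unitary: "\<And>y. y \<subseteq> R \<Longrightarrow> unitary_op (A y)"
  shows "unitary_op (controlled R A)"
proof -
  have A': "adjoint_op (A y) * h x = h x * adjoint_op (A y)" if "x \<subseteq> R" "y \<subseteq> R" for x y
  proof -
    have x: "finite x" "x \<subseteq> S" using that R finite_subset by auto
    have "adjoint_op (h x * A y) = adjoint_op (A y * h x)" using A[OF that] by simp
    then show ?thesis by (simp add: h_adjoint[OF x])
  qed
  have adj: "adjoint_op (controlled R A) = controlled R (\<lambda>y. adjoint_op (A y))"
    by (rule controlled_adjoint[OF R A])
  show ?thesis
    unfolding unitary_op_def adj
  proof
    have "controlled R A * controlled R (\<lambda>y. adjoint_op (A y)) = controlled R (\<lambda>y. A y * adjoint_op (A y))"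
      by (rule controlled_mult[OF R A])
    also have "\<dots> = controlled R (\<lambda>_. 1)" by (rule controlled_cong) (simp add: unitary unitary_opD)
    finally show "controlled R A * controlled R (\<lambda>y. adjoint_op (A y)) = 1" by (simp add: controlled_one R)
    have "controlled R (\<lambda>y. adjoint_op (A y)) * controlled R A = controlled R (\<lambda>y. adjoint_op (A y) * A y)"
      by (rule controlled_mult[OF R A'])
    also have "\<dots> = controlled R (\<lambda>_. 1)" by (rule controlled_cong) (simp add: unitary unitary_opD)
    finally show "controlled R (\<lambda>y. adjoint_op (A y)) * controlled R A = 1" by (simp add: controlled_one R)
  qed
qed

text \<open>
  An operator \<open>a\<close> that flips the controls in \<open>C\<close> acquires under conjugation the factor by which \<open>A\<close> changes
  when its argument is shifted by \<open>C\<close>. Comparing values of \<open>A\<close> only on the spectrum is essential for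
  relations among the controls to be usable.
\<close>

lemma controlled_flip:
  assumes R: "finite R" "R \<subseteq> S" and C: "C \<subseteq> R"
    and a: "\<And>x. x \<subseteq> R \<Longrightarrow> a * h x = scale (sgn1 (card (x \<inter> C))) (h x * a)"
    and Aa: "\<And>y. y \<subseteq> R \<Longrightarrow> A y * a = a * A y"
    and b: "\<And>x. x \<subseteq> R \<Longrightarrow> b * h x = h x * b"
    and shift: "\<And>y. y \<subseteq> R \<Longrightarrow> proj R y \<noteq> 0 \<Longrightarrow> A (y \<triangle> C) = b * A y"
  shows "controlled R A * a = b * a * controlled R A"
proof -
  have sub: "y \<triangle> C \<subseteq> R" if "y \<subseteq> R" for y using that C by auto
  have "controlled R A * a = (\<Sum>y\<in>Pow R. proj R (y \<triangle> C) * A (y \<triangle> C) * a)"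
    unfolding controlled_def sum_distrib_right
    by (rule sum_pow_shift[OF C, of "\<lambda>y. proj R y * A y * a", symmetric])
  also have "\<dots> = (\<Sum>y\<in>Pow R. b * a * (proj R y * A y))"
  proof (rule sum.cong[OF refl])
    fix y assume "y \<in> Pow R"
    then have y: "y \<subseteq> R" by simp
    have flip: "proj R (y \<triangle> C) * a = a * proj R y" by (rule proj_flip[OF R(1) C y a, symmetric])
    have "proj R (y \<triangle> C) * A (y \<triangle> C) * a = a * (proj R y * A (y \<triangle> C))"
      using Aa[OF sub[OF y]] flip by (simp only: mult.assoc) (simp only: mult.assoc[symmetric])
    also have "\<dots> = b * a * (proj R y * A y)"
    proof (cases "proj R y = 0")
      case False
      have "b * proj R (y \<triangle> C) = proj R (y \<triangle> C) * b" by (rule proj_commute[OF b])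
      have "a * (proj R y * A (y \<triangle> C)) = proj R (y \<triangle> C) * A (y \<triangle> C) * a"
        using calculation by simp
      also have "\<dots> = proj R (y \<triangle> C) * b * (A y * a)" using shift[OF y False] by (simp only: mult.assoc)
      also have "\<dots> = b * proj R (y \<triangle> C) * (a * A y)"
        using Aa[OF y] \<open>b * proj R (y \<triangle> C) = proj R (y \<triangle> C) * b\<close> by simp
      also have "\<dots> = b * (proj R (y \<triangle> C) * a) * A y" by (simp only: mult.assoc)
      also have "\<dots> = b * a * (proj R y * A y)" unfolding flip by (simp only: mult.assoc)
      finally show ?thesis .
    qed simp
    finally show "proj R (y \<triangle> C) * A (y \<triangle> C) * a = b * a * (proj R y * A y)" .
  qed
  finally show ?thesis by (simp add: controlled_def sum_distrib_left)
qed

text \<open>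
  An operator that commutes with the controls and anticommutes with \<open>A y\<close> exactly if \<open>s \<in> y\<close> acquires
  the involution of \<open>s\<close>.
\<close>

lemma controlled_sign:
  assumes R: "finite R" "R \<subseteq> S" and s: "s \<in> R"
    and a: "\<And>x. x \<subseteq> R \<Longrightarrow> a * h x = h x * a"
    and Aa: "\<And>y. y \<subseteq> R \<Longrightarrow> A y * a = scale (sgn1 (card ({s} \<inter> y))) (a * A y)"
  shows "controlled R A * a = a * h {s} * controlled R A"
  unfolding controlled_def sum_distrib_left sum_distrib_right
proof (rule sum.cong[OF refl])
  fix y assume "y \<in> Pow R"
  then have y: "y \<subseteq> R" by simp
  have "proj R y * A y * a = scale (sgn1 (card ({s} \<inter> y))) (proj R y * a * A y)"
    using Aa[OF y] by (simp only: mult.assoc scale_mult_right)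
  also have "proj R y * a = a * proj R y" by (rule proj_commute[OF a, symmetric])
  also have "scale (sgn1 (card ({s} \<inter> y))) (a * proj R y * A y) =
      a * scale (sgn1 (card ({s} \<inter> y))) (proj R y) * A y"
    by (simp add: mult.assoc)
  also have "scale (sgn1 (card ({s} \<inter> y))) (proj R y) = h {s} * proj R y"
    by (rule h_proj[OF R, symmetric]) (use s in simp)
  finally show "proj R y * A y * a = a * h {s} * (proj R y * A y)" by (simp only: mult.assoc)
qed

lemma controlled_commute:
  assumes a: "\<And>x. x \<subseteq> R \<Longrightarrow> a * h x = h x * a" and Aa: "\<And>y. y \<subseteq> R \<Longrightarrow> A y * a = a * A y"
  shows "controlled R A * a = a * controlled R A"
  unfolding controlled_def sum_distrib_left sum_distrib_right
proof (rule sum.cong[OF refl])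
  fix y assume "y \<in> Pow R"
  then have "A y * a = a * A y" "proj R y * a = a * proj R y" using Aa proj_commute[OF a] by auto
  then show "proj R y * A y * a = a * (proj R y * A y)" by (metis mult.assoc)
qed

end

section \<open>Poincare duality and the cochain operations\<close>

lemma lookup_frag_sum: "lookup (sum f S) k = (\<Sum>i\<in>S. lookup (f i) k)"
  by (induction S rule: infinite_finite_induct) (auto simp: lookup_add)

lemma bit_sum_eq_1_iff: "finite S \<Longrightarrow> sum f S = (1 :: bit) \<longleftrightarrow> odd (card {i \<in> S. f i = 1})"
proof (induction S rule: finite_induct)
  case (insert x S)
  have "{i \<in> insert x S. f i = 1} = (if f x = 1 then insert x {i \<in> S. f i = 1} else {i \<in> S. f i = 1})"
    by auto
  then show ?case using insert by (cases "f x"; cases "sum f S") auto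
qed simp

lemma prod_of_bool: "finite S \<Longrightarrow> (\<Prod>i\<in>S. of_bool (P i)) = (of_bool (\<forall>i\<in>S. P i) :: int)"
  by (induction S rule: finite_induct) auto

lemma cells_top: "c \<in> cells d d \<longleftrightarrow> fst c \<in> points d \<and> snd c = {1..d}"
proof -
  have "I = {1..d}" if "I \<subseteq> {1..d}" "card I = d" for I
    by (rule card_subset_eq) (use that in auto)
  then have "I \<subseteq> {1..d} \<and> card I = d \<longleftrightarrow> I = {1..d}" for I by (metis card_atLeastAtMost diff_Suc_1 order_refl)
  then show ?thesis unfolding cells_def by (simp only: mem_Collect_eq case_prod_unfold)
qed

lemma integral_cells_eq_sum:
  assumes "finite X" "X \<subseteq> cells d d" "\<And>c. c \<in> cells d d \<Longrightarrow> f c \<noteq> 0 \<Longrightarrow> c \<in> X"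
  shows "integral_cells d f = sum f X"
  unfolding integral_cells_def by (rule sum.mono_neutral_left) (use assms in auto)

context lattice
begin

text \<open>
  The cup product pairs \<open>s\<close> on the left with exactly one cell, its dual.
\<close>

definition dual :: "cell \<Rightarrow> cell" where
  "dual s = (translate (fst s) (snd s), {1..d} - snd s)"

definition dual_inverse :: "cell \<Rightarrow> cell" where
  "dual_inverse s = (\<lambda>i. fst s i - of_bool (i \<in> {1..d} - snd s), {1..d} - snd s)"

lemma dual_cells: "s \<in> cells d p \<Longrightarrow> dual s \<in> cells d (d - p)"
  by (auto simp: cells_def dual_def translate_def points_def card_Diff_subset finite_subset)

lemma dual_inverse_cells: "s \<in> cells d p \<Longrightarrow> dual_inverse s \<in> cells d (d - p)"
  by (auto simp: cells_def dual_inverse_def points_def card_Diff_subset finite_subset)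

lemma dual_dual_inverse: "s \<in> cells d p \<Longrightarrow> dual (dual_inverse s) = s"
  by (auto simp: cells_def dual_def dual_inverse_def translate_def)

lemma dual_inverse_dual:
  assumes "s \<in> cells d p"
  shows "dual_inverse (dual s) = s"
proof -
  have "snd s \<subseteq> {1..d}" using assms by (auto simp: cells_def)
  then have *: "{1..d} - ({1..d} - snd s) = snd s" by auto
  have "(\<lambda>i. translate (fst s) (snd s) i - of_bool (i \<in> snd s)) = fst s"
    by (rule ext) (simp add: translate_def)
  then show ?thesis by (simp only: dual_def dual_inverse_def fst_conv snd_conv * prod.collapse)
qed

lemma mem_coboundary_set:
  "s \<in> coboundary_set r \<longleftrightarrow>
     (\<exists>i\<in>{1..d} - snd r. snd s = insert i (snd r) \<and> (fst s = fst r \<or> fst s = (fst r)(i := fst r i - 1)))"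
proof -
  let ?N = "{1..d} - snd r"
  let ?t = "\<lambda>i. (-1) ^ card {j \<in> snd r. j < i} *
    (of_bool (s = ((fst r)(i := fst r i - 1), insert i (snd r))) - of_bool (s = (fst r, insert i (snd r))) :: int)"
  have lookup: "lookup (coboundary_cell r) s = (\<Sum>i\<in>?N. ?t i)"
    unfolding coboundary_cell_def lookup_frag_sum
    by (intro sum.cong refl) (auto simp: lookup_minus of_bool_def)
  show ?thesis
  proof (cases "\<exists>i\<in>?N. snd s = insert i (snd r) \<and> (fst s = fst r \<or> fst s = (fst r)(i := fst r i - 1))")
    case True
    then obtain i where i: "i \<in> ?N" "snd s = insert i (snd r)"
      "fst s = fst r \<or> fst s = (fst r)(i := fst r i - 1)" by blast
    have "(\<Sum>i\<in>?N. ?t i) = (\<Sum>i\<in>{i}. ?t i)"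
    proof (rule sum.mono_neutral_right)
      show "\<forall>j\<in>?N - {i}. ?t j = 0"
      proof
        fix j assume j: "j \<in> ?N - {i}"
        then have "snd s \<noteq> insert j (snd r)" using i by auto
        then have "s \<noteq> (v, insert j (snd r))" for v by auto
        then show "?t j = 0" by simp
      qed
    qed (use i in auto)
    moreover have "(fst r)(i := fst r i - 1) \<noteq> fst r"
    proof
      assume "(fst r)(i := fst r i - 1) = fst r"
      from fun_cong[OF this, of i] show False by simp
    qed
    then have "odd (?t i)" using i(2,3) by (cases s) auto
    ultimately have "odd (lookup (coboundary_cell r) s)" unfolding lookup by simp
    then show ?thesis using True by (simp add: coboundary_set_def)
  next
    case False
    have "?t i = 0" if "i \<in> ?N" for i
      using False that by (cases s) (auto simp: of_bool_def)
    then have "lookup (coboundary_cell r) s = 0" unfolding lookup by (intro sum.neutral) blast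
    then show ?thesis using False by (simp add: coboundary_set_def)
  qed
qed

lemma coboundary_set_cells: "r \<in> cells d p \<Longrightarrow> s \<in> coboundary_set r \<Longrightarrow> s \<in> cells d (Suc p)"
  using coboundary_cell_cells coboundary_set_keys by blast

lemma coboundary_set_near: "s \<in> coboundary_set r \<Longrightarrow> near_cells 1 r s"
  using coboundary_cell_near coboundary_set_keys by blast

lemma dual_coboundary:
  assumes a: "a \<in> cells d p" and b: "b \<in> cells d (Suc p)"
  shows "b \<in> coboundary_set a \<longleftrightarrow> dual a \<in> coboundary_set (dual b)"
proof -
  obtain w J where a_eq: "a = (w, J)" by (cases a)
  obtain v I where b_eq: "b = (v, I)" by (cases b)
  have sub: "J \<subseteq> {1..d}" "I \<subseteq> {1..d}" using a b by (auto simp: a_eq b_eq cells_def)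
  show ?thesis
  proof
    assume "b \<in> coboundary_set a"
    then obtain i where i: "i \<in> {1..d} - J" "I = insert i J" "v = w \<or> v = w(i := w i - 1)"
      by (auto simp: mem_coboundary_set a_eq b_eq)
    have "{1..d} - J = insert i ({1..d} - I)" "i \<in> {1..d} - ({1..d} - I)" using i by auto
    moreover have "translate w J = translate v I \<or>
        translate w J = (translate v I)(i := translate v I i - 1)"
      using i(3)
    proof
      assume "v = w"
      then have "translate w J = (translate v I)(i := translate v I i - 1)"
        using i by (intro ext) (auto simp: translate_def)
      then show ?thesis ..
    next
      assume "v = w(i := w i - 1)"
      then have "translate w J = translate v I"
        using i by (intro ext) (auto simp: translate_def)
      then show ?thesis ..
    qed
    ultimately show "dual a \<in> coboundary_set (dual b)"
      unfolding mem_coboundary_set by (auto simp: a_eq b_eq dual_def)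
  next
    assume "dual a \<in> coboundary_set (dual b)"
    then obtain i where i: "i \<in> {1..d} - ({1..d} - I)" "{1..d} - J = insert i ({1..d} - I)"
      "translate w J = translate v I \<or> translate w J = (translate v I)(i := translate v I i - 1)"
      unfolding mem_coboundary_set a_eq b_eq dual_def fst_conv snd_conv by blast
    have "i \<notin> J" using i(2) by blast
    have I: "I = insert i J" using i(1,2) sub by blast
    have "v = w \<or> v = w(i := w i - 1)"
      using i(3)
    proof
      assume h: "translate w J = translate v I"
      have "v = w(i := w i - 1)"
      proof
        fix k show "v k = (w(i := w i - 1)) k"
          using fun_cong[OF h, of k] \<open>i \<notin> J\<close> by (auto simp: translate_def I split: if_splits)
      qed
      then show ?thesis ..
    next
      assume h: "translate w J = (translate v I)(i := translate v I i - 1)"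
      have "v = w"
      proof
        fix k show "v k = w k"
          using fun_cong[OF h, of k] \<open>i \<notin> J\<close> by (auto simp: translate_def I split: if_splits)
      qed
      then show ?thesis ..
    qed
    moreover have "i \<in> {1..d} - J" using i(1) \<open>i \<notin> J\<close> by auto
    ultimately show "b \<in> coboundary_set a"
      unfolding mem_coboundary_set using I by (auto simp: a_eq b_eq)
  qed
qed

lemma dual_inverse_coboundary:
  assumes a: "a \<in> cells d p" and b: "b \<in> cells d (Suc p)"
  shows "b \<in> coboundary_set a \<longleftrightarrow> dual_inverse a \<in> coboundary_set (dual_inverse b)"
proof -
  have "Suc p \<le> d"
    using b card_mono[of "{1..d}" "snd b"] by (auto simp: cells_def)
  then have "dual_inverse a \<in> cells d (Suc (d - Suc p))"
    using dual_inverse_cells[OF a] by (simp add: Suc_diff_Suc)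
  from dual_coboundary[OF dual_inverse_cells[OF b] this] show ?thesis
    by (simp add: dual_dual_inverse[OF a] dual_dual_inverse[OF b])
qed

lemma coboundary_set_coboundary_set:
  assumes q: "q \<in> cells d p"
  shows "even (card {r \<in> coboundary_set q. t \<in> coboundary_set r})"
proof -
  have "coboundary (coboundary_cell q) = 0" using cellsD[OF q] by (simp add: coboundary_coboundary_cell)
  then have "(\<Sum>r\<in>keys (coboundary_cell q). lookup (coboundary_cell q) r * lookup (coboundary_cell r) t) = 0"
    unfolding coboundary_def frag_extend_def
    by (metis (no_types, lifting) lookup_frag_cmul lookup_frag_sum lookup_zero sum.cong)
  then have "even (\<Sum>r\<in>keys (coboundary_cell q). lookup (coboundary_cell q) r * lookup (coboundary_cell r) t)"
    by simp
  then have "even (card {r \<in> keys (coboundary_cell q). odd (lookup (coboundary_cell q) r * lookup (coboundary_cell r) t)})"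
    by (subst (asm) even_sum_iff) auto
  moreover have "{r \<in> keys (coboundary_cell q). odd (lookup (coboundary_cell q) r * lookup (coboundary_cell r) t)} =
      {r \<in> coboundary_set q. t \<in> coboundary_set r}"
    by (auto simp: coboundary_set_def in_keys_iff)
  ultimately show ?thesis by simp
qed

lemma lookup_coboundary_chain_of:
  "finite n \<Longrightarrow> lookup (coboundary (chain_of n)) t = (\<Sum>s\<in>n. lookup (coboundary_cell s) t)"
  by (simp add: chain_of_def coboundary_sum lookup_frag_sum)

lemma even_coboundary_chain_of:
  assumes "finite n"
  shows "even (lookup (coboundary (chain_of n)) t) \<longleftrightarrow> even (card {s \<in> n. t \<in> coboundary_set s})"
  using assms by (simp add: lookup_coboundary_chain_of even_sum_iff coboundary_set_def)

definition faces :: "cell \<Rightarrow> cell set" where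
  "faces t = {s \<in> cells d (card (snd t) - 1). t \<in> coboundary_set s}"

lemma faces_near: "s \<in> faces t \<Longrightarrow> near_cells 1 t s"
  using coboundary_set_near near_cells_sym by (auto simp: faces_def)

text \<open>
  Duality turns the faces of \<open>t\<close> into the coboundary of the dual of \<open>t\<close>, so this is \<open>\<delta>\<delta> = 0\<close>.
\<close>

lemma faces_dual:
  assumes t: "t \<in> cells d (Suc (Suc p))" and x: "x \<in> cells d y"
  shows "even (card {s \<in> faces t. x \<in> coboundary_set (dual s)})"
proof -
  have le: "Suc (Suc p) \<le> d"
    using t card_mono[of "{1..d}" "snd t"] by (auto simp: cells_def)
  have dt: "dual t \<in> cells d (d - Suc (Suc p))" by (rule dual_cells[OF t])
  have faces: "s \<in> faces t \<longleftrightarrow> s \<in> cells d (Suc p) \<and> dual s \<in> coboundary_set (dual t)" for s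
    using dual_coboundary[OF _ t, of s] cellsD[OF t] by (auto simp: faces_def)
  have "bij_betw dual {s \<in> faces t. x \<in> coboundary_set (dual s)}
      {r \<in> coboundary_set (dual t). x \<in> coboundary_set r}"
  proof (rule bij_betw_byWitness[where f' = dual_inverse])
    have cells: "r \<in> cells d (d - Suc p)" if "r \<in> coboundary_set (dual t)" for r
      using coboundary_set_cells[OF dt that] le by (simp add: Suc_diff_Suc)
    have "d - (d - Suc p) = Suc p" using le by simp
    then show "dual_inverse ` {r \<in> coboundary_set (dual t). x \<in> coboundary_set r} \<subseteq>
        {s \<in> faces t. x \<in> coboundary_set (dual s)}"
      using cells dual_inverse_cells dual_dual_inverse by (fastforce simp: faces)
    show "\<forall>r\<in>{r \<in> coboundary_set (dual t). x \<in> coboundary_set r}. dual (dual_inverse r) = r"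
      using cells dual_dual_inverse by blast
    show "\<forall>s\<in>{s \<in> faces t. x \<in> coboundary_set (dual s)}. dual_inverse (dual s) = s"
      using dual_inverse_dual by (auto simp: faces)
  qed (auto simp: faces)
  then have "card {s \<in> faces t. x \<in> coboundary_set (dual s)} =
      card {r \<in> coboundary_set (dual t). x \<in> coboundary_set r}"
    by (rule bij_betw_same_card)
  then show ?thesis using coboundary_set_coboundary_set[OF dt] by (simp only:)
qed

lemma cobd_ind:
  assumes "finite (snd s)" "snd s \<subseteq> {1..d}"
  shows "cobd (ind r) s = 1 \<longleftrightarrow> s \<in> coboundary_set r"
proof -
  obtain v I where s: "s = (v, I)" by (cases s)
  obtain w J where r: "r = (w, J)" by (cases r)
  let ?f = "\<lambda>i. ind r (v, I - {i}) + ind r (translate v {i}, I - {i})"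
  have I: "finite I" using assms s by simp
  have f: "?f i = 1 \<longleftrightarrow> I - {i} = J \<and> (v = w \<or> v = w(i := w i - 1))" for i
  proof -
    have "translate v {i} = w \<longleftrightarrow> v = w(i := w i - 1)"
    proof
      assume h: "translate v {i} = w"
      show "v = w(i := w i - 1)" unfolding h[symmetric] by (rule ext) (simp add: translate_def)
    next
      assume "v = w(i := w i - 1)"
      then show "translate v {i} = w" by (intro ext) (simp add: translate_def)
    qed
    moreover have "w(i := w i - 1) \<noteq> w"
    proof
      assume "w(i := w i - 1) = w"
      from fun_cong[OF this, of i] show False by simp
    qed
    ultimately show ?thesis by (auto simp: ind_def r)
  qed
  have "cobd (ind r) s = (\<Sum>i\<in>I. ?f i)" by (simp add: cobd_def s)
  then have "cobd (ind r) s = 1 \<longleftrightarrow> odd (card {i \<in> I. ?f i = 1})"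
    using bit_sum_eq_1_iff[OF I] by simp
  also have "{i \<in> I. ?f i = 1} = {i \<in> I. I - {i} = J \<and> (v = w \<or> v = w(i := w i - 1))}"
    using f by simp
  also have "odd (card \<dots>) \<longleftrightarrow> (\<exists>i. i \<in> I \<and> I - {i} = J \<and> (v = w \<or> v = w(i := w i - 1)))"
  proof (cases "\<exists>i. i \<in> I \<and> I - {i} = J \<and> (v = w \<or> v = w(i := w i - 1))")
    case True
    then obtain i where i: "i \<in> I" "I - {i} = J" "v = w \<or> v = w(i := w i - 1)" by blast
    have single: "{i \<in> I. I - {i} = J \<and> (v = w \<or> v = w(i := w i - 1))} = {i}" using i by blast
    show ?thesis unfolding single using True by simp
  next
    case False
    then have empty: "{i \<in> I. I - {i} = J \<and> (v = w \<or> v = w(i := w i - 1))} = {}" by blast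
    show ?thesis unfolding empty using False by simp
  qed
  also have "\<dots> \<longleftrightarrow> s \<in> coboundary_set r"
  proof -
    have "I \<subseteq> {1..d}" using assms(2) s by simp
    then have "i \<in> I \<and> I - {i} = J \<longleftrightarrow> i \<in> {1..d} - J \<and> I = insert i J" for i by blast
    then show ?thesis unfolding mem_coboundary_set s r fst_conv snd_conv Bex_def by metis
  qed
  finally show ?thesis .
qed

lemma integral_cup_ind:
  assumes a: "a \<in> cells d p"
  shows "integral_cells d (cup p (ind a) (ind b)) = 1 \<longleftrightarrow> b = dual a"
proof -
  let ?K = "{1..d}"
  have cup: "cup p (ind a) (ind b) (v, ?K) = (if v = fst a \<and> b = dual a then 1 else 0)" for v
  proof -
    have "cup p (ind a) (ind b) (v, ?K) =
        (\<Sum>I | I \<subseteq> ?K \<and> card I = p. if I = snd a then (if v = fst a \<and> b = dual a then 1 else 0) else 0)"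
      unfolding cup_def split_conv
    proof (rule sum.cong[OF refl])
      fix I
      have "(v, I) = a \<longleftrightarrow> v = fst a \<and> I = snd a" by (cases a) simp
      then have 1: "ind a (v, I) = (if v = fst a \<and> I = snd a then 1 else 0)" by (simp only: ind_def)
      show "ind a (v, I) * ind b (translate v I, ?K - I) =
          (if I = snd a then (if v = fst a \<and> b = dual a then 1 else 0) else 0)"
      proof (cases "v = fst a \<and> I = snd a")
        case True
        then have "(translate v I, ?K - I) = dual a" by (simp add: dual_def)
        then have "ind b (translate v I, ?K - I) = (if b = dual a then 1 else 0)"
          unfolding ind_def by metis
        then show ?thesis unfolding 1 using True by simp
      next
        case False
        then show ?thesis unfolding 1 by auto
      qed
    qed
    also have "\<dots> = (if v = fst a \<and> b = dual a then 1 else 0)"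
      using a by (subst sum.delta) (auto simp: cells_def)
    finally show ?thesis .
  qed
  have "integral_cells d (cup p (ind a) (ind b)) = sum (cup p (ind a) (ind b)) {(fst a, ?K)}"
  proof (rule integral_cells_eq_sum)
    show "{(fst a, ?K)} \<subseteq> cells d d" using a by (auto simp: cells_top cells_def)
    fix c assume "c \<in> cells d d" "cup p (ind a) (ind b) c \<noteq> 0"
    then show "c \<in> {(fst a, ?K)}"
      using cup[of "fst c"] by (cases c) (auto simp: cells_top split: if_splits)
  qed simp
  then show ?thesis using cup[of "fst a"] by simp
qed

text \<open>
  The only cell that pairs on the left with \<open>t\<close> in the summand of the \<open>\<union>\<^sub>1\<close>-product with shared
  direction \<open>c\<close>.
\<close>

definition partner :: "cell \<Rightarrow> nat \<Rightarrow> cell" where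
  "partner t c = (\<lambda>i. fst t i - of_bool (i \<in> {1..d} - snd t \<and> i < c) + of_bool (i \<in> snd t \<and> c < i),
     insert c ({1..d} - snd t))"

lemma inj_partner: "inj_on (partner t) (snd t)"
proof (rule inj_onI)
  fix c c' assume c: "c \<in> snd t" "c' \<in> snd t" "partner t c = partner t c'"
  then have "insert c ({1..d} - snd t) = insert c' ({1..d} - snd t)" by (simp add: partner_def)
  then show "c = c'" using c by blast
qed

lemma card_partner: "odd (card {c \<in> snd t. s = partner t c}) \<longleftrightarrow> (\<exists>c\<in>snd t. s = partner t c)"
proof (cases "\<exists>c\<in>snd t. s = partner t c")
  case True
  then obtain c where c: "c \<in> snd t" "s = partner t c" by blast
  then have single: "{c \<in> snd t. s = partner t c} = {c}" using inj_onD[OF inj_partner] by blast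
  show ?thesis unfolding single using True by simp
next
  case False
  then have empty: "{c \<in> snd t. s = partner t c} = {}" by blast
  show ?thesis unfolding empty using False by simp
qed

lemma unsigned_factors1:
  assumes s: "s \<in> cells d p" and t: "t \<in> cells d q" and c: "c \<in> {1..d}"
  shows "unsigned_form (factors1 c) s t = of_bool (c \<in> snd t \<and> s = partner t c)"
proof -
  define P where "P i \<longleftrightarrow> (if i < c then i \<notin> snd s \<and> i \<in> snd t \<and> fst s i = fst t i \<or>
        i \<in> snd s \<and> i \<notin> snd t \<and> fst t i = fst s i + 1
     else if i = c then i \<in> snd s \<and> i \<in> snd t \<and> fst s i = fst t i
     else i \<notin> snd t \<and> i \<in> snd s \<and> fst t i = fst s i \<or> i \<in> snd t \<and> i \<notin> snd s \<and> fst s i = fst t i + 1)" for i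
  have "unsigned_form (factors1 c) s t = (\<Prod>i\<in>{1..d}. of_bool (P i))"
    unfolding unsigned_form_def
    by (rule prod.cong) (simp_all add: factors1_def cup_form_def edge_form_def flipped_def comp_at_def P_def)
  also have "\<dots> = of_bool (\<forall>i\<in>{1..d}. P i)" by (rule prod_of_bool) simp
  also have "(\<forall>i\<in>{1..d}. P i) \<longleftrightarrow> c \<in> snd t \<and> s = partner t c"
  proof
    assume P: "\<forall>i\<in>{1..d}. P i"
    have sub: "snd s \<subseteq> {1..d}" "snd t \<subseteq> {1..d}" and pts: "fst s \<in> points d" "fst t \<in> points d"
      using cellsD[OF s] cellsD[OF t] by auto
    have ct: "c \<in> snd t" using P c by (auto simp: P_def)
    have "snd s = snd (partner t c)"
    proof (rule set_eqI)
      fix i show "i \<in> snd s \<longleftrightarrow> i \<in> snd (partner t c)"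
      proof (cases "i \<in> {1..d}")
        case True
        then show ?thesis using bspec[OF P True] by (auto simp: P_def partner_def split: if_splits)
      next
        case False
        then show ?thesis using sub c by (auto simp: partner_def)
      qed
    qed
    moreover have "fst s = fst (partner t c)"
    proof
      fix i show "fst s i = fst (partner t c) i"
      proof (cases "i \<in> {1..d}")
        case True
        have Pi: "P i" using P True by blast
        consider "i < c" | "i = c" | "c < i" by linarith
        then show ?thesis
        proof cases
          case 1
          then show ?thesis using Pi True by (cases "i \<in> snd t") (simp_all add: P_def partner_def)
        next
          case 2
          then show ?thesis using Pi True by (simp add: P_def partner_def)
        next
          case 3
          then show ?thesis using Pi True by (cases "i \<in> snd t") (simp_all add: P_def partner_def)
        qed
      next
        case False
        then have "fst s i = 0" "fst t i = 0" "i \<notin> snd t" using pts sub unfolding points_def by blast+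
        then show ?thesis using False by (auto simp: partner_def)
      qed
    qed
    ultimately show "c \<in> snd t \<and> s = partner t c" using ct by (simp add: prod_eq_iff)
  next
    assume h: "c \<in> snd t \<and> s = partner t c"
    show "\<forall>i\<in>{1..d}. P i"
    proof
      fix i assume i: "i \<in> {1..d}"
      have s: "i \<in> snd s \<longleftrightarrow> i = c \<or> i \<notin> snd t"
        "fst s i = fst t i - of_bool (i \<in> {1..d} - snd t \<and> i < c) + of_bool (i \<in> snd t \<and> c < i)"
        using h i by (auto simp: partner_def)
      show "P i"
        unfolding P_def s using h i by (cases "i \<in> snd t") auto
    qed
  qed
  finally show ?thesis .
qed

lemma odd_cup1_form:
  assumes s: "s \<in> cells d p" and t: "t \<in> cells d q"
  shows "odd (cup1_form s t) \<longleftrightarrow> (\<exists>c\<in>snd t. s = partner t c)"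
proof -
  have sub: "snd t \<subseteq> {1..d}" using cellsD[OF t] by simp
  have odd_koszul: "odd (koszul I J)" for I J by (simp add: koszul_def)
  have "odd (cup1_form s t) \<longleftrightarrow> odd (card {c \<in> {1..d}. odd ((-1) ^ (c - 1) * form (factors1 c) s t)})"
    by (simp add: cup1_form_def even_sum_iff)
  also have "{c \<in> {1..d}. odd ((-1) ^ (c - 1) * form (factors1 c) s t)} = {c \<in> snd t. s = partner t c}"
  proof -
    have "odd ((-1) ^ (c - 1) * form (factors1 c) s t) \<longleftrightarrow> c \<in> snd t \<and> s = partner t c"
      if "c \<in> {1..d}" for c
      unfolding form_def unsigned_factors1[OF s t that] by (simp add: odd_koszul)
    then show ?thesis using sub by blast
  qed
  also have "odd (card {c \<in> snd t. s = partner t c}) \<longleftrightarrow> (\<exists>c\<in>snd t. s = partner t c)"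
    by (rule card_partner)
  finally show ?thesis .
qed

lemma integral_cup1_ind:
  assumes t: "t \<in> cells d l" and d: "d = 2 * l - 1" "l \<ge> 1"
  shows "integral_cells d (cup1 l a (ind t)) = (\<Sum>c\<in>snd t. a (partner t c))"
proof -
  let ?K = "{1..d}" and ?J = "snd t"
  let ?I = "?K - ?J"
  define pt where "pt c = (\<lambda>i. fst t i - of_bool (i \<in> ?I \<and> i < c))" for c
  have sub: "?J \<subseteq> ?K" and pts: "fst t \<in> points d" and cardJ: "card ?J = l" using cellsD[OF t] by auto
  have finJ: "finite ?J" using sub finite_subset by auto
  have cardI: "card ?I = l - 1" using sub finJ cardJ d by (simp add: card_Diff_subset)
  have val: "cup1 l a (ind t) (v, ?K) = (\<Sum>c\<in>?J. if v = pt c then a (partner t c) else 0)" for v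
  proof -
    let ?T = "\<lambda>c I. a (translate v {j \<in> ?K - {c} - I. c < j}, insert c I) *
        ind t (translate v {i \<in> I. i < c}, insert c (?K - {c} - I))"
    have inner: "(\<Sum>I | I \<subseteq> ?K - {c} \<and> card I = l - 1. ?T c I) =
        (if c \<in> ?J \<and> v = pt c then a (partner t c) else 0)" if c: "c \<in> ?K" for c
    proof -
      have "(\<Sum>I | I \<subseteq> ?K - {c} \<and> card I = l - 1. ?T c I) =
          (\<Sum>I | I \<subseteq> ?K - {c} \<and> card I = l - 1. if I = ?I then (if c \<in> ?J \<and> v = pt c then a (partner t c) else 0) else 0)"
      proof (rule sum.cong[OF refl])
        fix I assume "I \<in> {I. I \<subseteq> ?K - {c} \<and> card I = l - 1}"
        then have I: "I \<subseteq> ?K - {c}" by simp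
        show "?T c I = (if I = ?I then (if c \<in> ?J \<and> v = pt c then a (partner t c) else 0) else 0)"
        proof (cases "I = ?I \<and> c \<in> ?J")
          case True
          have J: "insert c (?K - {c} - I) = ?J" using True sub by auto
          have "translate v {i \<in> I. i < c} = fst t \<longleftrightarrow> v = pt c"
          proof
            assume h: "translate v {i \<in> I. i < c} = fst t"
            show "v = pt c"
            proof
              fix i show "v i = pt c i"
                using fun_cong[OF h, of i] True by (auto simp: translate_def pt_def)
            qed
          next
            assume "v = pt c"
            then show "translate v {i \<in> I. i < c} = fst t"
              using True by (intro ext) (auto simp: translate_def pt_def)
          qed
          then have ind: "ind t (translate v {i \<in> I. i < c}, insert c (?K - {c} - I)) = (if v = pt c then 1 else 0)"
            unfolding J by (auto simp: ind_def prod_eq_iff)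
          have "translate v {j \<in> ?K - {c} - I. c < j} = fst (partner t c)" if "v = pt c"
          proof
            fix i show "translate v {j \<in> ?K - {c} - I. c < j} i = fst (partner t c) i"
              using True sub that by (auto simp: translate_def partner_def pt_def)
          qed
          moreover have "insert c I = snd (partner t c)" using True by (simp add: partner_def)
          ultimately have "v = pt c \<Longrightarrow> (translate v {j \<in> ?K - {c} - I. c < j}, insert c I) = partner t c"
            by (simp add: prod_eq_iff)
          then show ?thesis unfolding ind using True by auto
        next
          case False
          have "insert c (?K - {c} - I) \<noteq> ?J"
          proof
            assume h: "insert c (?K - {c} - I) = ?J"
            then have "c \<in> ?J" by blast
            moreover have "I = ?I" using h I c by auto
            ultimately show False using False by simp
          qed
          then have "(x, insert c (?K - {c} - I)) \<noteq> t" for x by (cases t) (simp only: snd_conv prod.inject, blast)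
          then have 0: "ind t (translate v {i \<in> I. i < c}, insert c (?K - {c} - I)) = 0"
            unfolding ind_def by (simp only: if_False)
          show ?thesis unfolding 0 using False by (cases "I = ?I"; cases "c \<in> ?J") (simp_all only: mult_zero_right simp_thms if_True if_False)
        qed
      qed
      also have "\<dots> = (if c \<in> ?J \<and> v = pt c then a (partner t c) else 0)"
      proof (cases "c \<in> ?J")
        case True
        then show ?thesis using cardI by (subst sum.delta) auto
      qed simp
      finally show ?thesis .
    qed
    have "cup1 l a (ind t) (v, ?K) = (\<Sum>c\<in>?K. if c \<in> ?J \<and> v = pt c then a (partner t c) else 0)"
      unfolding cup1_def split_conv Let_def by (rule sum.cong[OF refl inner])
    also have "\<dots> = (\<Sum>c\<in>?J. if v = pt c then a (partner t c) else 0)"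
      by (rule sum.mono_neutral_cong_right) (use sub in auto)
    finally show ?thesis .
  qed
  let ?X = "(\<lambda>c. (pt c, ?K)) ` ?J"
  have "integral_cells d (cup1 l a (ind t)) = sum (cup1 l a (ind t)) ?X"
  proof (rule integral_cells_eq_sum)
    show "finite ?X" using finJ by simp
    have "pt c \<in> points d" for c using pts by (auto simp: points_def pt_def)
    then show "?X \<subseteq> cells d d" by (auto simp: cells_top)
    fix x assume x: "x \<in> cells d d" "cup1 l a (ind t) x \<noteq> 0"
    then have x_eq: "x = (fst x, ?K)" by (simp add: cells_top prod_eq_iff)
    show "x \<in> ?X"
    proof (rule ccontr)
      assume "x \<notin> ?X"
      then have "fst x \<noteq> pt c" if "c \<in> ?J" for c using that x_eq by auto
      then have "cup1 l a (ind t) (fst x, ?K) = 0" unfolding val by (intro sum.neutral) auto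
      then show False using x(2) x_eq by simp
    qed
  qed
  also have "\<dots> = (\<Sum>x\<in>?X. \<Sum>c\<in>?J. if fst x = pt c then a (partner t c) else 0)"
  proof (rule sum.cong[OF refl])
    fix x assume "x \<in> ?X"
    then have "x = (fst x, ?K)" by auto
    then show "cup1 l a (ind t) x = (\<Sum>c\<in>?J. if fst x = pt c then a (partner t c) else 0)"
      using val[of "fst x"] by simp
  qed
  also have "\<dots> = (\<Sum>c\<in>?J. \<Sum>x\<in>?X. if fst x = pt c then a (partner t c) else 0)"
    by (rule sum.swap)
  also have "\<dots> = (\<Sum>c\<in>?J. a (partner t c))"
  proof (rule sum.cong[OF refl])
    fix c assume c: "c \<in> ?J"
    have "(\<Sum>x\<in>?X. if fst x = pt c then a (partner t c) else 0) = (\<Sum>x\<in>{(pt c, ?K)}. a (partner t c))"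
      by (rule sum.mono_neutral_cong_right) (use c finJ in auto)
    then show "(\<Sum>x\<in>?X. if fst x = pt c then a (partner t c) else 0) = a (partner t c)" by simp
  qed
  finally show ?thesis .
qed

lemma integral_cup1_ind_ind:
  assumes s: "s \<in> cells d l" and t: "t \<in> cells d l" and d: "d = 2 * l - 1" "l \<ge> 1"
  shows "integral_cells d (cup1 l (ind s) (ind t)) = 1 \<longleftrightarrow> odd (cup1_form s t)"
proof -
  have finJ: "finite (snd t)" using cellsD[OF t] finite_subset by auto
  have "integral_cells d (cup1 l (ind s) (ind t)) = 1 \<longleftrightarrow> odd (card {c \<in> snd t. s = partner t c})"
  proof -
    have "ind s x = 1 \<longleftrightarrow> s = x" for x unfolding ind_def by (cases "x = s") auto
    then show ?thesis unfolding integral_cup1_ind[OF t d] bit_sum_eq_1_iff[OF finJ] by (simp only:)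
  qed
  also have "\<dots> \<longleftrightarrow> (\<exists>c\<in>snd t. s = partner t c)" by (rule card_partner)
  finally show ?thesis unfolding odd_cup1_form[OF s t] .
qed

lemma integral_cup1_cobd:
  assumes r: "r \<in> cells d (l - 1)" and t: "t \<in> cells d l" and d: "d = 2 * l - 1" "l \<ge> 1"
  shows "integral_cells d (cup1 l (cobd (ind r)) (ind t)) = 1 \<longleftrightarrow>
    odd (\<Sum>s\<in>coboundary_set r. cup1_form s t)"
proof -
  have finJ: "finite (snd t)" and sub: "snd t \<subseteq> {1..d}" using cellsD[OF t] finite_subset by auto
  have "integral_cells d (cup1 l (cobd (ind r)) (ind t)) = 1 \<longleftrightarrow>
      odd (card {c \<in> snd t. cobd (ind r) (partner t c) = 1})"
    unfolding integral_cup1_ind[OF t d] bit_sum_eq_1_iff[OF finJ] ..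
  also have "{c \<in> snd t. cobd (ind r) (partner t c) = 1} = {c \<in> snd t. partner t c \<in> coboundary_set r}"
    using sub by (auto simp: cobd_ind partner_def)
  also have "card \<dots> = card {s \<in> coboundary_set r. odd (cup1_form s t)}"
  proof (rule bij_betw_same_card)
    have "odd (cup1_form s t) \<longleftrightarrow> (\<exists>c\<in>snd t. s = partner t c)" if "s \<in> coboundary_set r" for s
      using odd_cup1_form[OF coboundary_set_cells[OF r that] t] .
    then have "partner t ` {c \<in> snd t. partner t c \<in> coboundary_set r} = {s \<in> coboundary_set r. odd (cup1_form s t)}"
      by blast
    moreover have "inj_on (partner t) {c \<in> snd t. partner t c \<in> coboundary_set r}"
      by (rule inj_on_subset[OF inj_partner]) auto
    ultimately show "bij_betw (partner t) {c \<in> snd t. partner t c \<in> coboundary_set r}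
        {s \<in> coboundary_set r. odd (cup1_form s t)}"
      by (simp add: bij_betw_def)
  qed
  also have "odd \<dots> \<longleftrightarrow> odd (\<Sum>s\<in>coboundary_set r. cup1_form s t)"
    by (simp add: even_sum_iff finite_coboundary_set)
  finally show ?thesis .
qed

end

section \<open>Membrane operators\<close>

definition ipow :: "int \<Rightarrow> complex" where "ipow k = \<i> powi k"

lemma ipow_add: "ipow (a + b) = ipow a * ipow b"
  by (simp add: ipow_def power_int_add)

lemma ipow_0 [simp]: "ipow 0 = 1"
  by (simp add: ipow_def)

lemma ipow_double: "ipow (2 * k) = (if even k then 1 else - 1)"
proof -
  have "ipow (2 * k) = (\<i> powi 2) powi k" by (simp only: ipow_def power_int_mult)
  also have "\<i> powi 2 = - 1" by simp
  finally show ?thesis by (auto simp: power_int_minus_left)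
qed

lemma ipow_4 [simp]: "ipow (4 * k) = 1"
  using ipow_double[of "2 * k"] by simp

lemma cmod_ipow [simp]: "cmod (ipow k) = 1"
  by (simp add: ipow_def norm_power_int)

lemma sum_sym_diff:
  fixes f :: "'a \<Rightarrow> int"
  assumes "finite A" "finite B"
  shows "sum f (A \<triangle> B) = sum f A + sum f B - 2 * sum f (A \<inter> B)"
proof -
  have "sum f (A \<triangle> B) = sum f (A - B) + sum f (B - A)" using assms by (intro sum.union_disjoint) auto
  moreover have "sum f A = sum f (A - B) + sum f (A \<inter> B)" "sum f B = sum f (B - A) + sum f (A \<inter> B)"
    using sum.Int_Diff[OF assms(1), of f B] sum.Int_Diff[OF assms(2), of f A] by (simp_all add: Int_commute)
  ultimately show ?thesis by simp
qed

lemma sgn1_card_odd: "finite n \<Longrightarrow> sgn1 (card {t \<in> n. odd (f t)}) = ipow (2 * sum f n)"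
  unfolding ipow_double by (simp add: even_sum_iff minus_one_power_iff)

abbreviation cell_qubit_set :: "species \<Rightarrow> cell set \<Rightarrow> qubit set" where
  "cell_qubit_set \<alpha> n \<equiv> Cell_Qubit \<alpha> ` n"

lemma cell_qubit_set_sym_diff: "cell_qubit_set \<alpha> (A \<triangle> B) = cell_qubit_set \<alpha> A \<triangle> cell_qubit_set \<alpha> B"
  by auto

lemma card_cell_qubit_set_Int: "card (cell_qubit_set \<alpha> A \<inter> cell_qubit_set \<alpha> B) = card (A \<inter> B)"
proof -
  have "cell_qubit_set \<alpha> A \<inter> cell_qubit_set \<alpha> B = cell_qubit_set \<alpha> (A \<inter> B)" by auto
  then show ?thesis by (simp add: card_image inj_on_def)
qed

locale odd_lattice = lattice +
  fixes l :: nat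
  assumes l: "l \<ge> 3" "odd l" and d: "d = 2 * l - 1"
begin

lemma degrees: "even (l - 1)" "Suc (l - 1) = l" "d - l = l - 1" "d - (l - 1) = l" "Suc (Suc (l - 1)) = Suc l"
  using l d by auto

definition nbhd :: "nat \<Rightarrow> cell \<Rightarrow> cell set" where
  "nbhd R s = {t \<in> cells d l. near_cells R s t}"

lemma finite_nbhd: "finite (nbhd R s)"
proof -
  let ?A = "\<Union>i\<in>{1..d}. {fst s i - int R..fst s i + int R}"
  let ?P = "{v :: point. \<forall>i. (i \<in> {1..d} \<longrightarrow> v i \<in> ?A) \<and> (i \<notin> {1..d} \<longrightarrow> v i = 0)}"
  have "finite ?P" by (rule finite_set_of_finite_funs) auto
  moreover have "nbhd R s \<subseteq> ?P \<times> Pow {1..d}"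
  proof
    fix t assume t: "t \<in> nbhd R s"
    have "fst t i \<in> ?A" if "i \<in> {1..d}" for i
    proof -
      have "\<bar>fst s i - fst t i\<bar> \<le> int R" using t by (simp add: nbhd_def near_cells_def)
      then have "fst t i \<in> {fst s i - int R..fst s i + int R}" by auto
      then show ?thesis using that by blast
    qed
    moreover have "fst t i = 0" if "i \<notin> {1..d}" for i
      using t that unfolding nbhd_def cells_def points_def by fastforce
    ultimately have "fst t \<in> ?P" by blast
    moreover have "snd t \<in> Pow {1..d}" using t cellsD[of t d l] by (simp add: nbhd_def)
    ultimately show "t \<in> ?P \<times> Pow {1..d}" by (simp add: mem_Times_iff)
  qed
  ultimately show ?thesis using finite_subset by blast
qed

lemma nbhd_self: "s \<in> cells d l \<Longrightarrow> s \<in> nbhd R s"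
  by (simp add: nbhd_def)

lemma nbhd_cells: "nbhd R s \<subseteq> cells d l"
  by (auto simp: nbhd_def)

lemma nbhd_trans: "t \<in> nbhd R s \<Longrightarrow> t' \<in> nbhd R' t \<Longrightarrow> R + R' \<le> R'' \<Longrightarrow> t' \<in> nbhd R'' s"
  using near_cells_trans near_cells_mono by (fastforce simp: nbhd_def)

lemma nbhd_sym: "s \<in> cells d l \<Longrightarrow> t \<in> nbhd R s \<Longrightarrow> s \<in> nbhd R t"
  by (auto simp: nbhd_def near_cells_sym)

lemma nbhd_mono: "R \<le> R' \<Longrightarrow> nbhd R s \<subseteq> nbhd R' s"
  unfolding nbhd_def using near_cells_mono by blast

lemma cup1_form_nbhd: "s \<in> cells d l \<Longrightarrow> t \<in> cells d l \<Longrightarrow> cup1_form s t \<noteq> 0 \<Longrightarrow> t \<in> nbhd 1 s"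
  using cup1_form_near cellsD by (simp add: nbhd_def)

definition tail :: "cell set \<Rightarrow> cell set" where
  "tail n = {t \<in> cells d l. odd (\<Sum>s\<in>n. cup1_form s t)}"

lemma tail_nbhd: "n \<subseteq> cells d l \<Longrightarrow> tail n \<subseteq> (\<Union>s\<in>n. nbhd 1 s)"
proof
  fix t assume n: "n \<subseteq> cells d l" and t: "t \<in> tail n"
  then obtain s where "s \<in> n" "cup1_form s t \<noteq> 0" "t \<in> cells d l"
    unfolding tail_def using sum.neutral[of n "\<lambda>s. cup1_form s t"] by fastforce
  then show "t \<in> (\<Union>s\<in>n. nbhd 1 s)" using cup1_form_nbhd n by blast
qed

lemma finite_tail: "finite n \<Longrightarrow> n \<subseteq> cells d l \<Longrightarrow> finite (tail n)"
  using tail_nbhd finite_nbhd by (meson finite_UN_I finite_subset)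

text \<open>
  The operator \<open>V\<^sub>n\<close> of the introduction; for the coboundary of \<open>r\<close> it is the generator \<open>G\<^sub>r\<close>.
\<close>

definition membrane :: "species \<Rightarrow> cell set \<Rightarrow> qubit local_op" where
  "membrane \<alpha> n = pauli (cell_qubit_set \<alpha> n) (cell_qubit_set \<alpha> (tail n))"

lemma membrane_local:
  assumes "finite n" "n \<subseteq> cells d l"
  shows "membrane \<alpha> n \<in> local_ops (cell_qubit_set \<alpha> (n \<union> tail n))"
  unfolding membrane_def image_Un by (rule pauli_local) (use assms finite_tail in auto)

lemma membrane_unitary: "finite n \<Longrightarrow> n \<subseteq> cells d l \<Longrightarrow> unitary_op (membrane \<alpha> n)"
  unfolding membrane_def by (rule pauli_unitary) (use finite_tail in auto)

lemma membrane_empty [simp]: "membrane \<alpha> {} = 1"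
  by (simp add: membrane_def tail_def)

lemma membrane_mult:
  assumes n: "finite n" "n \<subseteq> cells d l" and n': "finite n'" "n' \<subseteq> cells d l"
  shows "membrane \<alpha> n * membrane \<alpha> n' =
    scale (ipow (2 * (\<Sum>s\<in>n. \<Sum>t\<in>n'. cup1_form s t))) (membrane \<alpha> (n \<triangle> n'))"
proof -
  have "tail (n \<triangle> n') = tail n \<triangle> tail n'"
    unfolding tail_def by (auto simp: sum_sym_diff n n')
  moreover have "tail n \<inter> n' = {t \<in> n'. odd (\<Sum>s\<in>n. cup1_form s t)}" using n' by (auto simp: tail_def)
  then have "sgn1 (card (tail n \<inter> n')) = ipow (2 * (\<Sum>s\<in>n. \<Sum>t\<in>n'. cup1_form s t))"
    using sgn1_card_odd[OF n'(1), of "\<lambda>t. \<Sum>s\<in>n. cup1_form s t"] by (simp add: sum.swap[of _ n])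
  ultimately show ?thesis
    unfolding membrane_def
    by (subst pauli_mult) (simp_all add: n n' finite_tail card_cell_qubit_set_Int flip: cell_qubit_set_sym_diff)
qed

text \<open>
  With the phase given by the square, closed membranes multiply without signs; this both
  chooses the signs of the commuting generators consistently and makes the products of gates
  below behave like a representation.
\<close>

definition closed_membrane :: "species \<Rightarrow> cell set \<Rightarrow> qubit local_op" where
  "closed_membrane \<alpha> n = scale (ipow (square n)) (membrane \<alpha> n)"

lemma square_empty [simp]: "square {} = 0"
  by (simp add: square_def)

lemma closed_membrane_empty [simp]: "closed_membrane \<alpha> {} = 1"
  by (simp add: closed_membrane_def)

lemma coboundary_set_l: "r \<in> cells d (l - 1) \<Longrightarrow> coboundary_set r \<subseteq> cells d l"
  using coboundary_set_cells[of r "l - 1"] degrees(2) by auto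

lemma square_coboundary:
  assumes r: "r \<in> cells d (l - 1)" and n: "finite n" "n \<subseteq> cells d l" and closed: "closed_near (Suc l) r n"
  shows "ipow (square (n \<triangle> coboundary_set r)) = ipow (square n) * ipow (square (coboundary_set r)) *
    ipow (2 * (\<Sum>s\<in>coboundary_set r. \<Sum>t\<in>n. cup1_form s t))"
proof -
  obtain k where "square (n \<triangle> coboundary_set r) = square n + square (coboundary_set r) +
    2 * (\<Sum>s\<in>coboundary_set r. \<Sum>t\<in>n. cup1_form s t) + 4 * k"
    using square_shift[OF r degrees(1)] n closed degrees by auto
  then show ?thesis by (simp only: ipow_add ipow_4 mult_1_right)
qed

lemma closed_membrane_mult:
  assumes r: "r \<in> cells d (l - 1)" and n: "finite n" "n \<subseteq> cells d l" and closed: "closed_near (Suc l) r n"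
  shows "closed_membrane \<alpha> (coboundary_set r) * closed_membrane \<alpha> n = closed_membrane \<alpha> (n \<triangle> coboundary_set r)"
  unfolding closed_membrane_def square_coboundary[OF assms]
  using membrane_mult[OF finite_coboundary_set coboundary_set_l[OF r] n, of \<alpha>]
  by (simp add: mult_ac Un_commute)

definition boundary_sum :: "cell set \<Rightarrow> cell set" where
  "boundary_sum x = {t \<in> cells d l. odd (card {s \<in> x. t \<in> coboundary_set (dual s)})}"

lemma dual_l: "s \<in> cells d l \<Longrightarrow> dual s \<in> cells d (l - 1)"
  using dual_cells[of s l] degrees by simp

lemma dual_inverse_l: "s \<in> cells d l \<Longrightarrow> dual_inverse s \<in> cells d (l - 1)"
  using dual_inverse_cells[of s l] degrees by simp

lemma boundary_sum_toggle:
  assumes "finite x" "s \<in> cells d l"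
  shows "boundary_sum (x \<triangle> {s}) = boundary_sum x \<triangle> coboundary_set (dual s)"
proof -
  have "odd (card {s' \<in> x \<triangle> {s}. t \<in> coboundary_set (dual s')}) \<longleftrightarrow>
      (odd (card {s' \<in> x. t \<in> coboundary_set (dual s')}) \<noteq> (t \<in> coboundary_set (dual s)))" for t
  proof -
    have "{s' \<in> x \<triangle> {s}. t \<in> coboundary_set (dual s')} =
        {s' \<in> x. t \<in> coboundary_set (dual s')} \<triangle> (if t \<in> coboundary_set (dual s) then {s} else {})"
      by auto
    then show ?thesis
      using card_sym_diff_parity[of "{s' \<in> x. t \<in> coboundary_set (dual s')}"
          "if t \<in> coboundary_set (dual s) then {s} else {}"] assms(1) by simp
  qed
  then show ?thesis
    unfolding boundary_sum_def using coboundary_set_l[OF dual_l[OF assms(2)]] by blast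
qed

lemma boundary_sum_empty [simp]: "boundary_sum {} = {}"
  by (simp add: boundary_sum_def)

lemma boundary_sum_single: "s \<in> cells d l \<Longrightarrow> boundary_sum {s} = coboundary_set (dual s)"
  using boundary_sum_toggle[of "{}" s] by simp

lemma boundary_sum_cells: "boundary_sum x \<subseteq> cells d l"
  by (auto simp: boundary_sum_def)

lemma boundary_sum_sub: "boundary_sum x \<subseteq> (\<Union>s\<in>x. coboundary_set (dual s))"
proof
  fix t assume "t \<in> boundary_sum x"
  then have "{s \<in> x. t \<in> coboundary_set (dual s)} \<noteq> {}" unfolding boundary_sum_def by (metis (mono_tags, lifting) card.empty even_zero mem_Collect_eq)
  then show "t \<in> (\<Union>s\<in>x. coboundary_set (dual s))" by blast
qed

lemma finite_boundary_sum: "finite x \<Longrightarrow> finite (boundary_sum x)"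
  by (rule finite_subset[OF boundary_sum_sub]) (simp add: finite_coboundary_set)

lemma boundary_sum_closed:
  assumes "finite x" "x \<subseteq> cells d l"
  shows "even (card {s \<in> boundary_sum x. t \<in> coboundary_set s})"
  using assms
proof (induction x rule: finite_induct)
  case (insert s x)
  have "insert s x = x \<triangle> {s}" using insert by auto
  then have "boundary_sum (insert s x) = boundary_sum x \<triangle> coboundary_set (dual s)"
    unfolding \<open>insert s x = x \<triangle> {s}\<close> by (intro boundary_sum_toggle) (use insert in auto)
  then have "{u \<in> boundary_sum (insert s x). t \<in> coboundary_set u} =
      {u \<in> boundary_sum x. t \<in> coboundary_set u} \<triangle> {u \<in> coboundary_set (dual s). t \<in> coboundary_set u}"
    by auto
  moreover have "even (card {u \<in> coboundary_set (dual s). t \<in> coboundary_set u})"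
    using coboundary_set_coboundary_set[OF dual_l] insert by blast
  ultimately show ?case
    using card_sym_diff_parity[of "{u \<in> boundary_sum x. t \<in> coboundary_set u}"
        "{u \<in> coboundary_set (dual s). t \<in> coboundary_set u}"]
      insert finite_boundary_sum finite_coboundary_set by simp
qed simp

lemma boundary_sum_closed_near:
  assumes "finite x" "x \<subseteq> cells d l"
  shows "closed_near p r (boundary_sum x)"
  unfolding closed_near_def
  using boundary_sum_closed[OF assms] even_coboundary_chain_of[OF finite_boundary_sum[OF assms(1)]] by blast

text \<open>
  The product of the signed generators dual to the cells of \<open>x\<close>, as a single closed membrane. These are the
  involutions whose eigenvalues control the circuit.
\<close>

definition flux :: "species \<Rightarrow> cell set \<Rightarrow> qubit local_op" where
  "flux \<alpha> x = closed_membrane \<alpha> (boundary_sum x)"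

lemma flux_toggle:
  assumes "finite x" "x \<subseteq> cells d l" "s \<in> cells d l"
  shows "closed_membrane \<alpha> (coboundary_set (dual s)) * flux \<alpha> x = flux \<alpha> (x \<triangle> {s})"
  unfolding flux_def boundary_sum_toggle[OF assms(1,3)]
  by (rule closed_membrane_mult[OF dual_l[OF assms(3)] finite_boundary_sum[OF assms(1)]
        boundary_sum_cells boundary_sum_closed_near[OF assms(1,2)]])

lemma flux_mult:
  assumes "finite x" "x \<subseteq> cells d l" "finite y" "y \<subseteq> cells d l"
  shows "flux \<alpha> x * flux \<alpha> y = flux \<alpha> (x \<triangle> y)"
  using assms(1,2)
proof (induction x rule: finite_induct)
  case empty
  then show ?case by (simp add: flux_def)
next
  case (insert s x)
  have eq: "insert s x = x \<triangle> {s}" "(x \<triangle> y) \<triangle> {s} = insert s x \<triangle> y" using insert.hyps by auto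
  have "flux \<alpha> (insert s x) * flux \<alpha> y = closed_membrane \<alpha> (coboundary_set (dual s)) * flux \<alpha> x * flux \<alpha> y"
    unfolding eq(1) using insert by (subst flux_toggle) auto
  also have "\<dots> = closed_membrane \<alpha> (coboundary_set (dual s)) * flux \<alpha> (x \<triangle> y)"
    using insert by (simp add: mult.assoc)
  also have "\<dots> = flux \<alpha> ((x \<triangle> y) \<triangle> {s})"
    by (rule flux_toggle) (use insert assms in auto)
  finally show ?case unfolding eq(2) .
qed

lemma closed_membrane_unitary: "finite n \<Longrightarrow> n \<subseteq> cells d l \<Longrightarrow> unitary_op (closed_membrane \<alpha> n)"
  unfolding closed_membrane_def by (rule unitary_scale) (simp_all add: membrane_unitary)

lemma flux_adjoint:
  assumes "finite x" "x \<subseteq> cells d l"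
  shows "adjoint_op (flux \<alpha> x) = flux \<alpha> x"
proof -
  have "unitary_op (flux \<alpha> x)"
    unfolding flux_def by (rule closed_membrane_unitary[OF finite_boundary_sum[OF assms(1)] boundary_sum_cells])
  moreover have "flux \<alpha> x * flux \<alpha> x = 1" using flux_mult[OF assms assms] by (simp add: flux_def)
  ultimately show ?thesis by (metis mult.assoc mult.left_neutral mult.right_neutral unitary_opD(2))
qed

lemma flux_local:
  "finite x \<Longrightarrow> flux \<alpha> x \<in> local_ops (cell_qubit_set \<alpha> (boundary_sum x \<union> tail (boundary_sum x)))"
  unfolding flux_def closed_membrane_def
  using membrane_local[OF finite_boundary_sum boundary_sum_cells] by (auto intro: local_ops_scale)

text \<open>
  The relations that force the eigenvalue configurations to be closed.
\<close>

lemma flux_faces: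
  assumes "t \<in> cells d (Suc l)"
  shows "flux \<alpha> (faces t) = 1"
proof -
  have "even (card {s \<in> faces t. x \<in> coboundary_set (dual s)})" if "x \<in> cells d l" for x
    using faces_dual[of t "l - 1" x l] assms that degrees by simp
  then have "boundary_sum (faces t) = {}" unfolding boundary_sum_def by blast
  then show ?thesis by (simp add: flux_def)
qed

sublocale B: involutions "flux SpB" "cells d l"
  by unfold_locales (simp_all add: flux_mult flux_adjoint flux_def[of _ "{}"])

lemma Z_op_eq: "Z_op \<alpha> s = pauli {} {Cell_Qubit \<alpha> s}"
  by (simp add: Z_op_def pauli_Z_eq)

lemma X_op_eq: "X_op \<alpha> s = pauli {Cell_Qubit \<alpha> s} {}"
  by (simp add: X_op_def pauli_X_eq)

lemma Z_membrane:
  assumes "finite n" "n \<subseteq> cells d l"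
  shows "Z_op \<alpha> s * membrane \<alpha> n = scale (sgn1 (card ({s} \<inter> n))) (membrane \<alpha> n * Z_op \<alpha> s)"
proof -
  have "card ({Cell_Qubit \<alpha> s} \<inter> cell_qubit_set \<alpha> n) = card ({s} \<inter> n)"
    using card_cell_qubit_set_Int[of \<alpha> "{s}" n] by simp
  then show ?thesis
    unfolding Z_op_eq membrane_def by (subst pauli_commute) (use assms finite_tail in simp_all)
qed

lemma Z_flux:
  assumes x: "finite x" "x \<subseteq> cells d l" and s: "s \<in> cells d l"
  shows "Z_op \<alpha> s * flux \<alpha> x = scale (sgn1 (card (x \<inter> coboundary_set (dual_inverse s)))) (flux \<alpha> x * Z_op \<alpha> s)"
proof -
  have "s \<in> coboundary_set (dual s') \<longleftrightarrow> s' \<in> coboundary_set (dual_inverse s)" if "s' \<in> cells d l" for s'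
    using dual_inverse_coboundary[of "dual s'" "l - 1" s] dual_l[OF that] s degrees(2)
      dual_inverse_dual[OF that] by simp
  then have "{s' \<in> x. s \<in> coboundary_set (dual s')} = x \<inter> coboundary_set (dual_inverse s)"
    using x by auto
  then have "s \<in> boundary_sum x \<longleftrightarrow> odd (card (x \<inter> coboundary_set (dual_inverse s)))"
    using s by (simp add: boundary_sum_def)
  then have "sgn1 (card ({s} \<inter> boundary_sum x)) = sgn1 (card (x \<inter> coboundary_set (dual_inverse s)))"
    by (intro sgn1_cong) auto
  then show ?thesis
    unfolding flux_def closed_membrane_def
    using Z_membrane[OF finite_boundary_sum[OF x(1)] boundary_sum_cells, of \<alpha> s] by (simp add: mult.commute)
qed

definition hopping :: "species \<Rightarrow> cell \<Rightarrow> qubit local_op" where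
  "hopping \<alpha> s = pauli {Cell_Qubit \<alpha> s} (cell_qubit_set \<alpha> {t \<in> cells d l. odd (cup1_form t s)})"

lemma finite_hopping_tail:
  assumes "s \<in> cells d l"
  shows "finite {t \<in> cells d l. odd (cup1_form t s)}"
proof (rule finite_subset[OF _ finite_nbhd[of 1 s]])
  show "{t \<in> cells d l. odd (cup1_form t s)} \<subseteq> nbhd 1 s"
    using cup1_form_nbhd[of _ s] nbhd_sym assms by (metis (no_types, lifting) even_zero mem_Collect_eq subsetI)
qed

text \<open>
  The \<open>Z\<close>-part of a hopping operator is given by the transpose of the matrix for membranes, so
  each commutation sign occurs twice.
\<close>

lemma hopping_membrane:
  assumes s: "s \<in> cells d l" and n: "finite n" "n \<subseteq> cells d l"
  shows "hopping \<alpha> s * membrane \<alpha> n = membrane \<alpha> n * hopping \<alpha> s"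
proof -
  let ?A = "{t \<in> cells d l. odd (cup1_form t s)}"
  have "?A \<inter> n = {t \<in> n. odd (cup1_form t s)}" using n by auto
  moreover have "card (tail n \<inter> {s}) = of_bool (odd (\<Sum>t\<in>n. cup1_form t s))"
    using s by (cases "s \<in> tail n") (auto simp: tail_def)
  ultimately have "even (card (?A \<inter> n) + card (tail n \<inter> {s}))"
    using n by (simp add: even_sum_iff)
  moreover have "card (cell_qubit_set \<alpha> ?A \<inter> cell_qubit_set \<alpha> n) = card (?A \<inter> n)"
    "card (cell_qubit_set \<alpha> (tail n) \<inter> {Cell_Qubit \<alpha> s}) = card (tail n \<inter> {s})"
    using card_cell_qubit_set_Int[of \<alpha> ?A n] card_cell_qubit_set_Int[of \<alpha> "tail n" "{s}"] by simp_all
  ultimately have sign: "sgn1 (card (cell_qubit_set \<alpha> ?A \<inter> cell_qubit_set \<alpha> n) +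
      card (cell_qubit_set \<alpha> (tail n) \<inter> {Cell_Qubit \<alpha> s})) = 1"
    by simp
  show ?thesis
    unfolding hopping_def membrane_def
    by (subst pauli_commute) (use s n finite_tail finite_hopping_tail sign in simp_all)
qed

lemma hopping_flux:
  assumes "s \<in> cells d l" "finite x"
  shows "hopping \<alpha> s * flux \<alpha> x = flux \<alpha> x * hopping \<alpha> s"
  unfolding flux_def closed_membrane_def
  using hopping_membrane[OF assms(1) finite_boundary_sum[OF assms(2)] boundary_sum_cells] by simp

lemma Z_op_local: "Z_op \<alpha> s \<in> local_ops (cell_qubit_set \<alpha> UNIV)"
  unfolding Z_op_eq by (rule pauli_subset_local) auto

lemma hopping_species: "s \<in> cells d l \<Longrightarrow> hopping \<alpha> s \<in> local_ops (cell_qubit_set \<alpha> UNIV)"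
  unfolding hopping_def by (rule pauli_subset_local) (auto simp: finite_hopping_tail)

lemma membrane_species: "finite n \<Longrightarrow> n \<subseteq> cells d l \<Longrightarrow> membrane \<alpha> n \<in> local_ops (cell_qubit_set \<alpha> UNIV)"
  by (rule local_ops_mono[OF membrane_local]) auto

lemma flux_species: "finite x \<Longrightarrow> flux \<alpha> x \<in> local_ops (cell_qubit_set \<alpha> UNIV)"
  by (rule local_ops_mono[OF flux_local]) auto

lemma species_commute:
  assumes "a \<in> local_ops (cell_qubit_set \<alpha> UNIV)" "b \<in> local_ops (cell_qubit_set \<beta> UNIV)" "\<alpha> \<noteq> \<beta>"
  shows "a * b = b * a"
  by (rule local_ops_commute[OF assms(1,2)]) (use assms(3) in auto)

end

section \<open>The circuit\<close>

lemma pairing_cong_lookup: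
  assumes "\<And>k. k \<in> keys x \<union> keys y \<Longrightarrow> f k \<noteq> 0 \<Longrightarrow> lookup x k = lookup y k"
  shows "pairing f x = pairing f y"
proof -
  have "pairing f (x - y) = 0"
    unfolding pairing_eq_sum
  proof (intro sum.neutral ballI)
    fix k assume "k \<in> keys (x - y)"
    then have "k \<in> keys x \<union> keys y" by (rule subsetD[OF keys_diff])
    then show "lookup (x - y) k * f k = 0" using assms[of k] by (auto simp: lookup_minus)
  qed
  then show ?thesis by (simp add: pairing_diff)
qed

context odd_lattice
begin

text \<open>The share of the cell \<open>s \<in> n\<close> in \<open>square n\<close>; it only depends on \<open>n\<close> near \<open>s\<close>.\<close>

definition energy :: "cell \<Rightarrow> cell set \<Rightarrow> int" where
  "energy s n = (\<Sum>t\<in>n. cup1_form s t) + 2 * pairing (cup2_form s) (half (coboundary (chain_of n)))"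

lemma sum_energy: "(\<Sum>s\<in>n. energy s n) = square n"
  by (simp add: energy_def square_def bilinear_def pairing_chain_of sum.distrib sum_distrib_left)

lemma cup1_sum_nbhd:
  assumes "s \<in> cells d l" "finite n" "n \<subseteq> cells d l"
  shows "(\<Sum>t\<in>n. cup1_form s t) = (\<Sum>t\<in>n \<inter> nbhd 1 s. cup1_form s t)"
proof (rule sum.mono_neutral_right)
  show "\<forall>t\<in>n - n \<inter> nbhd 1 s. cup1_form s t = 0"
    using cup1_form_nbhd[OF assms(1)] assms(3) by blast
qed (use assms in auto)

lemma energy_cong:
  assumes s: "s \<in> cells d l" and n: "finite n" "n \<subseteq> cells d l" "finite n'" "n' \<subseteq> cells d l"
    and eq: "n \<inter> nbhd 2 s = n' \<inter> nbhd 2 s"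
  shows "energy s n = energy s n'"
proof -
  have "nbhd 1 s \<subseteq> nbhd 2 s" by (rule nbhd_mono) simp
  then have "n \<inter> nbhd 1 s = n' \<inter> nbhd 1 s" using eq by blast
  then have "(\<Sum>t\<in>n. cup1_form s t) = (\<Sum>t\<in>n'. cup1_form s t)"
    using cup1_sum_nbhd[OF s n(1,2)] cup1_sum_nbhd[OF s n(3,4)] by simp
  moreover have "pairing (cup2_form s) (half (coboundary (chain_of n))) =
      pairing (cup2_form s) (half (coboundary (chain_of n')))"
  proof (rule pairing_cong_lookup)
    fix t assume t: "t \<in> keys (half (coboundary (chain_of n))) \<union> keys (half (coboundary (chain_of n')))"
      and nz: "cup2_form s t \<noteq> 0"
    have "keys (coboundary (chain_of n)) \<subseteq> cells d (Suc l)" "keys (coboundary (chain_of n')) \<subseteq> cells d (Suc l)"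
      using n by (auto intro!: keys_coboundary_cells simp: keys_chain_of)
    then have "t \<in> cells d (Suc l)"
      using t keys_half[of "coboundary (chain_of n)"] keys_half[of "coboundary (chain_of n')"] by blast
    then have st: "near_cells 1 s t"
      by (intro cup2_form_near[OF _ _ nz]) (use cellsD[OF s] cellsD[of t d "Suc l"] in auto)
    have restrict: "lookup (coboundary (chain_of m)) t = (\<Sum>u\<in>m \<inter> nbhd 2 s. lookup (coboundary_cell u) t)"
      if m: "finite m" "m \<subseteq> cells d l" for m
      unfolding lookup_coboundary_chain_of[OF m(1)]
    proof (rule sum.mono_neutral_right)
      show "\<forall>u\<in>m - m \<inter> nbhd 2 s. lookup (coboundary_cell u) t = 0"
      proof (rule ballI, rule ccontr)
        fix u assume u: "u \<in> m - m \<inter> nbhd 2 s" and "lookup (coboundary_cell u) t \<noteq> 0"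
        then have "near_cells 1 u t" using coboundary_cell_near[of t u] by (simp add: in_keys_iff)
        then have "near_cells (1 + 1) s u" using near_cells_trans[OF st near_cells_sym] by blast
        then have "u \<in> nbhd 2 s" using u m unfolding one_add_one nbhd_def by blast
        then show False using u by blast
      qed
    qed (use m in auto)
    show "lookup (half (coboundary (chain_of n))) t = lookup (half (coboundary (chain_of n'))) t"
      using restrict[OF n(1,2)] restrict[OF n(3,4)] eq by simp
  qed
  ultimately show ?thesis by (simp add: energy_def)
qed

end

locale coloured_lattice = odd_lattice +
  fixes col :: "cell \<Rightarrow> nat" and K :: nat
  assumes col_less: "s \<in> cells d l \<Longrightarrow> col s < K"
    and col_far: "s \<in> cells d l \<Longrightarrow> t \<in> cells d l \<Longrightarrow> s \<noteq> t \<Longrightarrow> col s = col t \<Longrightarrow> \<not> near_cells 10 s t"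
begin

text \<open>
  Multiplying the single-cell membranes in the order of the colours produces the sign of all pairs in
  that order; \<open>order\<close> compensates for it.
\<close>

definition order :: "cell \<Rightarrow> cell set \<Rightarrow> int" where
  "order s n = (\<Sum>t | t \<in> n \<and> col t < col s. cup1_form s t)"

definition branch :: "cell \<Rightarrow> cell set \<Rightarrow> qubit local_op" where
  "branch s n = (if s \<in> n then scale (ipow (energy s n + 2 * order s n)) (membrane SpA {s}) else 1)"

text \<open>
  If the generator dual to \<open>s\<close> has eigenvalue \<open>-1\<close>, the gate applies the membrane of \<open>s\<close> with a phase read off
  from the configuration near \<open>s\<close>.
\<close>

definition gate :: "cell \<Rightarrow> qubit local_op" where
  "gate s = B.controlled (nbhd 2 s) (branch s)"

text \<open>
  Starting from \<open>s\<close>, the controls reach two steps, the coboundaries of their duals two more,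
  and the \<open>Z\<close>-parts of the membranes a fifth one.
\<close>

definition gate_block :: "cell \<Rightarrow> qubit set" where
  "gate_block s = {Cell_Qubit \<alpha> t | \<alpha> t. t \<in> nbhd 5 s}"

lemma cup1_same_colour:
  assumes "s \<in> cells d l" "t \<in> cells d l" "s \<noteq> t" "col s = col t"
  shows "cup1_form s t = 0"
proof (rule ccontr)
  assume "cup1_form s t \<noteq> 0"
  then have "near_cells 1 s t" using cup1_form_nbhd assms by (simp add: nbhd_def)
  then have "near_cells 10 s t" by (rule near_cells_mono) simp
  then show False using col_far assms by blast
qed

lemma branch_restrict:
  assumes s: "s \<in> cells d l" and n: "finite n" "n \<subseteq> cells d l"
  shows "branch s (n \<inter> nbhd 2 s) = branch s n"
proof -
  have "energy s (n \<inter> nbhd 2 s) = energy s n" by (rule energy_cong[OF s]) (use n in auto)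
  moreover have "order s (n \<inter> nbhd 2 s) = order s n"
    unfolding order_def
  proof (rule sum.mono_neutral_left)
    have "nbhd 1 s \<subseteq> nbhd 2 s" by (rule nbhd_mono) simp
    then show "\<forall>t\<in>{t. t \<in> n \<and> col t < col s} - {t. t \<in> n \<inter> nbhd 2 s \<and> col t < col s}. cup1_form s t = 0"
      using cup1_form_nbhd[OF s] n by blast
  qed (use n in auto)
  ultimately show ?thesis using nbhd_self[OF s] by (simp add: branch_def)
qed

lemma branch_species: "s \<in> cells d l \<Longrightarrow> branch s n \<in> local_ops (cell_qubit_set SpA UNIV)"
  unfolding branch_def by (auto intro: membrane_species)

lemma branch_flux:
  "s \<in> cells d l \<Longrightarrow> finite x \<Longrightarrow> branch s n * flux SpB x = flux SpB x * branch s n"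
  by (rule species_commute[OF branch_species flux_species]) auto

lemma branch_unitary: "s \<in> cells d l \<Longrightarrow> unitary_op (branch s n)"
  unfolding branch_def by (simp add: unitary_scale membrane_unitary)

lemma finite_sub_nbhd: "x \<subseteq> nbhd R s \<Longrightarrow> finite x"
  using finite_nbhd finite_subset by blast

lemma gate_unitary:
  assumes "s \<in> cells d l"
  shows "unitary_op (gate s)"
  unfolding gate_def
  by (rule B.controlled_unitary[OF finite_nbhd nbhd_cells])
    (use assms branch_flux branch_unitary finite_sub_nbhd in auto)

lemma gate_local:
  assumes s: "s \<in> cells d l"
  shows "gate s \<in> local_ops (gate_block s)"
  unfolding gate_def B.controlled_def
proof (rule local_ops_sum, rule local_ops_mult)
  fix y
  show "B.proj (nbhd 2 s) y \<in> local_ops (gate_block s)"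
  proof (rule B.proj_local)
    fix x assume x: "x \<subseteq> nbhd 2 s"
    have b: "boundary_sum x \<subseteq> nbhd 4 s"
    proof
      fix t assume t: "t \<in> boundary_sum x"
      then obtain u where u: "u \<in> x" "t \<in> coboundary_set (dual u)" using boundary_sum_sub by blast
      have "near_cells 1 u (dual u)" by (simp add: near_cells_def dual_def translate_def)
      then have "near_cells (1 + 1) u t" using coboundary_set_near[OF u(2)] near_cells_trans by blast
      moreover have "near_cells 2 s u" using u(1) x by (auto simp: nbhd_def)
      ultimately have "near_cells (2 + (1 + 1)) s t" using near_cells_trans by blast
      then have "near_cells 4 s t" by (rule near_cells_mono) simp
      then show "t \<in> nbhd 4 s" using t boundary_sum_cells by (auto simp: nbhd_def)
    qed
    have "tail (boundary_sum x) \<subseteq> nbhd 5 s"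
    proof
      fix t assume "t \<in> tail (boundary_sum x)"
      then obtain u where "u \<in> boundary_sum x" "t \<in> nbhd 1 u" using tail_nbhd[OF boundary_sum_cells] by blast
      then show "t \<in> nbhd 5 s" using b nbhd_trans[of u 4 s t 1 5] by auto
    qed
    moreover have "nbhd 4 s \<subseteq> nbhd 5 s" by (rule nbhd_mono) simp
    ultimately have "cell_qubit_set SpB (boundary_sum x \<union> tail (boundary_sum x)) \<subseteq> gate_block s"
      using b by (auto simp: gate_block_def)
    then show "flux SpB x \<in> local_ops (gate_block s)"
      by (rule local_ops_mono[OF flux_local[OF finite_sub_nbhd[OF x]]])
  qed
  have "tail {s} \<subseteq> nbhd 1 s" using tail_nbhd[of "{s}"] s by auto
  moreover have "nbhd 1 s \<subseteq> nbhd 5 s" by (rule nbhd_mono) simp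
  ultimately have "cell_qubit_set SpA ({s} \<union> tail {s}) \<subseteq> gate_block s"
    unfolding gate_block_def using nbhd_self[OF s, of 5] by blast
  then have "membrane SpA {s} \<in> local_ops (gate_block s)"
    by (intro local_ops_mono[OF membrane_local]) (use s in auto)
  then show "branch s y \<in> local_ops (gate_block s)" by (auto simp: branch_def)
qed

sublocale G: coloured_gates "cell_qubits d l" "cells d l" gate gate_block 10 col K
proof unfold_locales
  fix s assume s: "s \<in> cells d l"
  show "gate_block s \<subseteq> cell_qubits d l"
    unfolding gate_block_def cell_qubits_def using nbhd_cells by blast
  show "gate_block s \<noteq> {}" unfolding gate_block_def using nbhd_self[OF s, of 5] by blast
  show "near 10 p q" if p: "p \<in> gate_block s" and q: "q \<in> gate_block s" for p q
  proof -
    obtain \<alpha> t \<beta> u where pq: "p = Cell_Qubit \<alpha> t" "q = Cell_Qubit \<beta> u" "t \<in> nbhd 5 s" "u \<in> nbhd 5 s"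
      using p q unfolding gate_block_def by blast
    have "near_cells (5 + 5) t u"
      by (rule near_cells_trans[OF near_cells_sym]) (use pq in \<open>auto simp: nbhd_def\<close>)
    then show ?thesis by (simp add: near_def near_cells_def pq(1,2))
  qed
  show "gate s \<in> local_ops (gate_block s)" by (rule gate_local[OF s])
  show "unitary_op (gate s)" by (rule gate_unitary[OF s])
  show "col s < K" by (rule col_less[OF s])
next
  fix s t assume st: "s \<in> cells d l" "t \<in> cells d l" "s \<noteq> t" "col s = col t"
  show "gate_block s \<inter> gate_block t = {}"
  proof (rule ccontr)
    assume "gate_block s \<inter> gate_block t \<noteq> {}"
    then obtain u where "u \<in> nbhd 5 s" "u \<in> nbhd 5 t" unfolding gate_block_def by blast
    then have "near_cells (5 + 5) s t" by (intro near_cells_trans[OF _ near_cells_sym]) (auto simp: nbhd_def)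
    then show False using col_far[OF st] by simp
  qed
qed

definition total_phase :: "cell set \<Rightarrow> cell set \<Rightarrow> int" where
  "total_phase T n = (\<Sum>s\<in>T \<inter> n. energy s n + 2 * order s n) + 2 * (\<Sum>s\<in>T \<inter> n. order s (T \<inter> n))"

lemma prod_branches:
  assumes "distinct ss" "sorted_wrt (\<lambda>s t. col t \<le> col s) ss" "set ss \<subseteq> cells d l"
    and n: "finite n" "n \<subseteq> cells d l"
  shows "prod_list (map (\<lambda>s. branch s n) ss) =
    scale (ipow (total_phase (set ss) n)) (membrane SpA (set ss \<inter> n))"
  using assms(1-3)
proof (induction ss)
  case Nil
  then show ?case by (simp add: total_phase_def)
next
  case (Cons s ss)
  let ?Y = "set ss \<inter> n"
  have IH: "prod_list (map (\<lambda>s. branch s n) ss) = scale (ipow (total_phase (set ss) n)) (membrane SpA ?Y)"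
    using Cons by simp
  show ?case
  proof (cases "s \<in> n")
    case False
    then have "set (s # ss) \<inter> n = ?Y" by auto
    then have "total_phase (set (s # ss)) n = total_phase (set ss) n" by (simp only: total_phase_def)
    then show ?thesis using False IH \<open>set (s # ss) \<inter> n = ?Y\<close> by (simp add: branch_def)
  next
    case True
    have Y: "finite ?Y" "?Y \<subseteq> cells d l" "s \<notin> ?Y" using Cons.prems by auto
    have eq: "set (s # ss) \<inter> n = insert s ?Y" "{s} \<triangle> ?Y = insert s ?Y" using True Y(3) by auto
    have "membrane SpA {s} * membrane SpA ?Y =
        scale (ipow (2 * (\<Sum>t\<in>?Y. cup1_form s t))) (membrane SpA (insert s ?Y))"
      using membrane_mult[of "{s}" ?Y SpA] Y Cons.prems(3) by (simp add: eq(2))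
    moreover have "total_phase (set (s # ss)) n =
        (energy s n + 2 * order s n) + total_phase (set ss) n + 2 * (\<Sum>t\<in>?Y. cup1_form s t)"
    proof -
      have "order s (insert s ?Y) = (\<Sum>t\<in>?Y. cup1_form s t)"
        unfolding order_def
      proof (rule sum.mono_neutral_left)
        show "\<forall>t\<in>?Y - {t. t \<in> insert s ?Y \<and> col t < col s}. cup1_form s t = 0"
        proof
          fix t assume t: "t \<in> ?Y - {t. t \<in> insert s ?Y \<and> col t < col s}"
          then have "col t = col s" using Cons.prems(2) by auto
          then show "cup1_form s t = 0" using cup1_same_colour[of s t] t Y Cons.prems(3) by auto
        qed
      qed (use Y in auto)
      moreover have "order t (insert s ?Y) = order t ?Y" if "t \<in> ?Y" for t
      proof -
        have "col t \<le> col s" using that Cons.prems(2) by auto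
        then have "{u. u \<in> insert s ?Y \<and> col u < col t} = {u. u \<in> ?Y \<and> col u < col t}" by auto
        then show ?thesis by (simp only: order_def)
      qed
      ultimately show ?thesis
        unfolding total_phase_def eq(1) using Y by (simp add: algebra_simps)
    qed
    ultimately show ?thesis
      unfolding eq(1) using True IH by (simp add: branch_def ipow_add mult_ac)
  qed
qed

text \<open>
  In the bulk of the finite set \<open>T\<close> of gates, the product of the branches behaves like the closed
  membrane operator: the discrepancies sit at the boundary of \<open>T\<close> and are unaffected by a change at \<open>r\<close>.
\<close>

lemma branches_shift:
  assumes r: "r \<in> cells d (l - 1)" and T: "finite T" "T \<subseteq> cells d l" "nbhd 4 r \<subseteq> T"
    and n: "finite n" "n \<subseteq> cells d l" and closed: "closed_near (Suc l) r n"
  shows "scale (ipow (total_phase T (n \<triangle> coboundary_set r))) (membrane SpA (T \<inter> (n \<triangle> coboundary_set r))) =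
    closed_membrane SpA (coboundary_set r) * scale (ipow (total_phase T n)) (membrane SpA (T \<inter> n))"
proof -
  let ?C = "coboundary_set r"
  let ?n' = "n \<triangle> ?C"
  have C: "finite ?C" "?C \<subseteq> cells d l" by (simp_all add: finite_coboundary_set coboundary_set_l[OF r])
  have near_T: "t \<in> T" if "t \<in> cells d l" "near_cells R r t" "R \<le> 4" for t R
    using T(3) near_cells_mono[OF that(2,3)] that(1) unfolding nbhd_def by blast
  have C_near: "near_cells 1 r s" if "s \<in> ?C" for s using coboundary_set_near[OF that] .
  have CT: "?C \<subseteq> T"
  proof
    fix s assume s: "s \<in> ?C"
    show "s \<in> T" by (rule near_T[of s 1]) (use s C C_near in auto)
  qed
  have nbr_T: "t \<in> T" if "s \<in> ?C" "t \<in> nbhd 2 s" for s t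
  proof (rule near_T[of t "1 + 2"])
    show "near_cells (1 + 2) r t" by (rule near_cells_trans[OF C_near[OF that(1)]]) (use that(2) in \<open>simp add: nbhd_def\<close>)
  qed (use that(2) in \<open>auto simp: nbhd_def\<close>)
  have n': "finite ?n'" "?n' \<subseteq> cells d l" using n C by auto
  define X where "X m = (\<Sum>s\<in>T \<inter> m. \<Sum>t | t \<in> m - T \<and> col t < col s. cup1_form s t)" for m
  have outside: "?n' - T = n - T" using CT by auto
  have phase: "ipow (total_phase T m) = ipow (square m - (\<Sum>s\<in>m - T. energy s m) + 2 * X m)"
    if m: "finite m" "m \<subseteq> cells d l" for m
  proof -
    have "order s m = order s (T \<inter> m) + (\<Sum>t | t \<in> m - T \<and> col t < col s. cup1_form s t)" for s
    proof -
      have "{t. t \<in> m \<and> col t < col s} = {t. t \<in> T \<inter> m \<and> col t < col s} \<union> {t. t \<in> m - T \<and> col t < col s}"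
        by auto
      then show ?thesis unfolding order_def using m T by (simp only:) (intro sum.union_disjoint, auto)
    qed
    then have "(\<Sum>s\<in>T \<inter> m. order s m) = (\<Sum>s\<in>T \<inter> m. order s (T \<inter> m)) + X m"
      by (simp add: X_def sum.distrib)
    moreover have "square m = (\<Sum>s\<in>T \<inter> m. energy s m) + (\<Sum>s\<in>m - T. energy s m)"
      unfolding sum_energy[symmetric] using sum.Int_Diff[OF m(1), of "\<lambda>s. energy s m" T] by (simp only: Int_commute)
    ultimately have "total_phase T m = (square m - (\<Sum>s\<in>m - T. energy s m) + 2 * X m) +
        4 * (\<Sum>s\<in>T \<inter> m. order s (T \<inter> m))"
      unfolding total_phase_def sum.distrib by (simp add: sum_distrib_left[symmetric])
    then show ?thesis by (simp only: ipow_add ipow_4 mult_1_right)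
  qed
  have energy: "(\<Sum>s\<in>?n' - T. energy s ?n') = (\<Sum>s\<in>n - T. energy s n)"
    unfolding outside
  proof (rule sum.cong[OF refl])
    fix s assume s: "s \<in> n - T"
    have "?C \<inter> nbhd 2 s = {}"
    proof (rule ccontr)
      assume "?C \<inter> nbhd 2 s \<noteq> {}"
      then obtain t where "t \<in> ?C" "t \<in> nbhd 2 s" by blast
      then show False using nbr_T[of t s] nbhd_sym[of s t 2] s n by auto
    qed
    then show "energy s ?n' = energy s n" by (intro energy_cong) (use s n n' in auto)
  qed
  have X: "X ?n' = X n"
  proof -
    let ?g = "\<lambda>s. \<Sum>t | t \<in> n - T \<and> col t < col s. cup1_form s t"
    have zero: "?g s = 0" if s: "s \<in> ?C" for s
    proof (rule sum.neutral, rule ballI, rule ccontr)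
      fix t assume t: "t \<in> {t. t \<in> n - T \<and> col t < col s}" and nz: "cup1_form s t \<noteq> 0"
      have "t \<in> nbhd 1 s" by (rule cup1_form_nbhd) (use s C t n nz in auto)
      then have "t \<in> nbhd 2 s" using nbhd_mono[of 1 2 s] by auto
      then show False using nbr_T[OF s] t by auto
    qed
    have "T \<inter> ?n' = (T \<inter> n) \<triangle> ?C" using CT by auto
    then have "X ?n' = sum ?g ((T \<inter> n) \<triangle> ?C)" unfolding X_def outside by (simp only:)
    also have "\<dots> = sum ?g (T \<inter> n)"
      using zero by (subst sum_sym_diff) (use T C in \<open>auto intro!: sum.neutral\<close>)
    finally show ?thesis by (simp only: X_def)
  qed
  have inner: "(\<Sum>s\<in>?C. \<Sum>t\<in>T \<inter> n. cup1_form s t) = (\<Sum>s\<in>?C. \<Sum>t\<in>n. cup1_form s t)"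
  proof (rule sum.cong[OF refl])
    fix s assume s: "s \<in> ?C"
    show "(\<Sum>t\<in>T \<inter> n. cup1_form s t) = (\<Sum>t\<in>n. cup1_form s t)"
    proof (rule sum.mono_neutral_left)
      show "\<forall>t\<in>n - T \<inter> n. cup1_form s t = 0"
      proof (rule ballI, rule ccontr)
        fix t assume t: "t \<in> n - T \<inter> n" and nz: "cup1_form s t \<noteq> 0"
        have "t \<in> nbhd 1 s" by (rule cup1_form_nbhd) (use s C t n nz in auto)
        then have "t \<in> nbhd 2 s" using nbhd_mono[of 1 2 s] by auto
        then show False using nbr_T[OF s] t by auto
      qed
    qed (use n in auto)
  qed
  have "T \<inter> ?n' = ?C \<triangle> (T \<inter> n)" using CT by auto
  moreover have "membrane SpA ?C * membrane SpA (T \<inter> n) =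
      scale (ipow (2 * (\<Sum>s\<in>?C. \<Sum>t\<in>n. cup1_form s t))) (membrane SpA (?C \<triangle> (T \<inter> n)))"
    unfolding inner[symmetric] by (rule membrane_mult) (use C T n in auto)
  moreover have "ipow (total_phase T ?n') = ipow (square ?C) * (ipow (2 * (\<Sum>s\<in>?C. \<Sum>t\<in>n. cup1_form s t)) * ipow (total_phase T n))"
  proof -
    have "ipow (total_phase T ?n') = ipow (square ?n') * ipow (- (\<Sum>s\<in>n - T. energy s n) + 2 * X n)"
      unfolding phase[OF n'] energy X ipow_add[symmetric] by (simp add: algebra_simps)
    moreover have "ipow (total_phase T n) = ipow (square n) * ipow (- (\<Sum>s\<in>n - T. energy s n) + 2 * X n)"
      unfolding phase[OF n] ipow_add[symmetric] by (simp add: algebra_simps)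
    ultimately show ?thesis unfolding square_coboundary[OF r n closed] by (simp only: mult_ac)
  qed
  ultimately show ?thesis by (simp add: closed_membrane_def mult_ac)
qed

definition region :: "cell set \<Rightarrow> cell set" where
  "region T = (\<Union>s\<in>T. nbhd 2 s)"

lemma region:
  assumes "finite T" "T \<subseteq> cells d l"
  shows "finite (region T)" "region T \<subseteq> cells d l" "T \<subseteq> region T"
proof -
  show "finite (region T)" unfolding region_def by (rule finite_UN_I[OF assms(1) finite_nbhd])
  show "region T \<subseteq> cells d l" unfolding region_def using nbhd_cells by blast
  show "T \<subseteq> region T" unfolding region_def using nbhd_self assms(2) by blast
qed

lemma prod_gates:
  assumes ss: "distinct ss" "sorted_wrt (\<lambda>s t. col t \<le> col s) ss" "set ss \<subseteq> cells d l"
  shows "prod_list (map gate ss) = B.controlled (region (set ss))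
    (\<lambda>n. scale (ipow (total_phase (set ss) n)) (membrane SpA (set ss \<inter> n)))"
proof -
  let ?R = "region (set ss)"
  have R: "finite ?R" "?R \<subseteq> cells d l" using region[of "set ss"] ss(3) by auto
  have "prod_list (map gate ss) = prod_list (map (\<lambda>s. B.controlled ?R (\<lambda>n. branch s (n \<inter> nbhd 2 s))) ss)"
  proof (rule arg_cong[where f = prod_list], rule map_cong[OF refl])
    fix s assume "s \<in> set ss"
    then have "nbhd 2 s \<subseteq> ?R" by (auto simp: region_def)
    then show "gate s = B.controlled ?R (\<lambda>n. branch s (n \<inter> nbhd 2 s))"
      unfolding gate_def by (rule B.controlled_extend[OF R])
  qed
  also have "\<dots> = B.controlled ?R (\<lambda>n. prod_list (map (\<lambda>s. branch s (n \<inter> nbhd 2 s)) ss))"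
  proof (rule B.controlled_prod_list[OF R])
    fix s x y assume "s \<in> set ss" "x \<subseteq> ?R"
    then show "branch s (y \<inter> nbhd 2 s) * flux SpB x = flux SpB x * branch s (y \<inter> nbhd 2 s)"
      using ss(3) R(1) finite_subset by (intro branch_flux) auto
  qed
  also have "\<dots> = B.controlled ?R (\<lambda>n. scale (ipow (total_phase (set ss) n)) (membrane SpA (set ss \<inter> n)))"
  proof (rule B.controlled_cong)
    fix n assume "n \<subseteq> ?R"
    then have n: "finite n" "n \<subseteq> cells d l" using R finite_subset by auto
    have "map (\<lambda>s. branch s (n \<inter> nbhd 2 s)) ss = map (\<lambda>s. branch s n) ss"
      using branch_restrict[OF _ n] ss(3) by auto
    then show "prod_list (map (\<lambda>s. branch s (n \<inter> nbhd 2 s)) ss) =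
        scale (ipow (total_phase (set ss) n)) (membrane SpA (set ss \<inter> n))"
      using prod_branches[OF ss n] by (simp only:)
  qed
  finally show ?thesis .
qed

end

section \<open>Images of the generators\<close>

lemma Cell_Qubit_mem: "Cell_Qubit \<alpha> s \<in> cell_qubits d l \<longleftrightarrow> s \<in> cells d l"
  unfolding cell_qubits_def by blast

context coloured_lattice
begin

text \<open>
  Near \<open>r\<close> all relations among the controls are visible within \<open>R\<close>.
\<close>

lemma closed_of_proj:
  assumes R: "finite R" "R \<subseteq> cells d l" "nbhd 4 r \<subseteq> R" and n: "n \<subseteq> R" and nz: "B.proj R n \<noteq> 0"
  shows "closed_near (Suc l) r n"
  unfolding closed_near_def
proof (intro ballI impI)
  fix t assume t: "t \<in> cells d (Suc l)" "near_cells 2 r t"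
  have card_t: "card (snd t) - 1 = l" using cellsD[OF t(1)] by simp
  have fin: "finite n" by (rule finite_subset[OF n R(1)])
  have "faces t \<subseteq> R"
  proof
    fix s assume s: "s \<in> faces t"
    then have "near_cells (2 + 1) r s" using near_cells_trans[OF t(2) faces_near] by blast
    then have "near_cells 4 r s" by (rule near_cells_mono) simp
    then have "s \<in> nbhd 4 r" using s card_t by (simp add: nbhd_def faces_def)
    then show "s \<in> R" using R(3) by blast
  qed
  then have "even (card (faces t \<inter> n))"
    using B.proj_eq_0[OF R(1,2), of "faces t" n] flux_faces[OF t(1)] nz by blast
  moreover have "faces t \<inter> n = {s \<in> n. t \<in> coboundary_set s}"
    using n R(2) unfolding faces_def card_t by blast
  ultimately show "even (lookup (coboundary (chain_of n)) t)"
    using even_coboundary_chain_of[OF fin] by simp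
qed

text \<open>
  A product of all gates near \<open>s\<close> is already sufficient to determine the images of the generators at \<open>s\<close>.
\<close>

lemma gates_on_generators:
  assumes ss: "distinct ss" "sorted_wrt (\<lambda>s t. col t \<le> col s) ss" "set ss \<subseteq> cells d l"
    and s: "s \<in> set ss" "nbhd 4 (dual_inverse s) \<subseteq> set ss"
  shows "conjugate (prod_list (map gate ss)) (Z_op SpA s) =
      Z_op SpA s * closed_membrane SpB (coboundary_set (dual s))"
    and "conjugate (prod_list (map gate ss)) (Z_op SpB s) =
      Z_op SpB s * closed_membrane SpA (coboundary_set (dual_inverse s))"
    and "conjugate (prod_list (map gate ss)) (hopping \<alpha> s) = hopping \<alpha> s"
proof -
  let ?T = "set ss"
  let ?R = "region ?T" and ?r = "dual_inverse s"
  let ?A = "\<lambda>n. scale (ipow (total_phase ?T n)) (membrane SpA (?T \<inter> n))"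
  let ?W = "prod_list (map gate ss)"
  have W: "?W = B.controlled ?R ?A" by (rule prod_gates[OF ss])
  have R: "finite ?R" "?R \<subseteq> cells d l" "?T \<subseteq> ?R" using region[of ?T] ss(3) by auto
  have s_cell: "s \<in> cells d l" using s(1) ss(3) by auto
  have r: "?r \<in> cells d (l - 1)" by (rule dual_inverse_l[OF s_cell])
  have T: "finite (?T \<inter> n)" "?T \<inter> n \<subseteq> cells d l" for n using ss(3) by auto
  have fin: "finite x" if "x \<subseteq> ?R" for x using that R(1) finite_subset by blast
  have unitary: "unitary_op ?W"
    by (rule unitary_prod_list) (use ss(3) gate_unitary in auto)
  have A_species: "?A n \<in> local_ops (cell_qubit_set SpA UNIV)" for n
    by (rule local_ops_scale[OF membrane_species[OF T]])
  have C: "finite (coboundary_set ?r)" "coboundary_set ?r \<subseteq> cells d l"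
    by (simp_all add: finite_coboundary_set coboundary_set_l[OF r])
  have b_species: "closed_membrane SpA (coboundary_set ?r) \<in> local_ops (cell_qubit_set SpA UNIV)"
    unfolding closed_membrane_def by (rule local_ops_scale[OF membrane_species[OF C]])
  have "?W * Z_op SpA s = Z_op SpA s * flux SpB {s} * ?W"
    unfolding W
  proof (rule B.controlled_sign[OF R(1,2)])
    show "s \<in> ?R" using s(1) R(3) by blast
    show "Z_op SpA s * flux SpB x = flux SpB x * Z_op SpA s" if "x \<subseteq> ?R" for x
      by (rule species_commute[OF Z_op_local flux_species[OF fin[OF that]]]) simp
    fix n
    have "{s} \<inter> (?T \<inter> n) = {s} \<inter> n" using s(1) by auto
    then have "Z_op SpA s * membrane SpA (?T \<inter> n) =
        scale (sgn1 (card ({s} \<inter> n))) (membrane SpA (?T \<inter> n) * Z_op SpA s)"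
      using Z_membrane[OF T, of SpA s n] by simp
    then show "?A n * Z_op SpA s = scale (sgn1 (card ({s} \<inter> n))) (Z_op SpA s * ?A n)"
      by (simp add: mult.left_commute)
  qed
  then show "conjugate ?W (Z_op SpA s) = Z_op SpA s * closed_membrane SpB (coboundary_set (dual s))"
    unfolding flux_def boundary_sum_single[OF s_cell] by (rule conjugate_eqI[OF unitary])
  have "?W * Z_op SpB s = closed_membrane SpA (coboundary_set ?r) * Z_op SpB s * ?W"
    unfolding W
  proof (rule B.controlled_flip[OF R(1,2)])
    show "coboundary_set ?r \<subseteq> ?R"
    proof
      fix t assume t: "t \<in> coboundary_set ?r"
      then have "near_cells 4 ?r t" using near_cells_mono[OF coboundary_set_near[OF t], of 4] by simp
      then have "t \<in> nbhd 4 ?r" using t C(2) by (auto simp: nbhd_def)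
      then show "t \<in> ?R" using s(2) R(3) by blast
    qed
    show "Z_op SpB s * flux SpB x = scale (sgn1 (card (x \<inter> coboundary_set ?r))) (flux SpB x * Z_op SpB s)"
      if "x \<subseteq> ?R" for x
      by (rule Z_flux[OF fin[OF that] _ s_cell]) (use that R(2) in blast)
    show "?A n * Z_op SpB s = Z_op SpB s * ?A n" for n
      by (rule species_commute[OF A_species Z_op_local]) simp
    show "closed_membrane SpA (coboundary_set ?r) * flux SpB x = flux SpB x * closed_membrane SpA (coboundary_set ?r)"
      if "x \<subseteq> ?R" for x
      by (rule species_commute[OF b_species flux_species[OF fin[OF that]]]) simp
    fix n assume n: "n \<subseteq> ?R" and nz: "B.proj ?R n \<noteq> 0"
    have closed: "closed_near (Suc l) ?r n"
      by (rule closed_of_proj[OF R(1,2) _ n nz]) (use s(2) R(3) in blast)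
    show "?A (n \<triangle> coboundary_set ?r) = closed_membrane SpA (coboundary_set ?r) * ?A n"
      by (rule branches_shift[OF r _ ss(3) s(2) fin[OF n] _ closed]) (use n R(2) in auto)
  qed
  also have "closed_membrane SpA (coboundary_set ?r) * Z_op SpB s = Z_op SpB s * closed_membrane SpA (coboundary_set ?r)"
    by (rule species_commute[OF b_species Z_op_local]) simp
  finally show "conjugate ?W (Z_op SpB s) = Z_op SpB s * closed_membrane SpA (coboundary_set ?r)"
    by (rule conjugate_eqI[OF unitary])
  have "?W * hopping \<alpha> s = hopping \<alpha> s * ?W"
    unfolding W
  proof (rule B.controlled_commute)
    note commute_A = species_commute[OF A_species hopping_species[OF s_cell]]
    note commute_B = species_commute[OF hopping_species[OF s_cell] flux_species]
    show "hopping \<alpha> s * flux SpB x = flux SpB x * hopping \<alpha> s" if "x \<subseteq> ?R" for x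
    proof (cases \<alpha>)
      case SpA
      show ?thesis unfolding SpA by (rule commute_B[OF fin[OF that]]) simp
    next
      case SpB
      show ?thesis unfolding SpB by (rule hopping_flux[OF s_cell fin[OF that]])
    qed
    show "?A n * hopping \<alpha> s = hopping \<alpha> s * ?A n" for n
    proof (cases \<alpha>)
      case SpA
      show ?thesis unfolding SpA using hopping_membrane[OF s_cell T, of SpA n] by simp
    next
      case SpB
      show ?thesis unfolding SpB by (rule commute_A) simp
    qed
  qed
  then show "conjugate ?W (hopping \<alpha> s) = hopping \<alpha> s" by (rule conjugate_eqI[OF unitary])
qed

lemma colour_sorted_list:
  assumes "finite T" "T \<subseteq> cells d l"
  obtains ss where "distinct ss" "sorted_wrt (\<lambda>s t. col t \<le> col s) ss" "set ss = T"
proof -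
  obtain xs where xs: "distinct xs" "set xs = T" using finite_distinct_list[OF assms(1)] by blast
  let ?ss = "sort_key (\<lambda>s. K - col s) xs"
  have "sorted_wrt (\<lambda>s t. K - col s \<le> K - col t) ?ss"
    using sorted_sort_key[of "\<lambda>s. K - col s" xs] by (simp only: sorted_map)
  then have "sorted_wrt (\<lambda>s t. col t \<le> col s) ?ss"
  proof (rule sorted_wrt_mono_rel[rotated])
    fix s t assume "s \<in> set ?ss" "t \<in> set ?ss" "K - col s \<le> K - col t"
    moreover have "s \<in> cells d l" "t \<in> cells d l" using calculation(1,2) xs(2) assms(2) by auto
    then have "col s < K" "col t < K" by (simp_all only: col_less)
    ultimately show "col t \<le> col s" by linarith
  qed
  then show ?thesis using that[of ?ss] xs by simp
qed

lemma Z_op_cell: "s \<in> cells d l \<Longrightarrow> Z_op \<alpha> s \<in> local_ops (cell_qubits d l)"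
  unfolding Z_op_eq by (rule pauli_subset_local) (auto simp: Cell_Qubit_mem)

lemma hopping_cell: "s \<in> cells d l \<Longrightarrow> hopping \<alpha> s \<in> local_ops (cell_qubits d l)"
  unfolding hopping_def by (rule pauli_subset_local) (auto simp: Cell_Qubit_mem finite_hopping_tail)

lemma circuit_bulk:
  assumes a: "a \<in> local_ops (cell_qubits d l)" and s: "s \<in> cells d l"
  obtains ss where "distinct ss" "sorted_wrt (\<lambda>s t. col t \<le> col s) ss" "set ss \<subseteq> cells d l"
    "s \<in> set ss" "nbhd 4 (dual_inverse s) \<subseteq> set ss"
    "G.circuit K a = conjugate (prod_list (map gate ss)) a"
proof -
  obtain T where T: "finite T" "T \<subseteq> {i \<in> cells d l. col i < K}"
    "\<forall>xs. distinct xs \<and> sorted_wrt (\<lambda>i j. col j \<le> col i) xs \<and> T \<subseteq> set xs \<and>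
      set xs \<subseteq> {i \<in> cells d l. col i < K} \<longrightarrow> G.circuit K a = conjugate (prod_list (map gate xs)) a"
    using G.circuit_limit[OF a, of K] by (elim exE conjE) (rule that)
  let ?T = "insert s (T \<union> nbhd 4 (dual_inverse s))"
  have T': "finite ?T" "?T \<subseteq> cells d l" using T(1,2) s finite_nbhd nbhd_cells by auto
  obtain ss where ss: "distinct ss" "sorted_wrt (\<lambda>s t. col t \<le> col s) ss" "set ss = ?T"
    by (rule colour_sorted_list[OF T'])
  have "G.circuit K a = conjugate (prod_list (map gate ss)) a"
    by (rule T(3)[rule_format]) (use ss T' col_less in auto)
  then show ?thesis using that[OF ss(1,2)] ss(3) T' by auto
qed

lemma circuit_generators:
  assumes s: "s \<in> cells d l"
  shows "G.circuit K (Z_op SpA s) = Z_op SpA s * closed_membrane SpB (coboundary_set (dual s))"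
    and "G.circuit K (Z_op SpB s) = Z_op SpB s * closed_membrane SpA (coboundary_set (dual_inverse s))"
    and "G.circuit K (hopping \<alpha> s) = hopping \<alpha> s"
proof -
  show "G.circuit K (Z_op SpA s) = Z_op SpA s * closed_membrane SpB (coboundary_set (dual s))"
    by (rule circuit_bulk[OF Z_op_cell[OF s, of SpA] s]) (simp only: gates_on_generators(1))
  show "G.circuit K (Z_op SpB s) = Z_op SpB s * closed_membrane SpA (coboundary_set (dual_inverse s))"
    by (rule circuit_bulk[OF Z_op_cell[OF s, of SpB] s]) (simp only: gates_on_generators(2))
  show "G.circuit K (hopping \<alpha> s) = hopping \<alpha> s"
    by (rule circuit_bulk[OF hopping_cell[OF s, of \<alpha>] s]) (simp only: gates_on_generators(3))
qed

end

definition phase_eq :: "'q local_op \<Rightarrow> 'q local_op \<Rightarrow> bool" (infix "\<simeq>" 50) where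
  "a \<simeq> b \<longleftrightarrow> (\<exists>c. cmod c = 1 \<and> a = scale c b)"

lemma phase_eq_refl [simp]: "a \<simeq> a"
  unfolding phase_eq_def by (rule exI[of _ 1]) simp

lemma phase_eq_scale: "cmod c = 1 \<Longrightarrow> scale c a \<simeq> a"
  unfolding phase_eq_def by blast

lemma phase_eq_sym:
  assumes "a \<simeq> b"
  shows "b \<simeq> a"
proof -
  obtain c where c: "cmod c = 1" "a = scale c b" using assms unfolding phase_eq_def by blast
  then have "c \<noteq> 0" by auto
  then have "b = scale (inverse c) a" using c(2) by simp
  moreover have "cmod (inverse c) = 1" using c(1) by (simp add: norm_inverse)
  ultimately show ?thesis unfolding phase_eq_def by blast
qed

lemma phase_eq_trans:
  assumes "a \<simeq> b" "b \<simeq> c"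
  shows "a \<simeq> c"
proof -
  obtain x y where "cmod x = 1" "a = scale x b" "cmod y = 1" "b = scale y c"
    using assms unfolding phase_eq_def by blast
  then show ?thesis unfolding phase_eq_def by (intro exI[of _ "x * y"]) (simp add: norm_mult)
qed

lemma phase_eq_mult:
  assumes "a \<simeq> b" "a' \<simeq> b'"
  shows "a * a' \<simeq> b * b'"
proof -
  obtain x y where "cmod x = 1" "a = scale x b" "cmod y = 1" "a' = scale y b'"
    using assms unfolding phase_eq_def by blast
  then show ?thesis unfolding phase_eq_def by (intro exI[of _ "y * x"]) (simp add: norm_mult)
qed

lemma phase_eq_prod_list:
  "(\<And>i. i \<in> set is \<Longrightarrow> f i \<simeq> g i) \<Longrightarrow> prod_list (map f is) \<simeq> prod_list (map g is)"
  by (induction "is") (auto intro: phase_eq_mult)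

context odd_lattice
begin

lemma op_prod_X: "finite S \<Longrightarrow> op_prod (X_op \<alpha>) S = pauli (cell_qubit_set \<alpha> S) {}"
proof -
  have "prod_list (map (X_op \<alpha>) xs) = pauli (cell_qubit_set \<alpha> (set xs)) {}" if "distinct xs" for xs
    using that
  proof (induction xs)
    case (Cons s xs)
    then have "Cell_Qubit \<alpha> s \<notin> cell_qubit_set \<alpha> (set xs)" by auto
    then show ?case using Cons by (simp add: X_op_eq pauli_mult insert_Diff_if)
  qed simp
  then show "finite S \<Longrightarrow> op_prod (X_op \<alpha>) S = pauli (cell_qubit_set \<alpha> S) {}"
    by (metis op_prod_list)
qed

lemma op_prod_Z: "finite S \<Longrightarrow> op_prod (Z_op \<alpha>) S = pauli {} (cell_qubit_set \<alpha> S)"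
proof -
  have "prod_list (map (Z_op \<alpha>) xs) = pauli {} (cell_qubit_set \<alpha> (set xs))" if "distinct xs" for xs
    using that
  proof (induction xs)
    case (Cons s xs)
    then have "Cell_Qubit \<alpha> s \<notin> cell_qubit_set \<alpha> (set xs)" by auto
    then show ?case using Cons by (simp add: Z_op_eq pauli_mult insert_Diff_if)
  qed simp
  then show "finite S \<Longrightarrow> op_prod (Z_op \<alpha>) S = pauli {} (cell_qubit_set \<alpha> S)"
    by (metis op_prod_list)
qed

lemma op_prod_singleton: "op_prod f {i} = f i"
proof -
  obtain xs where "distinct xs" "set xs = {i}" "op_prod f {i} = prod_list (map f xs)"
    by (rule op_prod_list[of "{i}" f]) auto
  moreover from this have "xs = [i]" by (cases xs; cases "tl xs") auto
  ultimately show ?thesis by simp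
qed

lemma d_l: "d = 2 * l - 1" "1 \<le> l"
  using d l by auto

lemma G_op_eq:
  assumes r: "r \<in> cells d (l - 1)"
  shows "G_op d l \<alpha> r = membrane \<alpha> (coboundary_set r)"
proof -
  have C: "finite (coboundary_set r)" "coboundary_set r \<subseteq> cells d l"
    by (simp_all add: finite_coboundary_set coboundary_set_l[OF r])
  have "cobd (ind r) s = 1 \<longleftrightarrow> s \<in> coboundary_set r" if "s \<in> cells d l" for s
    using cobd_ind[of s r] cellsD[OF that] finite_subset[of "snd s" "{1..d}"] by blast
  then have "{s \<in> cells d l. cobd (ind r) s = 1} = coboundary_set r" using C(2) by blast
  moreover have "{t \<in> cells d l. integral_cells d (cup1 l (cobd (ind r)) (ind t)) = 1} = tail (coboundary_set r)"
    unfolding tail_def using integral_cup1_cobd[OF r _ d_l] by blast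
  ultimately show ?thesis
    unfolding G_op_def membrane_def
    using C finite_tail[OF C] by (simp add: op_prod_X op_prod_Z pauli_mult)
qed

lemma U_op_eq:
  assumes s: "s \<in> cells d l"
  shows "{t \<in> cells d l. integral_cells d (cup1 l (ind t) (ind s)) = 1} = {t \<in> cells d l. odd (cup1_form t s)}"
    and "U_op d l \<alpha> s = hopping \<alpha> s"
proof -
  show set: "{t \<in> cells d l. integral_cells d (cup1 l (ind t) (ind s)) = 1} = {t \<in> cells d l. odd (cup1_form t s)}"
    using integral_cup1_ind_ind[OF _ s d_l] by blast
  show "U_op d l \<alpha> s = hopping \<alpha> s"
    unfolding U_op_def hopping_def set op_prod_Z[OF finite_hopping_tail[OF s]]
    using finite_hopping_tail[OF s] by (simp add: X_op_eq pauli_mult)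
qed

lemma Z_bar_eq:
  assumes s: "s \<in> cells d l"
  shows "Z_bar d l SpA s = Z_op SpA s * membrane SpB (coboundary_set (dual s))"
    and "Z_bar d l SpB s = Z_op SpB s * membrane SpA (coboundary_set (dual_inverse s))"
proof -
  have "{r \<in> cells d (l - 1). integral_cells d (cup l (ind s) (ind r)) = 1} = {dual s}"
    using integral_cup_ind[OF s] dual_l[OF s] by blast
  then show "Z_bar d l SpA s = Z_op SpA s * membrane SpB (coboundary_set (dual s))"
    by (simp add: Z_bar_def op_prod_singleton G_op_eq[OF dual_l[OF s]])
  have "s = dual r \<longleftrightarrow> r = dual_inverse s" if "r \<in> cells d (l - 1)" for r
    using dual_inverse_dual[OF that] dual_dual_inverse[OF s] by auto
  then have "{r \<in> cells d (l - 1). integral_cells d (cup (l - 1) (ind r) (ind s)) = 1} = {dual_inverse s}"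
    using integral_cup_ind[of _ "l - 1" s] dual_inverse_l[OF s] by blast
  then show "Z_bar d l SpB s = Z_op SpB s * membrane SpA (coboundary_set (dual_inverse s))"
    by (simp add: Z_bar_def op_prod_singleton G_op_eq[OF dual_inverse_l[OF s]])
qed

text \<open>
  A colour consists of the type of a cell and its position modulo eleven, so that the blocks of
  radius five around cells of the same colour are disjoint.
\<close>

lemma colouring: "\<exists>col K. coloured_lattice d l col K"
proof -
  define key where "key s = ((\<lambda>i. fst s i mod 11), snd s)" for s :: cell
  let ?P = "{v :: point. \<forall>i. (i \<in> {1..d} \<longrightarrow> v i \<in> {0..<11}) \<and> (i \<notin> {1..d} \<longrightarrow> v i = 0)}"
  have "finite ?P" by (rule finite_set_of_finite_funs) auto
  moreover have "key ` cells d l \<subseteq> ?P \<times> Pow {1..d}"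
    by (auto simp: key_def cells_def points_def)
  ultimately have "finite (key ` cells d l)" using finite_subset by blast
  then obtain f :: "point \<times> nat set \<Rightarrow> nat" and K where f: "f ` key ` cells d l = {i. i < K}" "inj_on f (key ` cells d l)"
    using finite_imp_inj_to_nat_seg by metis
  have "coloured_lattice d l (\<lambda>s. f (key s)) K"
  proof unfold_locales
    fix s assume "s \<in> cells d l"
    then show "f (key s) < K" using f(1) by blast
  next
    fix s t assume st: "s \<in> cells d l" "t \<in> cells d l" "s \<noteq> t" "f (key s) = f (key t)"
    then have key: "key s = key t" using inj_onD[OF f(2)] by blast
    show "\<not> near_cells 10 s t"
    proof
      assume near: "near_cells 10 s t"
      have "fst s = fst t"
      proof
        fix i
        have "fst s i mod 11 = fst t i mod 11" using key by (simp add: key_def fun_eq_iff)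
        moreover have "\<bar>fst s i - fst t i\<bar> \<le> 10" using near by (simp add: near_cells_def)
        ultimately show "fst s i = fst t i" by presburger
      qed
      moreover have "snd s = snd t" using key by (simp add: key_def)
      ultimately show False using st(3) by (simp add: prod_eq_iff)
    qed
  qed
  then show ?thesis by blast
qed

end

lemma qca_op_prod:
  assumes \<Phi>: "qca Q \<Phi>" and S: "finite S" and f: "\<And>i. i \<in> S \<Longrightarrow> f i \<in> local_ops Q"
    and g: "\<And>i. i \<in> S \<Longrightarrow> \<Phi> (f i) \<simeq> g i"
  shows "\<Phi> (op_prod f S) \<simeq> op_prod g S"
proof -
  define xs where "xs = (SOME xs. distinct xs \<and> set xs = S)"
  have "distinct xs \<and> set xs = S"
    unfolding xs_def by (rule someI_ex) (use finite_distinct_list[OF S] in blast)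
  then have xs: "set xs = S" ..
  have "\<Phi> (prod_list (map f ys)) = prod_list (map (\<lambda>i. \<Phi> (f i)) ys)" if "set ys \<subseteq> S" for ys
    using that
  proof (induction ys)
    case (Cons y ys)
    have "prod_list (map f ys) \<in> local_ops Q" by (rule local_ops_prod_list) (use Cons.prems f in auto)
    then show ?case using Cons f qca_mult[OF \<Phi>] by simp
  qed (simp add: qca_one[OF \<Phi>])
  then have "\<Phi> (op_prod f S) = prod_list (map (\<lambda>i. \<Phi> (f i)) xs)"
    using xs unfolding op_prod_def xs_def by blast
  also have "\<dots> \<simeq> prod_list (map g xs)" by (rule phase_eq_prod_list) (use g xs in auto)
  finally show ?thesis unfolding op_prod_def xs_def .
qed

lemma (in odd_lattice) circuit_exists:
  "\<exists>\<Phi>. qca (cell_qubits d l) \<Phi> \<and> finite_depth_circuit (cell_qubits d l) \<Phi> \<and>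
    (\<forall>\<alpha>. \<forall>s\<in>cells d l. \<Phi> (X_op \<alpha> s) \<simeq> X_bar d l \<alpha> s \<and> \<Phi> (Z_op \<alpha> s) \<simeq> Z_bar d l \<alpha> s)"
proof -
  obtain col K where "coloured_lattice d l col K" using colouring by blast
  then interpret coloured_lattice d l col K .
  let ?Q = "cell_qubits d l" and ?\<Phi> = "G.circuit K"
  have qca: "qca ?Q ?\<Phi>" by (rule G.qca_circuit)
  have Z: "?\<Phi> (Z_op \<alpha> s) \<simeq> Z_bar d l \<alpha> s" if s: "s \<in> cells d l" for \<alpha> s
    by (cases \<alpha>) (simp_all add: circuit_generators[OF s] Z_bar_eq[OF s] closed_membrane_def phase_eq_scale)
  have X: "?\<Phi> (X_op \<alpha> s) \<simeq> X_bar d l \<alpha> s" if s: "s \<in> cells d l" for \<alpha> s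
  proof -
    let ?S = "{t \<in> cells d l. odd (cup1_form t s)}"
    have S: "finite ?S" by (rule finite_hopping_tail[OF s])
    have "X_op \<alpha> s = hopping \<alpha> s * op_prod (Z_op \<alpha>) ?S"
      unfolding op_prod_Z[OF S] hopping_def X_op_eq using S by (simp add: pauli_mult)
    moreover have "op_prod (Z_op \<alpha>) ?S \<in> local_ops ?Q"
      unfolding op_prod_Z[OF S] by (rule pauli_subset_local) (use S in \<open>auto simp: Cell_Qubit_mem\<close>)
    ultimately have "?\<Phi> (X_op \<alpha> s) = hopping \<alpha> s * ?\<Phi> (op_prod (Z_op \<alpha>) ?S)"
      using qca_mult[OF qca hopping_cell[OF s]] circuit_generators(3)[OF s] by simp
    moreover have "?\<Phi> (op_prod (Z_op \<alpha>) ?S) \<simeq> op_prod (Z_bar d l \<alpha>) ?S"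
      by (rule qca_op_prod[OF qca S]) (use Z_op_cell Z in auto)
    ultimately show ?thesis
      unfolding X_bar_def U_op_eq[OF s] by (simp add: phase_eq_mult)
  qed
  show ?thesis using qca G.finite_depth_circuit X Z by blast
qed

section \<open>Signs\<close>

lemma foldr_comp: "foldr (\<circ>) fs g = foldr (\<circ>) fs id \<circ> g"
  by (induction fs) (auto simp: o_assoc)

text \<open>Conjugation by a product of single-qubit Pauli operators changes the signs of the generators at will.\<close>

lemma sign_layer:
  "\<exists>\<Lambda>. gate_layer Q \<Lambda> \<and> qca Q \<Lambda> \<and>
    (\<forall>q\<in>Q. \<Lambda> (pauli_X q) = (if q \<in> P then - pauli_X q else pauli_X q) \<and>
       \<Lambda> (pauli_Z q) = (if q \<in> P' then - pauli_Z q else pauli_Z q))"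
proof -
  let ?u = "\<lambda>q. pauli (if q \<in> P' then {q} else {}) (if q \<in> P then {q} else {})"
  have unitary: "unitary_op (?u q)" for q by (rule pauli_unitary) auto
  interpret disjoint_blocks Q Q ?u "\<lambda>q. {q}" 0
  proof unfold_locales
    show "?u q \<in> local_ops {q}" for q by (rule pauli_subset_local) auto
  qed (auto simp: unitary)
  have "act (pauli x z) = conjugate (?u q) (pauli x z)"
    if "q \<in> Q" "x \<subseteq> {q}" "z \<subseteq> {q}" for q x z
  proof -
    have "finite x" "finite z" using that finite_subset by auto
    then have "pauli x z \<in> local_ops {q}" using that by (intro pauli_subset_local)
    moreover have "meets {q} \<subseteq> set [q]" by (auto simp: meets_def)
    ultimately show ?thesis using act_eq[of "{q}" "pauli x z" "[q]"] that(1) by simp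
  qed
  moreover have "conjugate (?u q) (pauli_X q) = (if q \<in> P then - pauli_X q else pauli_X q)"
    "conjugate (?u q) (pauli_Z q) = (if q \<in> P' then - pauli_Z q else pauli_Z q)" for q
    by (rule conjugate_eqI[OF unitary];
        simp add: pauli_X_eq pauli_Z_eq pauli_mult scale_minus_one insert_commute)+
  ultimately have "act (pauli_X q) = (if q \<in> P then - pauli_X q else pauli_X q) \<and>
       act (pauli_Z q) = (if q \<in> P' then - pauli_Z q else pauli_Z q)" if "q \<in> Q" for q
    using that by (simp add: pauli_X_eq pauli_Z_eq)
  then show ?thesis using gate_layer_act qca_act by blast
qed

lemma scale_one_eq_one_iff: "scale c 1 = 1 \<longleftrightarrow> c = 1"
proof
  assume "scale c 1 = (1 :: 'a local_op)"
  then have "entry (scale c (1 :: 'a local_op)) (\<lambda>_. False) (\<lambda>_. False) = entry (1 :: 'a local_op) (\<lambda>_. False) (\<lambda>_. False)"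
    by simp
  then show "c = 1" by (simp add: scale.rep_eq one_local_op.rep_eq)
qed simp

text \<open>
  A phase between two involutions squares to one.
\<close>

lemma involution_sign:
  assumes "a \<simeq> b" "a * a = 1" "b * b = 1"
  shows "a = b \<or> a = - b"
proof -
  obtain c where c: "a = scale c b" using assms(1) unfolding phase_eq_def by blast
  then have "scale (c * c) (1 :: 'a local_op) = 1" using assms by simp
  then have "c * c = 1" by (simp only: scale_one_eq_one_iff)
  then have "c = 1 \<or> c = - 1" by algebra
  then show ?thesis using c by (auto simp: scale_minus_one)
qed

lemma qca_trivial:
  assumes qca: "qca (cell_qubits d l) \<Phi>" and circuit: "finite_depth_circuit (cell_qubits d l) \<Phi>"
  shows "trivial_qca d l \<Phi>"
proof -
  have anc: "ancillas d 0 = {}" by (auto simp: ancillas_def)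
  have "\<Phi> a = a" if "a \<in> local_ops {}" for a
  proof -
    obtain c where "a = (\<Sum>x\<in>Pow {}. \<Sum>z\<in>Pow {}. scale (c x z) (pauli x z))"
      using pauli_expansion[OF finite.emptyI \<open>a \<in> local_ops {}\<close>] by blast
    then have "a = scale (c {} {}) 1" by simp
    then show ?thesis using qca_scale[OF qca, of 1 "c {} {}"] qca_one[OF qca] by simp
  qed
  moreover have "circuits_and_shifts (cell_qubits d l) \<Phi>"
    unfolding circuits_and_shifts_def composite_def using circuit by (intro exI[of _ "[\<Phi>]"]) simp
  ultimately show ?thesis
    unfolding trivial_qca_def using qca by (intro exI[of _ 0] exI[of _ \<Phi>]) (simp add: anc)
qed

theorem mainTheorem2:
  fixes l d :: nat
  assumes "l \<ge> 3" and "odd l" and "d = 2 * l - 1"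
  shows "(\<exists>X' Z'. hermitian_images d l X' Z') \<and>
    (\<forall>X' Z'. hermitian_images d l X' Z' \<longrightarrow>
       (\<exists>\<Phi>. qca_given_by d l X' Z' \<Phi>) \<and>
       (\<forall>\<Phi>. qca_given_by d l X' Z' \<Phi> \<longrightarrow> trivial_qca d l \<Phi>))"
proof -
  interpret odd_lattice d l using assms by unfold_locales
  let ?Q = "cell_qubits d l"
  obtain \<Phi> where \<Phi>: "qca ?Q \<Phi>" "finite_depth_circuit ?Q \<Phi>" and
    images: "\<forall>\<alpha>. \<forall>s\<in>cells d l. \<Phi> (X_op \<alpha> s) \<simeq> X_bar d l \<alpha> s \<and> \<Phi> (Z_op \<alpha> s) \<simeq> Z_bar d l \<alpha> s"
    using circuit_exists by blast
  have local: "X_op \<alpha> s \<in> local_ops ?Q" "Z_op \<alpha> s \<in> local_ops ?Q" if "s \<in> cells d l" for \<alpha> s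
    unfolding X_op_eq Z_op_eq using that by (auto intro!: pauli_subset_local simp: Cell_Qubit_mem)
  have herm: "hermitian_involution (\<Phi> a)"
    if "a \<in> local_ops ?Q" "adjoint_op a = a" "a * a = 1" for a
    using qca_adjoint[OF \<Phi>(1) that(1)] qca_mult[OF \<Phi>(1) that(1,1)] qca_one[OF \<Phi>(1)] that
    by (simp add: hermitian_involution_def)
  have herm_gen: "hermitian_involution (\<Phi> (X_op \<alpha> s))" "hermitian_involution (\<Phi> (Z_op \<alpha> s))"
    if "s \<in> cells d l" for \<alpha> s
    by (rule herm[OF local(1)[OF that]], simp_all add: X_op_eq pauli_adjoint pauli_mult)
      (rule herm[OF local(2)[OF that]], simp_all add: Z_op_eq pauli_adjoint pauli_mult)
  have "hermitian_images d l (\<lambda>\<alpha> s. \<Phi> (X_op \<alpha> s)) (\<lambda>\<alpha> s. \<Phi> (Z_op \<alpha> s))"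
    unfolding hermitian_images_def using images herm_gen by (simp add: phase_eq_def)
  moreover have "(\<exists>\<Psi>. qca_given_by d l X' Z' \<Psi>) \<and> (\<forall>\<Psi>. qca_given_by d l X' Z' \<Psi> \<longrightarrow> trivial_qca d l \<Psi>)"
    if given: "hermitian_images d l X' Z'" for X' Z'
  proof -
    have X': "X' \<alpha> s = \<Phi> (X_op \<alpha> s) \<or> X' \<alpha> s = - \<Phi> (X_op \<alpha> s)"
      and Z': "Z' \<alpha> s = \<Phi> (Z_op \<alpha> s) \<or> Z' \<alpha> s = - \<Phi> (Z_op \<alpha> s)" if s: "s \<in> cells d l" for \<alpha> s
    proof -
      have "X' \<alpha> s \<simeq> X_bar d l \<alpha> s" "Z' \<alpha> s \<simeq> Z_bar d l \<alpha> s"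
        and inv: "X' \<alpha> s * X' \<alpha> s = 1" "Z' \<alpha> s * Z' \<alpha> s = 1"
        using given s unfolding hermitian_images_def hermitian_involution_def phase_eq_def by blast+
      then have "X' \<alpha> s \<simeq> \<Phi> (X_op \<alpha> s)" "Z' \<alpha> s \<simeq> \<Phi> (Z_op \<alpha> s)"
        using images s phase_eq_sym phase_eq_trans by blast+
      moreover have "\<Phi> (X_op \<alpha> s) * \<Phi> (X_op \<alpha> s) = 1" "\<Phi> (Z_op \<alpha> s) * \<Phi> (Z_op \<alpha> s) = 1"
        using herm_gen[OF s] by (simp_all add: hermitian_involution_def)
      ultimately show "X' \<alpha> s = \<Phi> (X_op \<alpha> s) \<or> X' \<alpha> s = - \<Phi> (X_op \<alpha> s)"
        "Z' \<alpha> s = \<Phi> (Z_op \<alpha> s) \<or> Z' \<alpha> s = - \<Phi> (Z_op \<alpha> s)"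
        using involution_sign inv by blast+
    qed
    let ?P = "{Cell_Qubit \<alpha> s | \<alpha> s. X' \<alpha> s \<noteq> \<Phi> (X_op \<alpha> s)}"
    let ?P' = "{Cell_Qubit \<alpha> s | \<alpha> s. Z' \<alpha> s \<noteq> \<Phi> (Z_op \<alpha> s)}"
    obtain \<Lambda> where \<Lambda>: "gate_layer ?Q \<Lambda>" "qca ?Q \<Lambda>" and
      signs: "\<forall>q\<in>?Q. \<Lambda> (pauli_X q) = (if q \<in> ?P then - pauli_X q else pauli_X q) \<and>
        \<Lambda> (pauli_Z q) = (if q \<in> ?P' then - pauli_Z q else pauli_Z q)"
      using sign_layer[of ?Q ?P ?P'] by blast
    have qca: "qca ?Q (\<Phi> \<circ> \<Lambda>)" by (rule qca_comp[OF \<Phi>(1) \<Lambda>(2)])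
    have neg: "\<Phi> (- a) = - \<Phi> a" if "a \<in> local_ops ?Q" for a
      using qca_scale[OF \<Phi>(1) that, of "- 1"] by (simp only: scale_minus_one)
    have generators: "(\<Phi> \<circ> \<Lambda>) (X_op \<alpha> s) = X' \<alpha> s" "(\<Phi> \<circ> \<Lambda>) (Z_op \<alpha> s) = Z' \<alpha> s"
      if s: "s \<in> cells d l" for \<alpha> s
    proof -
      have mem: "Cell_Qubit \<alpha> s \<in> ?Q" using s by (simp add: Cell_Qubit_mem)
      have "Cell_Qubit \<alpha> s \<in> ?P \<longleftrightarrow> X' \<alpha> s \<noteq> \<Phi> (X_op \<alpha> s)" "Cell_Qubit \<alpha> s \<in> ?P' \<longleftrightarrow> Z' \<alpha> s \<noteq> \<Phi> (Z_op \<alpha> s)"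
        by blast+
      with bspec[OF signs mem] have "\<Lambda> (X_op \<alpha> s) = (if X' \<alpha> s \<noteq> \<Phi> (X_op \<alpha> s) then - X_op \<alpha> s else X_op \<alpha> s)"
        "\<Lambda> (Z_op \<alpha> s) = (if Z' \<alpha> s \<noteq> \<Phi> (Z_op \<alpha> s) then - Z_op \<alpha> s else Z_op \<alpha> s)"
        unfolding X_op_def Z_op_def by (simp_all only:)
      then show "(\<Phi> \<circ> \<Lambda>) (X_op \<alpha> s) = X' \<alpha> s" "(\<Phi> \<circ> \<Lambda>) (Z_op \<alpha> s) = Z' \<alpha> s"
        using X'[OF s, of \<alpha>] Z'[OF s, of \<alpha>] neg local[OF s] by auto
    qed
    obtain \<Lambda>s where \<Lambda>s: "\<forall>\<Lambda>\<in>set \<Lambda>s. gate_layer ?Q \<Lambda>" "\<forall>a\<in>local_ops ?Q. \<Phi> a = foldr (\<circ>) \<Lambda>s id a"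
      using \<Phi>(2) unfolding finite_depth_circuit_def composite_def by blast
    have "trivial_qca d l \<Psi>" if \<Psi>: "qca_given_by d l X' Z' \<Psi>" for \<Psi>
    proof (rule qca_trivial)
      show q: "qca ?Q \<Psi>" using \<Psi> by (simp add: qca_given_by_def)
      have eq: "\<Psi> a = (\<Phi> \<circ> \<Lambda>) a" if "a \<in> local_ops ?Q" for a
      proof (rule qca_eqI[OF q qca _ _ that])
        fix q assume "q \<in> ?Q"
        then obtain \<alpha> s where q: "q = Cell_Qubit \<alpha> s" "s \<in> cells d l" unfolding cell_qubits_def by blast
        show "\<Psi> (pauli_X q) = (\<Phi> \<circ> \<Lambda>) (pauli_X q)" "\<Psi> (pauli_Z q) = (\<Phi> \<circ> \<Lambda>) (pauli_Z q)"
          using \<Psi> generators[OF q(2), of \<alpha>] q unfolding qca_given_by_def X_op_def Z_op_def by metis+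
      qed
      show "finite_depth_circuit ?Q \<Psi>"
        unfolding finite_depth_circuit_def composite_def
      proof (intro exI[of _ "\<Lambda>s @ [\<Lambda>]"] conjI ballI)
        show "gate_layer ?Q \<Lambda>'" if "\<Lambda>' \<in> set (\<Lambda>s @ [\<Lambda>])" for \<Lambda>' using that \<Lambda>s(1) \<Lambda>(1) by auto
        fix a assume a: "a \<in> local_ops ?Q"
        have "foldr (\<circ>) (\<Lambda>s @ [\<Lambda>]) id a = (foldr (\<circ>) \<Lambda>s id \<circ> \<Lambda>) a"
          by (simp add: foldr_comp[of \<Lambda>s \<Lambda>])
        then show "\<Psi> a = foldr (\<circ>) (\<Lambda>s @ [\<Lambda>]) id a"
          using eq[OF a] \<Lambda>s(2) qca_maps[OF \<Lambda>(2) a] by simp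
      qed
    qed
    moreover have "qca_given_by d l X' Z' (\<Phi> \<circ> \<Lambda>)"
      unfolding qca_given_by_def using qca generators by blast
    ultimately show ?thesis by blast
  qed
  ultimately show ?thesis by blast
qed

end
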